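(* Let $I$ be an interval, $t_0$ an interior point of $I$, $\alpha=(\alpha_1,\dots,\alpha_n)\in\mathbb{R}^n$, and $f_1,\dots,f_n\colon I\times\mathbb{R}^n\to\mathbb{R}$; write $\overline{f}(t,\overline{\mathbf{x}})=(f_1(t,\mathbf{x}),\dots,f_n(t,\mathbf{x}))^T$. Suppose (A) for every $\overline{\mathbf{x}}=(x_1,\dots,x_n)^T\in\mathcal{BLC}^n(I)$ and each $i$, the function $t\mapsto f_i(t,x_1(t),\dots,x_n(t))$ is Laplace continuous on $I$; and (B) there are a neighbourhood $U$ of $t_0$ in $I$ and a Lebesgue integrable function $v_{t_0}$ on $U$ such that for each $i=1,\dots,n$ and all $\overline{\mathbf{x}},\overline{\mathbf{y}}\in\mathcal{BLC}^n(I)$, \[|f_i(t,\mathbf{x}(t))-f_i(t,\mathbf{y}(t))|\leqslant v_{t_0}(t)\|\overline{\mathbf{x}}-\overline{\mathbf{y}}\|_{n,\infty}\quad\text{for a.e. }t\in U.\] Then there is $a>0$ with $[t_0-a,t_0+a]\subseteq U$ such that the initial value problem $LD_1\overline{\mathbf{x}}(t)=\overline{f}(t,\overline{\mathbf{x}}(t))$, $\overline{\mathbf{x}}(t_0)=\alpha^T$ has a unique solution on $[t_0-a,t_0+a]$.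
   Context: Laplace derivative: for $F$ Perron integrable near $x$, $LD_1F(x)$ is the common value, when both exist and are equal, of $\lim_{s\to\infty}s^2\int_0^\delta e^{-st}[F(x+t)-F(x)]dt$ and $\lim_{s\to\infty}(-s^2)\int_0^\delta e^{-st}[F(x-t)-F(x)]dt$ for some $\delta>0$ (one-sided at endpoints); $LD_1\overline{\mathbf{x}}=(LD_1x_1,\dots,LD_1x_n)^T$. Laplace integral: with lower/upper derivates defined by $\liminf$/$\limsup$ (minimum/maximum over sides), a major function of $h$ on $[c,d]$ is a continuous $W$ with $\underline{LD}_1W\geqslant h$, $\underline{LD}_1W>-\infty$ everywhere, a minor function a continuous $V$ with $\overline{LD}_1V\leqslant h$, $\overline{LD}_1V<\infty$ everywhere; $h$ is Laplace integrable if $\sup_V(V(d)-V(c))=\inf_W(W(d)-W(c))$ is finite. Laplace continuity: for $h$ Laplace integrable on a neighbourhood of $x$, $LD_0h(x)$ is the common value, when both exist and are equal, of $\lim_{s\to\infty}s\int_0^\delta e^{-st}h(x+t)dt$ and $\lim_{s\to\infty}s\int_0^\delta e^{-st}h(x-t)dt$; $h$ is Laplace continuous at $x$ if $LD_0h(x)=h(x)$. $\mathcal{BLC}(J)$ is the set of bounded Laplace continuous functions on an interval $J$ with the sup norm; $\mathcal{BLC}^n(J)$ is the set of column vectors $(x_1,\dots,x_n)^T$ with each $x_i\in\mathcal{BLC}(J)$, normed by $\|(x_1,\dots,x_n)^T\|_{n,\infty}=\max_i\sup_{t\in J}|x_i(t)|$. *)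

theory Defs
  imports "HOL-Analysis.Analysis"
begin

text \<open>Right / left Laplace expressions of F at x with cut-off delta:
  s^2 * int_0^delta e^{-st} [F(x+t) - F(x)] dt  and
  -s^2 * int_0^delta e^{-st} [F(x-t) - F(x)] dt  (Henstock-Kurzweil = Perron integral).\<close>

definition lapR1 :: "(real \<Rightarrow> real) \<Rightarrow> real \<Rightarrow> real \<Rightarrow> real \<Rightarrow> real" where
  "lapR1 F x \<delta> s = s\<^sup>2 * integral {0..\<delta>} (\<lambda>t. exp (- s * t) * (F (x + t) - F x))"

definition lapL1 :: "(real \<Rightarrow> real) \<Rightarrow> real \<Rightarrow> real \<Rightarrow> real \<Rightarrow> real" where
  "lapL1 F x \<delta> s = - (s\<^sup>2) * integral {0..\<delta>} (\<lambda>t. exp (- s * t) * (F (x - t) - F x))"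

definition has_right :: "real set \<Rightarrow> real \<Rightarrow> bool" where
  "has_right J x \<longleftrightarrow> (\<exists>y\<in>J. x < y)"

definition has_left :: "real set \<Rightarrow> real \<Rightarrow> bool" where
  "has_left J x \<longleftrightarrow> (\<exists>y\<in>J. y < x)"

definition has_LD1 :: "(real \<Rightarrow> real) \<Rightarrow> real set \<Rightarrow> real \<Rightarrow> real \<Rightarrow> bool" where
  "has_LD1 F J x L \<longleftrightarrow> x \<in> J \<and> (has_right J x \<or> has_left J x) \<and>
     (\<exists>\<delta>>0.
       (has_right J x \<longrightarrow> {x..x+\<delta>} \<subseteq> J \<and> F integrable_on {x..x+\<delta>} \<and>
           ((lapR1 F x \<delta>) \<longlongrightarrow> L) at_top) \<and>
       (has_left J x \<longrightarrow> {x-\<delta>..x} \<subseteq> J \<and> F integrable_on {x-\<delta>..x} \<and>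
           ((lapL1 F x \<delta>) \<longlongrightarrow> L) at_top))"

text \<open>Lower / upper Laplace derivates of W at x relative to [c,d]: liminf / limsup,
  minimum / maximum over the available sides. The cut-off is taken as the distance to the
  endpoint (the value does not depend on the cut-off for continuous W).\<close>

definition lower_LD1 :: "(real \<Rightarrow> real) \<Rightarrow> real \<Rightarrow> real \<Rightarrow> real \<Rightarrow> ereal" where
  "lower_LD1 W c d x =
     min (if x < d then Liminf at_top (\<lambda>s. ereal (lapR1 W x (d - x) s)) else \<infinity>)
         (if c < x then Liminf at_top (\<lambda>s. ereal (lapL1 W x (x - c) s)) else \<infinity>)"

definition upper_LD1 :: "(real \<Rightarrow> real) \<Rightarrow> real \<Rightarrow> real \<Rightarrow> real \<Rightarrow> ereal" where
  "upper_LD1 W c d x =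
     max (if x < d then Limsup at_top (\<lambda>s. ereal (lapR1 W x (d - x) s)) else - \<infinity>)
         (if c < x then Limsup at_top (\<lambda>s. ereal (lapL1 W x (x - c) s)) else - \<infinity>)"

definition major_fun :: "(real \<Rightarrow> real) \<Rightarrow> real \<Rightarrow> real \<Rightarrow> (real \<Rightarrow> real) \<Rightarrow> bool" where
  "major_fun h c d W \<longleftrightarrow> continuous_on {c..d} W \<and>
     (\<forall>x\<in>{c..d}. lower_LD1 W c d x \<ge> ereal (h x) \<and> lower_LD1 W c d x > - \<infinity>)"

definition minor_fun :: "(real \<Rightarrow> real) \<Rightarrow> real \<Rightarrow> real \<Rightarrow> (real \<Rightarrow> real) \<Rightarrow> bool" where
  "minor_fun h c d V \<longleftrightarrow> continuous_on {c..d} V \<and>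
     (\<forall>x\<in>{c..d}. upper_LD1 V c d x \<le> ereal (h x) \<and> upper_LD1 V c d x < \<infinity>)"

definition laplace_integrable :: "(real \<Rightarrow> real) \<Rightarrow> real \<Rightarrow> real \<Rightarrow> bool" where
  "laplace_integrable h c d \<longleftrightarrow>
     (SUP V\<in>{V. minor_fun h c d V}. ereal (V d - V c)) =
     (INF W\<in>{W. major_fun h c d W}. ereal (W d - W c)) \<and>
     \<bar>INF W\<in>{W. major_fun h c d W}. ereal (W d - W c)\<bar> \<noteq> \<infinity>"

definition laplace_integral :: "(real \<Rightarrow> real) \<Rightarrow> real \<Rightarrow> real \<Rightarrow> real" where
  "laplace_integral h c d = real_of_ereal (INF W\<in>{W. major_fun h c d W}. ereal (W d - W c))"

definition laplace_integrable_near :: "(real \<Rightarrow> real) \<Rightarrow> real set \<Rightarrow> real \<Rightarrow> bool" where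
  "laplace_integrable_near h J x \<longleftrightarrow>
     (\<exists>c d \<epsilon>. c < d \<and> {c..d} \<subseteq> J \<and> \<epsilon> > 0 \<and> J \<inter> ball x \<epsilon> \<subseteq> {c..d} \<and>
        laplace_integrable h c d)"

definition has_LD0 :: "(real \<Rightarrow> real) \<Rightarrow> real set \<Rightarrow> real \<Rightarrow> real \<Rightarrow> bool" where
  "has_LD0 h J x L \<longleftrightarrow> x \<in> J \<and> (has_right J x \<or> has_left J x) \<and>
     laplace_integrable_near h J x \<and>
     (\<exists>\<delta>>0.
       (has_right J x \<longrightarrow> {x..x+\<delta>} \<subseteq> J \<and>
          (\<forall>s>0. laplace_integrable (\<lambda>t. exp (- s * t) * h (x + t)) 0 \<delta>) \<and>
          ((\<lambda>s. s * laplace_integral (\<lambda>t. exp (- s * t) * h (x + t)) 0 \<delta>) \<longlongrightarrow> L) at_top) \<and>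
       (has_left J x \<longrightarrow> {x-\<delta>..x} \<subseteq> J \<and>
          (\<forall>s>0. laplace_integrable (\<lambda>t. exp (- s * t) * h (x - t)) 0 \<delta>) \<and>
          ((\<lambda>s. s * laplace_integral (\<lambda>t. exp (- s * t) * h (x - t)) 0 \<delta>) \<longlongrightarrow> L) at_top))"

definition laplace_continuous_at :: "(real \<Rightarrow> real) \<Rightarrow> real set \<Rightarrow> real \<Rightarrow> bool" where
  "laplace_continuous_at h J x \<longleftrightarrow> has_LD0 h J x (h x)"

definition laplace_continuous_on :: "(real \<Rightarrow> real) \<Rightarrow> real set \<Rightarrow> bool" where
  "laplace_continuous_on h J \<longleftrightarrow> (\<forall>x\<in>J. laplace_continuous_at h J x)"

definition BLC :: "real set \<Rightarrow> (real \<Rightarrow> real) set" where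
  "BLC J = {h. bounded (h ` J) \<and> laplace_continuous_on h J}"

definition BLCn :: "real set \<Rightarrow> (real \<Rightarrow> real ^ 'n) set" where
  "BLCn J = {x. \<forall>i. (\<lambda>t. x t $ i) \<in> BLC J}"

definition norm_n_inf :: "real set \<Rightarrow> (real \<Rightarrow> real ^ 'n) \<Rightarrow> real" where
  "norm_n_inf J x = Max (range (\<lambda>i. SUP t\<in>J. \<bar>x t $ i\<bar>))"

definition is_LD_solution ::
    "(real \<Rightarrow> real ^ 'n \<Rightarrow> real ^ 'n) \<Rightarrow> real \<Rightarrow> real ^ 'n \<Rightarrow> real set \<Rightarrow> (real \<Rightarrow> real ^ 'n) \<Rightarrow> bool" where
  "is_LD_solution f t0 \<alpha> J x \<longleftrightarrow> x t0 = \<alpha> \<and>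
     (\<forall>t\<in>J. \<forall>i. has_LD1 (\<lambda>s. x s $ i) J t (f t (x t) $ i))"

end

theory Submission
  imports Defs "HOL-Real_Asymp.Real_Asymp"
begin

text \<open>
  Existence is Picard iteration: by (B) the Laplace primitives of \<open>f(t, x(t))\<close> and \<open>f(t, y(t))\<close>
  differ by at most \<open>\<parallel>x - y\<parallel> \<integral>|v|\<close>, and the primitive of a Laplace continuous function has that
  function as its Laplace derivative. Uniqueness is subtler, since a competing solution need be
  neither continuous nor bounded, so that (A) and (B) do not apply to it. Testing (B) on constants
  shows that for \<^emph>\<open>every\<close> \<open>t\<close> the map \<open>f(t, \<cdot>)\<close> is Lipschitz with constant the lower Laplace
  derivate of \<open>\<Phi> = \<integral>|v|\<close>. A function with nonnegative lower Laplace derivate is nondecreasing, without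
  any continuity assumption beyond Laplace continuity; hence the difference \<open>z\<close> of two solutions
  satisfies \<open>|z(d) - z(c)| \<le> sup |z| (\<Phi>(d) - \<Phi>(c))\<close>, and a Baire category argument shows that \<open>z\<close>
  is bounded.
\<close>

section \<open>Laplace averages\<close>

text \<open>Solutions are only known to be Henstock-Kurzweil integrable, so averages, tails and
  boundary terms are controlled by the second mean value theorem and not by absolute integrability.
  This also shapes the monotonicity theorem: a function with nonnegative lower derivate need not a
  priori attain a maximum, so Rolle's argument is run on its primitive minus a chord, which is
  continuous. Similarly, a Laplace primitive need not be absolutely continuous, so the almost
  everywhere bound (B) cannot simply be integrated; it is compared with a continuous majorant whose
  integral error is small and whose slope is as large as desired on the exceptional null set. For
  two constants, the resulting estimate of increments combines with the Laplace continuity from (A)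
  to an estimate at every single point. The interval is chosen so that n times
  \<open>\<integral>|v|\<close> is at most 1/2, n being the dimension: this number is the
  contraction constant of the Picard operator, and absorbing it in the uniqueness estimate yields
  the factor 2 there.\<close>

definition lap :: "(real \<Rightarrow> real) \<Rightarrow> real \<Rightarrow> real \<Rightarrow> real" where
  "lap g \<delta> s = integral {0..\<delta>} (\<lambda>t. exp (- s * t) * g t)"

lemma lapR1_eq_lap: "lapR1 F x \<delta> s = s\<^sup>2 * lap (\<lambda>t. F (x + t) - F x) \<delta> s"
  by (simp add: lapR1_def lap_def)

text \<open>Bounded factors can destroy Henstock-Kurzweil integrability, monotone ones cannot: the
  second mean value theorem for the exponential weight yields integrability of the product together
  with its value.\<close>

lemma exp_mult_has_integral_mean_value:
  fixes g :: "real \<Rightarrow> real"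
  assumes "g integrable_on {a..b}" "a \<le> b" "0 \<le> s"
  obtains c where "c \<in> {a..b}"
    "((\<lambda>t. exp (- s * t) * g t) has_integral
       exp (- s * a) * integral {a..c} g + exp (- s * b) * integral {c..b} g) {a..b}"
proof -
  \<comment> \<open>The mean value theorem is stated for increasing weights, so it is applied to the
    negated exponential.\<close>
  have mono: "- exp (- s * x) \<le> - exp (- s * y)" if "a \<le> x" "x \<le> y" "y \<le> b" for x y
    using that assms(3) by (simp add: mult_left_mono)
  obtain c where c: "c \<in> {a..b}"
    and h: "((\<lambda>t. - exp (- s * t) * g t) has_integral
       - exp (- s * a) * integral {a..c} g + - exp (- s * b) * integral {c..b} g) {a..b}"
    using second_mean_value_theorem_full[OF assms(1,2), of "\<lambda>t. - exp (- s * t)"] mono by blast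
  from has_integral_neg[OF h] show thesis
    by (intro that[OF c]) (simp add: algebra_simps)
qed

lemma exp_mult_integrable:
  fixes g :: "real \<Rightarrow> real"
  assumes "g integrable_on {a..b}" "0 \<le> s"
  shows "(\<lambda>t. exp (- s * t) * g t) integrable_on {a..b}"
proof (cases "a \<le> b")
  case True
  with exp_mult_has_integral_mean_value[OF assms(1) True assms(2)] show ?thesis
    by (metis has_integral_integrable)
qed auto

lemma lap_add:
  assumes "g integrable_on {0..\<delta>}" "h integrable_on {0..\<delta>}" "0 \<le> s"
  shows "lap (\<lambda>t. g t + h t) \<delta> s = lap g \<delta> s + lap h \<delta> s"
  using exp_mult_integrable[OF assms(1,3)] exp_mult_integrable[OF assms(2,3)]
  by (simp add: lap_def algebra_simps integral_add)

lemma lap_cmult: "lap (\<lambda>t. k * g t) \<delta> s = k * lap g \<delta> s"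
proof -
  have "(\<lambda>t. exp (- s * t) * (k * g t)) = (\<lambda>t. k * (exp (- s * t) * g t))" by (auto simp: mult_ac)
  then show ?thesis by (simp add: lap_def)
qed

lemma lap_uminus: "lap (\<lambda>t. - g t) \<delta> s = - lap g \<delta> s"
  using lap_cmult[of "-1"] by simp

lemma lap_cong: "(\<And>t. 0 \<le> t \<Longrightarrow> t \<le> \<delta> \<Longrightarrow> g t = h t) \<Longrightarrow> lap g \<delta> s = lap h \<delta> s"
  unfolding lap_def by (rule integral_cong) auto

lemma lap_mono:
  assumes "g integrable_on {0..\<delta>}" "h integrable_on {0..\<delta>}" "0 \<le> s"
    "\<And>t. 0 \<le> t \<Longrightarrow> t \<le> \<delta> \<Longrightarrow> g t \<le> h t"
  shows "lap g \<delta> s \<le> lap h \<delta> s"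
  unfolding lap_def
  by (rule integral_le) (use assms exp_mult_integrable in \<open>auto intro!: mult_left_mono\<close>)

text \<open>On \<open>{\<delta>'..\<delta>}\<close> the weight is at most
  \<open>exp (- s * \<delta>')\<close>, and the second mean value theorem bounds the tail by this
  factor times a bound for the continuous primitive of \<open>g\<close>; the exponential beats every
  power of \<open>s\<close>. Hence Laplace limits do not depend on the cut-off.\<close>

lemma lap_cutoff:
  assumes g: "g integrable_on {0..\<delta>}" and d: "0 < \<delta>'" "\<delta>' \<le> \<delta>"
  shows "((\<lambda>s. s ^ k * (lap g \<delta> s - lap g \<delta>' s)) \<longlongrightarrow> 0) at_top"
proof -
  have g': "g integrable_on {\<delta>'..\<delta>}"
    using g d by (auto intro: integrable_on_subinterval)
  have "bounded ((\<lambda>c. integral {\<delta>'..c} g) ` {\<delta>'..\<delta>})"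
    using indefinite_integral_continuous_1[OF g'] compact_continuous_image compact_imp_bounded
    by blast
  then obtain B where "\<forall>c\<in>{\<delta>'..\<delta>}. \<bar>integral {\<delta>'..c} g\<bar> \<le> B"
    by (auto simp: bounded_iff)
  then have B: "\<And>c. c \<in> {\<delta>'..\<delta>} \<Longrightarrow> \<bar>integral {\<delta>'..c} g\<bar> \<le> B" by blast
  \<comment> \<open>\<open>B\<close> comes from the first mean value term and \<open>2 * B\<close>
    from the second, whose integral over \<open>{c..\<delta>}\<close> is a difference of two values
    of the primitive.\<close>
  have bound: "\<bar>lap g \<delta> s - lap g \<delta>' s\<bar> \<le> 3 * B * exp (- s * \<delta>')" if s: "0 \<le> s" for s
  proof -
    let ?e = "\<lambda>t. exp (- s * t) * g t"
    have "lap g \<delta>' s + integral {\<delta>'..\<delta>} ?e = lap g \<delta> s"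
      unfolding lap_def
      by (rule Henstock_Kurzweil_Integration.integral_combine)
        (use d exp_mult_integrable[OF g that] in auto)
    moreover obtain c where c: "c \<in> {\<delta>'..\<delta>}" and
      "(?e has_integral exp (- s * \<delta>') * integral {\<delta>'..c} g + exp (- s * \<delta>) * integral {c..\<delta>} g)
         {\<delta>'..\<delta>}"
      using exp_mult_has_integral_mean_value[OF g' d(2) s] by blast
    moreover have "integral {\<delta>'..c} g + integral {c..\<delta>} g = integral {\<delta>'..\<delta>} g"
      using c g' by (intro Henstock_Kurzweil_Integration.integral_combine) auto
    ultimately have eq: "lap g \<delta> s - lap g \<delta>' s = exp (- s * \<delta>') * integral {\<delta>'..c} g
        + exp (- s * \<delta>) * (integral {\<delta>'..\<delta>} g - integral {\<delta>'..c} g)"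
      by (metis (no_types, lifting) add_diff_cancel_left' integral_unique)
    have le: "exp (- s * \<delta>) \<le> exp (- s * \<delta>')" using that d by (simp add: mult_left_mono)
    have "\<bar>exp (- s * \<delta>') * integral {\<delta>'..c} g\<bar> \<le> exp (- s * \<delta>') * B"
      using B[OF c] by (simp add: abs_mult)
    moreover have "\<bar>exp (- s * \<delta>) * (integral {\<delta>'..\<delta>} g - integral {\<delta>'..c} g)\<bar>
        \<le> exp (- s * \<delta>') * (2 * B)"
      unfolding abs_mult
      by (rule mult_mono) (use le B[OF c] B[of \<delta>] d in auto)
    ultimately show ?thesis unfolding eq by (simp add: algebra_simps)
  qed
  have lim: "((\<lambda>s. s ^ k * (3 * B * exp (- s * \<delta>'))) \<longlongrightarrow> 0) at_top"
    using d(1) by real_asymp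
  show ?thesis
  proof (rule Lim_null_comparison[OF _ lim])
    show "\<forall>\<^sub>F s in at_top. norm (s ^ k * (lap g \<delta> s - lap g \<delta>' s)) \<le> s ^ k * (3 * B * exp (- s * \<delta>'))"
      using eventually_ge_at_top[of 0]
      by eventually_elim (use bound in \<open>auto simp: abs_mult intro!: mult_left_mono\<close>)
  qed
qed

section \<open>Laplace averages of constants and linear functions\<close>

lemma lap_const: "0 \<le> \<delta> \<Longrightarrow> s \<noteq> 0 \<Longrightarrow> lap (\<lambda>t. r) \<delta> s = r * (1 - exp (- s * \<delta>)) / s"
proof -
  assume a: "0 \<le> \<delta>" "s \<noteq> 0"
  have "((\<lambda>t. exp (- s * t) * r) has_integral
      (- r * exp (- s * \<delta>) / s) - (- r * exp (- s * 0) / s)) {0..\<delta>}"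
    by (rule fundamental_theorem_of_calculus[OF a(1)])
      (use a in \<open>auto intro!: derivative_eq_intros
         simp: has_real_derivative_iff_has_vector_derivative[symmetric]\<close>)
  from integral_unique[OF this] show ?thesis unfolding lap_def
    by (rule trans) (use a in \<open>simp add: field_simps\<close>)
qed

lemma lap_linear: "0 \<le> \<delta> \<Longrightarrow> s \<noteq> 0 \<Longrightarrow>
  lap (\<lambda>t. r * t) \<delta> s = r * (1 - (1 + s * \<delta>) * exp (- s * \<delta>)) / s\<^sup>2"
proof -
  assume a: "0 \<le> \<delta>" "s \<noteq> 0"
  have "((\<lambda>t. exp (- s * t) * (r * t)) has_integral
      (- r * (1 + s * \<delta>) * exp (- s * \<delta>) / s\<^sup>2) - (- r * (1 + s * 0) * exp (- s * 0) / s\<^sup>2)) {0..\<delta>}"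
    by (rule fundamental_theorem_of_calculus[OF a(1)])
      (use a in \<open>auto intro!: derivative_eq_intros
         simp: has_real_derivative_iff_has_vector_derivative[symmetric] field_simps power2_eq_square\<close>)
  from integral_unique[OF this] show ?thesis unfolding lap_def
    by (rule trans) (use a in \<open>simp add: field_simps\<close>)
qed

lemma lap_linear_tendsto:
  assumes "0 < \<delta>" shows "((\<lambda>s. s\<^sup>2 * lap (\<lambda>t. r * t) \<delta> s) \<longlongrightarrow> r) at_top"
proof (rule Lim_transform_eventually)
  show "((\<lambda>s. r * (1 - (1 + s * \<delta>) * exp (- s * \<delta>))) \<longlongrightarrow> r) at_top"
    using assms by real_asymp
  show "\<forall>\<^sub>F s in at_top. r * (1 - (1 + s * \<delta>) * exp (- s * \<delta>)) = s\<^sup>2 * lap (\<lambda>t. r * t) \<delta> s"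
    using eventually_gt_at_top[of 0] by eventually_elim (use assms in \<open>simp add: lap_linear\<close>)
qed

lemma lap_const_tendsto:
  assumes "0 < \<delta>" shows "((\<lambda>s. s * lap (\<lambda>t. r) \<delta> s) \<longlongrightarrow> r) at_top"
proof (rule Lim_transform_eventually)
  show "((\<lambda>s. r * (1 - exp (- s * \<delta>))) \<longlongrightarrow> r) at_top"
    using assms by real_asymp
  show "\<forall>\<^sub>F s in at_top. r * (1 - exp (- s * \<delta>)) = s * lap (\<lambda>t. r) \<delta> s"
    using eventually_gt_at_top[of 0] by eventually_elim (use assms in \<open>simp add: lap_const\<close>)
qed

text \<open>Integration by parts for Henstock--Kurzweil integrands, whose primitive need not be
  differentiable: by the second mean value theorem the defect is a function of the upper limit
  whose increments are \<open>o(k)\<close>, hence constant.\<close>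

lemma lap_by_parts:
  assumes g: "g integrable_on {0..\<delta>}" and d: "0 \<le> \<delta>" and s: "0 \<le> s"
  shows "lap g \<delta> s = exp (- s * \<delta>) * integral {0..\<delta>} g + s * lap (\<lambda>t. integral {0..t} g) \<delta> s"
proof -
  define G where "G t = integral {0..t} g" for t
  have contG: "continuous_on {0..\<delta>} G"
    unfolding G_def using g by (rule indefinite_integral_continuous_1)
  have ucG: "uniformly_continuous_on {0..\<delta>} G"
    using contG compact_uniformly_continuous by blast
  have intG: "G integrable_on {0..\<delta>}" using contG by (rule integrable_continuous_real)
  let ?e = "\<lambda>t. exp (- s * t) * g t" and ?E = "\<lambda>t. exp (- s * t) * G t"
  have ie: "?e integrable_on {0..\<delta>}" and iE: "?E integrable_on {0..\<delta>}"
    using g intG s exp_mult_integrable by auto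
  define Q where "Q y = integral {0..y} ?e - exp (- s * y) * G y - s * integral {0..y} ?E" for y
  have step: "\<bar>Q y - Q x\<bar> \<le> s * e * (y - x)"
    if xy: "0 \<le> x" "x \<le> y" "y \<le> \<delta>" and e: "\<And>u w. u \<in> {x..y} \<Longrightarrow> w \<in> {x..y} \<Longrightarrow> \<bar>G u - G w\<bar> \<le> e"
    for x y e
  proof -
    have sub: "{x..y} \<subseteq> {0..\<delta>}" using xy by auto
    have gi: "g integrable_on {x..y}" and ei: "?e integrable_on {x..y}" and Ei: "?E integrable_on {x..y}"
      using g ie iE sub integrable_on_subinterval by blast+
    obtain c where c: "c \<in> {x..y}" and
      hi: "(?e has_integral exp (- s * x) * integral {x..c} g + exp (- s * y) * integral {c..y} g) {x..y}"
      using exp_mult_has_integral_mean_value[OF gi xy(2) s] by blast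
    have sp: "G u + integral {u..w} g = G w" if "x \<le> u" "u \<le> w" "w \<le> y" for u w
      unfolding G_def
      by (rule Henstock_Kurzweil_Integration.integral_combine)
        (use that xy g in \<open>auto intro: integrable_on_subinterval\<close>)
    have i1: "integral {x..c} g = G c - G x" and i2: "integral {c..y} g = G y - G c"
      using sp[of x c] sp[of c y] c by auto
    have ce: "integral {0..x} ?e + integral {x..y} ?e = integral {0..y} ?e"
      by (rule Henstock_Kurzweil_Integration.integral_combine)
        (use xy ie in \<open>auto intro: integrable_on_subinterval\<close>)
    have cE: "integral {0..x} ?E + integral {x..y} ?E = integral {0..y} ?E"
      by (rule Henstock_Kurzweil_Integration.integral_combine)
        (use xy iE in \<open>auto intro: integrable_on_subinterval\<close>)
    have Q: "Q y - Q x = integral {x..y} ?e - exp (- s * y) * G y + exp (- s * x) * G x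
        - s * integral {x..y} ?E"
      unfolding Q_def ce[symmetric] cE[symmetric] by (simp only: algebra_simps)
    have fe: "((\<lambda>t. s * exp (- s * t)) has_integral (- exp (- s * y)) - (- exp (- s * x))) {x..y}"
      by (rule fundamental_theorem_of_calculus[OF xy(2)])
        (auto intro!: derivative_eq_intros simp: has_real_derivative_iff_has_vector_derivative[symmetric])
    \<comment> \<open>Freezing \<open>G\<close> at the mean value point \<open>c\<close> writes the
      increment of \<open>Q\<close> as the integral of
      \<open>s * exp (- s * t) * (G c - G t)\<close>, which is small because \<open>G\<close>
      oscillates little on a short interval.\<close>
    have "((\<lambda>t. G c * (s * exp (- s * t)) - s * ?E t) has_integral
        G c * (- exp (- s * y) - - exp (- s * x)) - s * integral {x..y} ?E) {x..y}"
      by (intro has_integral_diff has_integral_mult_right fe integrable_integral Ei)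
    moreover have "(\<lambda>t. G c * (s * exp (- s * t)) - s * ?E t) = (\<lambda>t. s * exp (- s * t) * (G c - G t))"
      by (auto simp: algebra_simps)
    moreover have "G c * (- exp (- s * y) - - exp (- s * x)) - s * integral {x..y} ?E = Q y - Q x"
      unfolding Q integral_unique[OF hi] i1 i2 by (simp add: algebra_simps)
    ultimately have h: "((\<lambda>t. s * exp (- s * t) * (G c - G t)) has_integral Q y - Q x) {x..y}"
      by simp
    have e0: "0 \<le> e" using e[of x x] xy by auto
    have "norm (Q y - Q x) \<le> (s * e) * Henstock_Kurzweil_Integration.content {x..y}"
    proof (rule has_integral_bound_real[OF _ _ h])
      show "norm (s * exp (- s * t) * (G c - G t)) \<le> s * e" if "t \<in> {x..y} - {}" for t
      proof -
        have "exp (- s * t) \<le> 1" using that xy s by simp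
        then have "exp (- s * t) * \<bar>G c - G t\<bar> \<le> 1 * e"
          by (intro mult_mono) (use e[of c t] that c in auto)
        then show ?thesis using s by (simp add: abs_mult mult.assoc mult_left_mono)
      qed
    qed (use e0 s in auto)
    then show ?thesis using xy by simp
  qed
  have const: "Q \<delta> = Q 0"
  proof (rule ccontr)
    assume that: "Q \<delta> \<noteq> Q 0"
      have dpos: "\<delta> > 0" using d that by (cases "\<delta> = 0") auto
      \<comment> \<open>With this value \<open>s * e * \<delta>\<close> is at most half of the
        supposed nonzero increment; the summand 1 keeps the denominator positive for
        \<open>s = 0\<close>.\<close>
      define e where "e = \<bar>Q \<delta> - Q 0\<bar> / (2 * (s * \<delta> + 1))"
      have sd: "s * \<delta> + 1 > 0" using s dpos by (simp add: add_nonneg_pos)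
      have epos: "e > 0" unfolding e_def using that sd by simp
      obtain k where k: "k > 0" "\<And>u w. u \<in> {0..\<delta>} \<Longrightarrow> w \<in> {0..\<delta>} \<Longrightarrow> dist w u < k \<Longrightarrow> dist (G w) (G u) < e"
        using ucG epos unfolding uniformly_continuous_on_def by metis
      let ?P = "\<lambda>a b. 0 \<le> a \<and> a \<le> b \<and> b \<le> \<delta> \<longrightarrow> \<bar>Q b - Q a\<bar> \<le> s * e * (b - a)"
      \<comment> \<open>The increment bound is additive over adjacent intervals and holds on short
        ones by uniform continuity of \<open>G\<close>, so bisection extends it to the whole
        interval.\<close>
      have "?P 0 \<delta>"
        using d
      proof (rule Bolzano[where P = ?P])
        fix a b c assume ab: "?P a b" and bc: "?P b c" and abc: "a \<le> b" "b \<le> c"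
        have "s * e * (c - a) = s * e * (b - a) + s * e * (c - b)" by (simp add: algebra_simps)
        then show "?P a c" using ab bc abc by linarith
      next
        fix x
        have "\<bar>Q b - Q a\<bar> \<le> s * e * (b - a)"
          if ab: "b - a < k" "0 \<le> a" "a \<le> b" "b \<le> \<delta>" for a b
        proof (rule step[OF ab(2-4)])
          fix u w assume "u \<in> {a..b}" "w \<in> {a..b}"
          then have "dist (G u) (G w) < e"
            by (intro k(2)) (use ab in \<open>auto simp: dist_real_def\<close>)
          then show "\<bar>G u - G w\<bar> \<le> e" by (simp add: dist_real_def)
        qed
        then show "\<exists>d>0. \<forall>a b. a \<le> x \<and> x \<le> b \<and> b - a < d \<longrightarrow> ?P a b"
          using k(1) by blast
      qed
      then have "\<bar>Q \<delta> - Q 0\<bar> \<le> s * e * \<delta>" using d by simp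
      also have "\<dots> < \<bar>Q \<delta> - Q 0\<bar>"
      proof -
        have "s * e * \<delta> \<le> e * (s * \<delta> + 1)" using epos by (simp add: algebra_simps)
        also have "\<dots> = \<bar>Q \<delta> - Q 0\<bar> / 2" unfolding e_def using sd by (simp add: field_simps)
        also have "\<dots> < \<bar>Q \<delta> - Q 0\<bar>" using that by simp
        finally show ?thesis by simp
      qed
      finally show False by simp
  qed
  have "Q 0 = 0" unfolding Q_def G_def by simp
  with const show ?thesis unfolding Q_def lap_def G_def by simp
qed

section \<open>One-sided lower Laplace derivates\<close>

text \<open>The lower right Laplace derivate is at least the real \<open>r\<close>, expressed
  without extended reals. Upper and left derivates are reduced to this predicate by negation and
  reflection.\<close>

definition right_LD_ge :: "(real \<Rightarrow> real) \<Rightarrow> real \<Rightarrow> real \<Rightarrow> real \<Rightarrow> bool" where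
  "right_LD_ge F x \<delta> r \<longleftrightarrow> (\<forall>r'<r. \<forall>\<^sub>F s in at_top. r' < lapR1 F x \<delta> s)"

text \<open>Division by \<open>s\<close> leaves the prefactor \<open>s\<close> instead of its
  square, so this is Laplace continuity of \<open>F\<close> from the right, with Henstock-Kurzweil
  averages in place of Laplace integrals.\<close>

definition right_lap_cont :: "(real \<Rightarrow> real) \<Rightarrow> real \<Rightarrow> real \<Rightarrow> bool" where
  "right_lap_cont F x \<delta> \<longleftrightarrow> ((\<lambda>s. lapR1 F x \<delta> s / s) \<longlongrightarrow> 0) at_top"

text \<open>Statements about left derivates are statements about right derivates of the reflection.\<close>

definition reflect :: "(real \<Rightarrow> real) \<Rightarrow> real \<Rightarrow> real" where
  "reflect F = (\<lambda>u. - F (- u))"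

lemma reflect_reflect [simp]: "reflect (reflect F) = F"
  by (simp add: reflect_def)

lemma lapL1_eq_lapR1_reflect: "lapL1 F x \<delta> s = lapR1 (reflect F) (- x) \<delta> s"
proof -
  have "(\<lambda>t. exp (- s * t) * (reflect F (- x + t) - reflect F (- x))) =
      (\<lambda>t. - (exp (- s * t) * (F (x - t) - F x)))"
    by (auto simp: reflect_def algebra_simps)
  then show ?thesis by (simp add: lapL1_def lapR1_def)
qed

section \<open>Integrals under reflection and translation\<close>

lemma has_integral_reflect:
  "((reflect F) has_integral - I) {- b..- a} \<longleftrightarrow> (F has_integral I) {a..b}"
  unfolding reflect_def by (simp add: has_integral_neg_iff has_integral_reflect_real)

lemma integrable_reflect: "reflect F integrable_on {- b..- a} \<longleftrightarrow> F integrable_on {a..b}"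
proof
  assume "reflect F integrable_on {- b..- a}"
  then obtain I where "(reflect F has_integral - (- I)) {- b..- a}"
    unfolding integrable_on_def by auto
  then show "F integrable_on {a..b}" unfolding has_integral_reflect by blast
next
  assume "F integrable_on {a..b}"
  then show "reflect F integrable_on {- b..- a}"
    unfolding integrable_on_def using has_integral_reflect by blast
qed

lemma integral_reflect: "integral {- b..- a} (reflect F) = - integral {a..b} F"
proof (cases "F integrable_on {a..b}")
  case True
  then show ?thesis using has_integral_reflect[of F _ b a] integrable_integral integral_unique by blast
next
  case False
  then show ?thesis using integrable_reflect[of F b a] by (simp add: not_integrable_integral)
qed

lemma has_integral_shift:
  "((\<lambda>t. F (x + t)) has_integral I) {a..b} \<longleftrightarrow> (F has_integral (I::real)) {x + a..x + b}"
  for F :: "real \<Rightarrow> real"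
proof -
  have *: "((\<lambda>t. F (x + t)) has_integral I) {a..b}" if "(F has_integral I) {x + a..x + b}"
    for F :: "real \<Rightarrow> real" and x a b
    using has_integral_affinity[of F I "x + a" "x + b" 1 x] that by (simp add: add.commute)
  show ?thesis using *[of F x a b] *[of "\<lambda>t. F (x + t)" "-x" "x + a" "x + b"] by auto
qed

lemma integrable_shift: "(\<lambda>t. F (x + t)) integrable_on {a..b} \<longleftrightarrow> F integrable_on {x + a..x + (b::real)}"
  for F :: "real \<Rightarrow> real"
  unfolding integrable_on_def has_integral_shift ..

lemma integral_shift: "integral {a..b} (\<lambda>t. F (x + t)) = integral {x + a..x + (b::real)} F"
  for F :: "real \<Rightarrow> real"
proof (cases "F integrable_on {x + a..x + b}")
  case True
  then show ?thesis using has_integral_shift[of F x _ a b] integrable_integral integral_unique by blast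
next
  case False
  then show ?thesis using integrable_shift[of F x a b] by (simp add: not_integrable_integral)
qed

lemma integrable_shift_diff:
  fixes F :: "real \<Rightarrow> real"
  assumes "F integrable_on {x..x + \<delta>}" shows "(\<lambda>t. F (x + t) - F x) integrable_on {0..\<delta>}"
  using assms integrable_shift[of F x 0 \<delta>] by (auto intro!: integrable_diff)

section \<open>Algebra and cut-off independence of right Laplace expressions\<close>

lemma lapR1_add:
  assumes "F integrable_on {x..x + \<delta>}" "G integrable_on {x..x + \<delta>}" "0 \<le> s"
  shows "lapR1 (\<lambda>t. F t + G t) x \<delta> s = lapR1 F x \<delta> s + lapR1 G x \<delta> s"
proof -
  have "lap (\<lambda>t. F (x + t) + G (x + t) - (F x + G x)) \<delta> s =
      lap (\<lambda>t. (F (x + t) - F x) + (G (x + t) - G x)) \<delta> s"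
    by (rule lap_cong) simp
  also have "\<dots> = lap (\<lambda>t. F (x + t) - F x) \<delta> s + lap (\<lambda>t. G (x + t) - G x) \<delta> s"
    by (intro lap_add integrable_shift_diff assms)
  finally show ?thesis by (simp add: lapR1_eq_lap algebra_simps)
qed

lemma lapR1_cmult: "lapR1 (\<lambda>t. k * F t) x \<delta> s = k * lapR1 F x \<delta> s"
  using lap_cmult[of k "\<lambda>t. F (x + t) - F x" \<delta> s] by (simp add: lapR1_eq_lap right_diff_distrib)

lemma lapR1_uminus: "lapR1 (\<lambda>t. - F t) x \<delta> s = - lapR1 F x \<delta> s"
  using lapR1_cmult[of "-1" F] by simp

lemma lapR1_diff:
  assumes "F integrable_on {x..x + \<delta>}" "G integrable_on {x..x + \<delta>}" "0 \<le> s"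
  shows "lapR1 (\<lambda>t. F t - G t) x \<delta> s = lapR1 F x \<delta> s - lapR1 G x \<delta> s"
  using lapR1_add[OF assms(1) integrable_neg[OF assms(2)] assms(3)] by (simp add: lapR1_uminus)

lemma lapR1_cong:
  assumes "\<And>t. x \<le> t \<Longrightarrow> t \<le> x + \<delta> \<Longrightarrow> F t = G t" "0 \<le> \<delta>"
  shows "lapR1 F x \<delta> s = lapR1 G x \<delta> s"
  unfolding lapR1_eq_lap using assms by (auto intro!: lap_cong arg_cong2[of _ _ _ _ "(*)"])

lemma lapR1_shift: "lapR1 (\<lambda>t. F (a + t)) x \<delta> s = lapR1 F (a + x) \<delta> s"
  by (simp add: lapR1_def add.assoc)

lemma lapR1_cutoff:
  assumes "F integrable_on {x..x + \<delta>}" "0 < \<delta>'" "\<delta>' \<le> \<delta>"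
  shows "((\<lambda>s. lapR1 F x \<delta> s - lapR1 F x \<delta>' s) \<longlongrightarrow> 0) at_top"
  using lap_cutoff[OF integrable_shift_diff[OF assms(1)] assms(2,3), of 2]
  by (simp add: lapR1_eq_lap right_diff_distrib)

lemma lapR1_tendsto_cutoff_iff:
  assumes "F integrable_on {x..x + \<delta>}" "0 < \<delta>'" "\<delta>' \<le> \<delta>"
  shows "(lapR1 F x \<delta> \<longlongrightarrow> L) at_top \<longleftrightarrow> (lapR1 F x \<delta>' \<longlongrightarrow> L) at_top"
  using Lim_transform_eq[OF lapR1_cutoff[OF assms]] by simp

lemma right_LD_ge_transform:
  assumes "((\<lambda>s. lapR1 F x \<delta> s - lapR1 G y \<delta>' s) \<longlongrightarrow> 0) at_top" "right_LD_ge G y \<delta>' r"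
  shows "right_LD_ge F x \<delta> r"
  unfolding right_LD_ge_def
proof (intro allI impI)
  fix r' assume "r' < r"
  define e where "e = (r - r') / 2"
  have e: "e > 0" "r' + e < r" using \<open>r' < r\<close> by (auto simp: e_def field_simps)
  have "\<forall>\<^sub>F s in at_top. \<bar>lapR1 F x \<delta> s - lapR1 G y \<delta>' s\<bar> < e"
    using assms(1) e(1) by (auto simp: tendsto_iff)
  moreover have "\<forall>\<^sub>F s in at_top. r' + e < lapR1 G y \<delta>' s"
    using assms(2) e(2) by (auto simp: right_LD_ge_def)
  ultimately show "\<forall>\<^sub>F s in at_top. r' < lapR1 F x \<delta> s"
    by eventually_elim auto
qed

lemma right_LD_ge_cutoff_iff:
  assumes "F integrable_on {x..x + \<delta>}" "0 < \<delta>'" "\<delta>' \<le> \<delta>"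
  shows "right_LD_ge F x \<delta> r \<longleftrightarrow> right_LD_ge F x \<delta>' r"
proof -
  have "((\<lambda>s. lapR1 F x \<delta>' s - lapR1 F x \<delta> s) \<longlongrightarrow> 0) at_top"
    using tendsto_minus[OF lapR1_cutoff[OF assms]] by simp
  then show ?thesis using right_LD_ge_transform lapR1_cutoff[OF assms] by blast
qed

lemma right_LD_ge_add:
  assumes "F integrable_on {x..x + \<delta>}" "G integrable_on {x..x + \<delta>}"
    and "right_LD_ge F x \<delta> a" "right_LD_ge G x \<delta> b"
  shows "right_LD_ge (\<lambda>t. F t + G t) x \<delta> (a + b)"
  unfolding right_LD_ge_def
proof (intro allI impI)
  fix r assume "r < a + b"
  then have "a - (a + b - r) / 2 < a" "b - (a + b - r) / 2 < b" by auto
  then have "\<forall>\<^sub>F s in at_top. a - (a + b - r) / 2 < lapR1 F x \<delta> s"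
    "\<forall>\<^sub>F s in at_top. b - (a + b - r) / 2 < lapR1 G x \<delta> s"
    using assms(3,4) unfolding right_LD_ge_def by blast+
  with eventually_ge_at_top[of 0] show "\<forall>\<^sub>F s in at_top. r < lapR1 (\<lambda>t. F t + G t) x \<delta> s"
    by eventually_elim (auto simp: lapR1_add[OF assms(1,2)] field_simps)
qed

lemma right_LD_ge_cmult:
  assumes "right_LD_ge F x \<delta> r" "0 \<le> k"
  shows "right_LD_ge (\<lambda>t. k * F t) x \<delta> (k * r)"
proof (cases "k = 0")
  case True
  then show ?thesis by (auto simp: right_LD_ge_def lapR1_def)
next
  case False
  then have k: "k > 0" using assms by simp
  show ?thesis unfolding right_LD_ge_def lapR1_cmult
  proof (intro allI impI)
    fix r' assume "r' < k * r"
    then have "r' / k < r" using k by (simp add: field_simps)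
    then have "\<forall>\<^sub>F s in at_top. r' / k < lapR1 F x \<delta> s"
      using assms by (auto simp: right_LD_ge_def)
    then show "\<forall>\<^sub>F s in at_top. r' < k * lapR1 F x \<delta> s"
      by eventually_elim (use k in \<open>simp add: field_simps\<close>)
  qed
qed

lemma right_LD_ge_mono: "right_LD_ge F x \<delta> a \<Longrightarrow> b \<le> a \<Longrightarrow> right_LD_ge F x \<delta> b"
  unfolding right_LD_ge_def by force

lemma right_LD_ge_cong:
  assumes "\<And>t. x \<le> t \<Longrightarrow> t \<le> x + \<delta> \<Longrightarrow> F t = G t" "0 \<le> \<delta>"
  shows "right_LD_ge F x \<delta> r \<longleftrightarrow> right_LD_ge G x \<delta> r"
  unfolding right_LD_ge_def using lapR1_cong[OF assms] by simp

lemma lapR1_tendsto_iff: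
  "(lapR1 F x \<delta> \<longlongrightarrow> L) at_top \<longleftrightarrow> right_LD_ge F x \<delta> L \<and> right_LD_ge (\<lambda>t. - F t) x \<delta> (- L)"
proof
  assume lim: "(lapR1 F x \<delta> \<longlongrightarrow> L) at_top"
  show "right_LD_ge F x \<delta> L \<and> right_LD_ge (\<lambda>t. - F t) x \<delta> (- L)"
    unfolding right_LD_ge_def
  proof (intro conjI allI impI)
    fix r assume "r < L"
    then show "\<forall>\<^sub>F s in at_top. r < lapR1 F x \<delta> s" using lim by (simp add: order_tendsto_iff)
  next
    fix r assume "r < - L"
    then have "\<forall>\<^sub>F s in at_top. lapR1 F x \<delta> s < - r" using lim by (simp add: order_tendsto_iff)
    then show "\<forall>\<^sub>F s in at_top. r < lapR1 (\<lambda>t. - F t) x \<delta> s"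
      by eventually_elim (simp add: lapR1_uminus)
  qed
next
  assume *: "right_LD_ge F x \<delta> L \<and> right_LD_ge (\<lambda>t. - F t) x \<delta> (- L)"
  show "(lapR1 F x \<delta> \<longlongrightarrow> L) at_top"
    unfolding order_tendsto_iff
  proof (intro conjI allI impI)
    fix l assume "l < L" then show "\<forall>\<^sub>F s in at_top. l < lapR1 F x \<delta> s"
      using * by (auto simp: right_LD_ge_def)
  next
    fix u assume "L < u"
    then have "\<forall>\<^sub>F s in at_top. - u < - lapR1 F x \<delta> s"
      using * unfolding right_LD_ge_def lapR1_uminus by (metis neg_less_iff_less)
    then show "\<forall>\<^sub>F s in at_top. lapR1 F x \<delta> s < u" by simp
  qed
qed

text \<open>The Laplace expression of a linear function of slope \<open>r\<close> tends to
  \<open>r\<close>, so monotonicity of the averages settles the cut-off \<open>\<delta>'\<close>,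
  and cut-off independence reaches \<open>\<delta>\<close>. This is how local difference estimates
  become derivate bounds.\<close>

lemma right_LD_ge_local:
  assumes F: "F integrable_on {x..x + \<delta>}" and d: "0 < \<delta>'" "\<delta>' \<le> \<delta>"
    and ge: "\<And>t. 0 \<le> t \<Longrightarrow> t \<le> \<delta>' \<Longrightarrow> r * t \<le> F (x + t) - F x"
  shows "right_LD_ge F x \<delta> r"
proof -
  have F': "F integrable_on {x..x + \<delta>'}" using F d by (auto intro: integrable_on_subinterval)
  have "right_LD_ge F x \<delta>' r"
    unfolding right_LD_ge_def
  proof (intro allI impI)
    fix r' assume "r' < r"
    then have "\<forall>\<^sub>F s in at_top. r' < s\<^sup>2 * lap (\<lambda>t. r * t) \<delta>' s"
      using lap_linear_tendsto[OF d(1), of r] by (auto simp: order_tendsto_iff)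
    with eventually_ge_at_top[of 0] show "\<forall>\<^sub>F s in at_top. r' < lapR1 F x \<delta>' s"
    proof eventually_elim
      case (elim s)
      have "lap (\<lambda>t. r * t) \<delta>' s \<le> lap (\<lambda>t. F (x + t) - F x) \<delta>' s"
        by (rule lap_mono) (use elim ge integrable_shift_diff[OF F'] in
            \<open>auto intro!: integrable_continuous_real continuous_intros\<close>)
      then have "s\<^sup>2 * lap (\<lambda>t. r * t) \<delta>' s \<le> lapR1 F x \<delta>' s"
        unfolding lapR1_eq_lap by (intro mult_left_mono) auto
      with elim show ?case by simp
    qed
  qed
  then show ?thesis using right_LD_ge_cutoff_iff[OF F d] by simp
qed

lemma right_LD_ge_mono_fun:
  assumes "F integrable_on {x..x + \<delta>}" "0 < \<delta>" "\<And>t. x \<le> t \<Longrightarrow> t \<le> x + \<delta> \<Longrightarrow> F x \<le> F t"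
  shows "right_LD_ge F x \<delta> 0"
  by (rule right_LD_ge_local[OF assms(1,2) order_refl]) (use assms(3) in auto)

lemma right_LD_ge_derivative:
  assumes F: "F integrable_on {x..x + \<delta>}" and d: "0 < \<delta>"
    and D: "(F has_real_derivative D) (at x within {x..x + \<delta>})"
  shows "right_LD_ge F x \<delta> D"
  unfolding right_LD_ge_def
proof (intro allI impI)
  fix r assume r: "r < D"
  have "right_LD_ge F x \<delta> ((r + D) / 2)" if "\<And>y. y \<in> {x..x + \<delta>} \<Longrightarrow> y \<noteq> x \<Longrightarrow> dist y x < k \<Longrightarrow>
      (r + D) / 2 < (F y - F x) / (y - x)" "k > 0" for k
  proof (rule right_LD_ge_local[OF F, of "min \<delta> (k / 2)"])
    fix t assume t: "0 \<le> t" "t \<le> min \<delta> (k / 2)"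
    show "(r + D) / 2 * t \<le> F (x + t) - F x"
    proof (cases "t = 0")
      case False
      then have "(r + D) / 2 < (F (x + t) - F x) / (x + t - x)"
        using t that(2) by (intro that(1)) (auto simp: dist_real_def)
      then show ?thesis using t False by (simp add: field_simps)
    qed simp
  qed (use d that in auto)
  moreover have "\<forall>\<^sub>F y in at x within {x..x + \<delta>}. (r + D) / 2 < (F y - F x) / (y - x)"
  proof -
    have "(r + D) / 2 < D" using r by simp
    then show ?thesis using D unfolding has_field_derivative_iff order_tendsto_iff by blast
  qed
  ultimately have "right_LD_ge F x \<delta> ((r + D) / 2)"
    unfolding eventually_at by blast
  then show "\<forall>\<^sub>F s in at_top. r < lapR1 F x \<delta> s"
    using r unfolding right_LD_ge_def by simp
qed

section \<open>Right Laplace continuity\<close>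

lemma right_lap_cont_of_tendsto:
  assumes "(lapR1 F x \<delta> \<longlongrightarrow> L) at_top" shows "right_lap_cont F x \<delta>"
  unfolding right_lap_cont_def
  using tendsto_mult[OF assms tendsto_inverse_0_at_top[OF filterlim_ident]] by (simp add: divide_inverse)

lemma right_lap_cont_add:
  assumes "F integrable_on {x..x + \<delta>}" "G integrable_on {x..x + \<delta>}"
    "right_lap_cont F x \<delta>" "right_lap_cont G x \<delta>"
  shows "right_lap_cont (\<lambda>t. F t + G t) x \<delta>"
  unfolding right_lap_cont_def
proof (rule Lim_transform_eventually)
  show "((\<lambda>s. lapR1 F x \<delta> s / s + lapR1 G x \<delta> s / s) \<longlongrightarrow> 0) at_top"
    using tendsto_add[OF assms(3,4)[unfolded right_lap_cont_def]] by simp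
  show "\<forall>\<^sub>F s in at_top. lapR1 F x \<delta> s / s + lapR1 G x \<delta> s / s = lapR1 (\<lambda>t. F t + G t) x \<delta> s / s"
    using eventually_ge_at_top[of 0]
    by eventually_elim (simp add: lapR1_add[OF assms(1,2)] add_divide_distrib)
qed

lemma right_lap_cont_cmult:
  "right_lap_cont F x \<delta> \<Longrightarrow> right_lap_cont (\<lambda>t. k * F t) x \<delta>"
  unfolding right_lap_cont_def lapR1_cmult
  using tendsto_mult_right_zero[of "\<lambda>s. lapR1 F x \<delta> s / s" at_top k] by simp

lemma right_lap_cont_iff: "right_lap_cont F x \<delta> \<longleftrightarrow> ((\<lambda>s. s * lap (\<lambda>t. F (x + t) - F x) \<delta> s) \<longlongrightarrow> 0) at_top"
  unfolding right_lap_cont_def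
  by (rule tendsto_cong) (use eventually_gt_at_top[of 0] in \<open>eventually_elim, simp add: lapR1_eq_lap power2_eq_square\<close>)

lemma right_lap_cont_cutoff_iff:
  assumes "F integrable_on {x..x + \<delta>}" "0 < \<delta>'" "\<delta>' \<le> \<delta>"
  shows "right_lap_cont F x \<delta> \<longleftrightarrow> right_lap_cont F x \<delta>'"
  unfolding right_lap_cont_iff
  using lap_cutoff[OF integrable_shift_diff[OF assms(1)] assms(2,3), of 1]
  by (intro Lim_transform_eq) (simp add: right_diff_distrib)

lemma right_lap_cont_continuous:
  assumes F: "continuous_on {x..x + \<delta>} F" and d: "0 < \<delta>"
  shows "right_lap_cont F x \<delta>"
proof -
  have int: "F integrable_on {x..x + \<delta>}" using F by (rule integrable_continuous_real)
  show ?thesis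
    unfolding right_lap_cont_iff tendsto_iff
  proof (intro allI impI)
    fix e :: real assume e: "0 < e"
    have "x \<in> {x..x + \<delta>}" "e / 4 > 0" using d e by auto
    then obtain k where k: "k > 0" "\<And>y. y \<in> {x..x + \<delta>} \<Longrightarrow> dist y x < k \<Longrightarrow> dist (F y) (F x) < e / 4"
      using F unfolding continuous_on_iff by blast
    define \<eta> where "\<eta> = min \<delta> (k / 2)"
    have eta: "0 < \<eta>" "\<eta> \<le> \<delta>" "\<eta> < k" using d k(1) by (auto simp: \<eta>_def)
    let ?g = "\<lambda>t. F (x + t) - F x"
    have gi: "?g integrable_on {0..\<delta>}" using int by (rule integrable_shift_diff)
    then have gi': "?g integrable_on {0..\<eta>}" using eta by (auto intro: integrable_on_subinterval)
    have small: "?g t \<le> e / 4" "- (e / 4) \<le> ?g t" if "0 \<le> t" "t \<le> \<eta>" for t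
    proof -
      have "dist (F (x + t)) (F x) < e / 4"
        by (rule k(2)) (use that eta in \<open>auto simp: dist_real_def\<close>)
      then show "?g t \<le> e / 4" "- (e / 4) \<le> ?g t" unfolding dist_real_def by linarith+
    qed
    have "((\<lambda>s. s ^ 1 * (lap ?g \<delta> s - lap ?g \<eta> s)) \<longlongrightarrow> 0) at_top"
      using gi eta by (intro lap_cutoff)
    then have "\<forall>\<^sub>F s in at_top. \<bar>s * (lap ?g \<delta> s - lap ?g \<eta> s)\<bar> < e / 4"
      using e by (auto simp: tendsto_iff dest!: spec[of _ "e / 4"])
    \<comment> \<open>Averages of a constant converge to it, so the bound \<open>e / 4\<close> on
      the integrand leaves room up to \<open>e / 2\<close>; with \<open>e / 4\<close> for the tail
      the total stays below \<open>e\<close>.\<close>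
    moreover have "\<forall>\<^sub>F s in at_top. \<bar>s * lap (\<lambda>t. e / 4) \<eta> s\<bar> < e / 2"
    proof -
      have "((\<lambda>s. \<bar>s * lap (\<lambda>t. e / 4) \<eta> s\<bar>) \<longlongrightarrow> \<bar>e / 4\<bar>) at_top"
        by (intro tendsto_rabs lap_const_tendsto eta)
      moreover have "\<bar>e / 4\<bar> < e / 2" using e by simp
      ultimately show ?thesis by (rule order_tendstoD)
    qed
    ultimately show "\<forall>\<^sub>F s in at_top. dist (s * lap ?g \<delta> s) 0 < e"
      using eventually_gt_at_top[of 0]
    proof eventually_elim
      case (elim s)
      have "lap ?g \<eta> s \<le> lap (\<lambda>t. e / 4) \<eta> s"
        by (rule lap_mono[OF gi']) (use elim small(1) in auto)
      moreover have "lap (\<lambda>t. - (e / 4)) \<eta> s \<le> lap ?g \<eta> s"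
        by (rule lap_mono[OF _ gi']) (use elim small(2) in auto)
      ultimately have "\<bar>lap ?g \<eta> s\<bar> \<le> lap (\<lambda>t. e / 4) \<eta> s"
        using lap_uminus[of "\<lambda>t. e / 4" \<eta> s] by simp
      then have "\<bar>s * lap ?g \<eta> s\<bar> \<le> \<bar>s * lap (\<lambda>t. e / 4) \<eta> s\<bar>"
        using elim by (simp add: abs_mult mult_left_mono)
      then show ?case
        using elim(1)[unfolded right_diff_distrib] elim(2) e unfolding dist_real_def by linarith
    qed
  qed
qed

section \<open>Monotonicity\<close>

text \<open>With \<open>G\<close> the primitive of \<open>F (x + t) - F x\<close>, integration by
  parts turns \<open>s\<close> times the average of \<open>F (x + t) - F x\<close> into
  \<open>s^2\<close> times the average of \<open>G\<close>, up to an exponentially small term. As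
  \<open>G t \<le> (m - F x) * t\<close>, the limit 0 given by Laplace continuity is at most
  \<open>m - F x\<close>. If \<open>F x = m\<close> then \<open>G \<le> 0\<close>, and the same
  identity with one more factor \<open>s\<close> makes \<open>lapR1\<close> at most exponentially
  small, which excludes a positive lower derivate.\<close>

lemma right_lap_cont_primitive_bound:
  assumes F: "F integrable_on {x..x + \<delta>}" and d: "0 < \<delta>"
    and cont: "right_lap_cont F x \<delta>"
    and le: "\<And>t. 0 \<le> t \<Longrightarrow> t \<le> \<delta> \<Longrightarrow> integral {x..x + t} F \<le> m * t"
  shows "F x \<le> m"
    and "F x = m \<Longrightarrow> 0 < e \<Longrightarrow> \<not> right_LD_ge F x \<delta> e"
proof -
  let ?g = "\<lambda>t. F (x + t) - F x"
  define G where "G t = integral {0..t} ?g" for t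
  have gi: "?g integrable_on {0..\<delta>}" using F by (rule integrable_shift_diff)
  have G: "G t = integral {x..x + t} F - F x * t" if "0 \<le> t" "t \<le> \<delta>" for t
  proof -
    have "(\<lambda>t. F (x + t)) integrable_on {0..t}"
      using F that unfolding integrable_shift by (auto intro: integrable_on_subinterval)
    then have "G t = integral {0..t} (\<lambda>t. F (x + t)) - integral {0..t} (\<lambda>t. F x)"
      unfolding G_def by (intro Henstock_Kurzweil_Integration.integral_diff) auto
    then show ?thesis using that integral_shift[of 0 t F x] by simp
  qed
  have Gi: "G integrable_on {0..\<delta>}"
    unfolding G_def by (intro integrable_continuous_real indefinite_integral_continuous_1 gi)
  have parts: "lap ?g \<delta> s = exp (- s * \<delta>) * G \<delta> + s * lap G \<delta> s" if "0 \<le> s" for s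
    using lap_by_parts[OF gi _ that] d unfolding G_def by simp
  have G_le: "lap G \<delta> s \<le> lap (\<lambda>t. (m - F x) * t) \<delta> s" if "0 \<le> s" for s
  proof (rule lap_mono[OF Gi _ that])
    show "(\<lambda>t. (m - F x) * t) integrable_on {0..\<delta>}"
      by (intro integrable_continuous_real continuous_intros)
    show "G t \<le> (m - F x) * t" if "0 \<le> t" "t \<le> \<delta>" for t
      using G[OF that] le[OF that] by (simp add: algebra_simps)
  qed
  show "F x \<le> m"
  proof -
    have "((\<lambda>s. s * exp (- s * \<delta>) * G \<delta>) \<longlongrightarrow> 0) at_top" using d by real_asymp
    with cont have "((\<lambda>s. s * lap ?g \<delta> s - s * exp (- s * \<delta>) * G \<delta>) \<longlongrightarrow> 0 - 0) at_top"
      unfolding right_lap_cont_iff by (rule tendsto_diff)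
    moreover have "\<forall>\<^sub>F s in at_top. s * lap ?g \<delta> s - s * exp (- s * \<delta>) * G \<delta> \<le> s\<^sup>2 * lap (\<lambda>t. (m - F x) * t) \<delta> s"
      using eventually_ge_at_top[of 0]
    proof eventually_elim
      case (elim s)
      have "s * lap ?g \<delta> s - s * exp (- s * \<delta>) * G \<delta> = s\<^sup>2 * lap G \<delta> s"
        using parts[OF elim] by (simp add: algebra_simps power2_eq_square)
      also have "\<dots> \<le> s\<^sup>2 * lap (\<lambda>t. (m - F x) * t) \<delta> s"
        using G_le[OF elim] by (intro mult_left_mono) auto
      finally show ?case .
    qed
    ultimately have "0 - 0 \<le> m - F x"
      using tendsto_le[OF trivial_limit_at_top_linorder lap_linear_tendsto[OF d]] by blast
    then show ?thesis by simp
  qed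
  show "\<not> right_LD_ge F x \<delta> e" if "F x = m" "0 < e"
  proof
    assume ge: "right_LD_ge F x \<delta> e"
    have "0 < e" "((\<lambda>s. s\<^sup>2 * exp (- s * \<delta>) * G \<delta>) \<longlongrightarrow> 0) at_top" using d that by (simp, real_asymp)
    then have "\<forall>\<^sub>F s in at_top. s\<^sup>2 * exp (- s * \<delta>) * G \<delta> < e / 2"
      by (intro order_tendstoD) auto
    moreover have "\<forall>\<^sub>F s in at_top. e / 2 < lapR1 F x \<delta> s"
      by (rule ge[unfolded right_LD_ge_def, rule_format]) (use that in simp)
    ultimately have "\<forall>\<^sub>F s :: real in at_top. False"
      using eventually_ge_at_top[of 0]
    proof eventually_elim
      case (elim s)
      have "lap (\<lambda>t. (m - F x) * t) \<delta> s = 0" using that by (simp add: lap_def)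
      then have "s * lap G \<delta> s \<le> 0" using G_le[OF elim(3)] elim(3) by (simp add: mult_nonneg_nonpos)
      then have "lap ?g \<delta> s \<le> exp (- s * \<delta>) * G \<delta>" using parts[OF elim(3)] by simp
      then have "lapR1 F x \<delta> s \<le> s\<^sup>2 * exp (- s * \<delta>) * G \<delta>"
        unfolding lapR1_eq_lap mult.assoc by (intro mult_left_mono) auto
      with elim show ?case by simp
    qed
    then show False by simp
  qed
qed

text \<open>Rolle's argument for \<open>\<psi>\<close>, the primitive of \<open>F\<close> minus its
  chord of slope \<open>m\<close>. At a maximum of \<open>\<psi>\<close> the right side forces
  \<open>F x < m\<close> and the left side \<open>m \<le> F x\<close>. So no maximum is interior,
  both endpoints are maxima, and \<open>F p < m \<le> F q\<close>.\<close>

lemma LD_pos_imp_le: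
  assumes F: "F integrable_on {p..q}"
    and contR: "\<And>x. p \<le> x \<Longrightarrow> x < q \<Longrightarrow> right_lap_cont F x (q - x)"
    and contL: "\<And>x. p < x \<Longrightarrow> x \<le> q \<Longrightarrow> right_lap_cont (reflect F) (- x) (x - p)"
    and pos: "\<And>x. p \<le> x \<Longrightarrow> x < q \<Longrightarrow> right_LD_ge F x (q - x) e" and e: "0 < e"
    and pq: "p < q"
  shows "F p \<le> F q"
proof -
  define G where "G t = integral {p..t} F" for t
  define m where "m = G q / (q - p)"
  define \<psi> where "\<psi> t = G t - m * (t - p)" for t
  have contG: "continuous_on {p..q} G"
    unfolding G_def using F by (rule indefinite_integral_continuous_1)
  have cont: "continuous_on {p..q} \<psi>"
    unfolding \<psi>_def by (intro continuous_intros contG)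
  have zero: "\<psi> p = 0" "\<psi> q = 0" using pq by (auto simp: \<psi>_def G_def m_def)
  have incr: "integral {x..y} F = G y - G x" if "p \<le> x" "x \<le> y" "y \<le> q" for x y
  proof -
    have "F integrable_on {p..y}" using F that by (auto intro: integrable_on_subinterval)
    then show ?thesis
      using Henstock_Kurzweil_Integration.integral_combine[of p x y F] that by (simp add: G_def)
  qed
  have right: "F x \<le> m \<and> F x \<noteq> m" if x: "p \<le> x" "x < q" and max: "\<And>y. p \<le> y \<Longrightarrow> y \<le> q \<Longrightarrow> \<psi> y \<le> \<psi> x" for x
  proof -
    have Fi: "F integrable_on {x..x + (q - x)}" using F x by (auto intro: integrable_on_subinterval)
    have le: "integral {x..x + t} F \<le> m * t" if "0 \<le> t" "t \<le> q - x" for t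
      using incr[of x "x + t"] max[of "x + t"] x that by (auto simp: \<psi>_def algebra_simps)
    have d: "0 < q - x" using x by simp
    show ?thesis
      using right_lap_cont_primitive_bound[OF Fi d contR[OF x] le] pos[OF x] e by blast
  qed
  have left: "m \<le> F x" if x: "p < x" "x \<le> q" and max: "\<And>y. p \<le> y \<Longrightarrow> y \<le> q \<Longrightarrow> \<psi> y \<le> \<psi> x" for x
  proof -
    have "F integrable_on {p..x}" using F x by (auto intro: integrable_on_subinterval)
    then have Fi: "reflect F integrable_on {- x..- x + (x - p)}" using integrable_reflect[of F x p] by simp
    have le: "integral {- x..- x + t} (reflect F) \<le> - m * t" if "0 \<le> t" "t \<le> x - p" for t
      using integral_reflect[of x "x - t" F] incr[of "x - t" x] max[of "x - t"] x that
      by (auto simp: \<psi>_def algebra_simps)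
    have d: "0 < x - p" using x by simp
    have "reflect F (- x) \<le> - m"
      using right_lap_cont_primitive_bound(1)[OF Fi d contL[OF x] le] by blast
    then show ?thesis by (simp add: reflect_def)
  qed
  obtain x where x: "x \<in> {p..q}" "\<And>y. y \<in> {p..q} \<Longrightarrow> \<psi> y \<le> \<psi> x"
    using continuous_attains_sup[of "{p..q}" \<psi>] cont pq by auto
  have "x = p \<or> x = q"
  proof (rule ccontr)
    assume "\<not> (x = p \<or> x = q)"
    then have "F x \<noteq> m" "F x \<le> m" "m \<le> F x" using right[of x] left[of x] x by auto
    then show False by simp
  qed
  then have "\<psi> y \<le> 0" if "p \<le> y" "y \<le> q" for y using x zero that by auto
  then show ?thesis using right[of p] left[of q] zero pq by auto
qed

text \<open>Adding \<open>e * t\<close> raises the lower derivate to at least \<open>e\<close> and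
  preserves Laplace continuity, so the strict case applies for every \<open>e > 0\<close>.\<close>

lemma LD_nonneg_imp_le:
  assumes F: "F integrable_on {p..q}"
    and contR: "\<And>x. p \<le> x \<Longrightarrow> x < q \<Longrightarrow> right_lap_cont F x (q - x)"
    and contL: "\<And>x. p < x \<Longrightarrow> x \<le> q \<Longrightarrow> right_lap_cont (reflect F) (- x) (x - p)"
    and nonneg: "\<And>x. p \<le> x \<Longrightarrow> x < q \<Longrightarrow> right_LD_ge F x (q - x) 0"
    and pq: "p \<le> q"
  shows "F p \<le> F q"
proof (cases "p < q")
  case True
  have *: "F p + e * p \<le> F q + e * q" if e: "0 < e" for e
  proof -
    have id: "(\<lambda>t. e * t) integrable_on {a..b}" for a b
      by (intro integrable_continuous_real continuous_intros)
    have id_cont: "right_lap_cont (\<lambda>t. e * t) x d" if "0 < d" for x d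
      using that by (intro right_lap_cont_continuous continuous_intros)
    show ?thesis
    proof (rule LD_pos_imp_le[of "\<lambda>t. F t + e * t", OF _ _ _ _ e True])
      show "(\<lambda>t. F t + e * t) integrable_on {p..q}" using F id by (rule integrable_add)
      show "right_lap_cont (\<lambda>t. F t + e * t) x (q - x)" if "p \<le> x" "x < q" for x
        using contR[OF that] id_cont[of "q - x"] id F that
        by (intro right_lap_cont_add) (auto intro: integrable_on_subinterval)
      show "right_LD_ge (\<lambda>t. F t + e * t) x (q - x) e" if "p \<le> x" "x < q" for x
      proof -
        have "right_LD_ge (\<lambda>t. F t + e * t) x (q - x) (0 + e)"
        proof (rule right_LD_ge_add[OF _ id nonneg[OF that]])
          show "F integrable_on {x..x + (q - x)}" using F that by (auto intro: integrable_on_subinterval)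
          show "right_LD_ge (\<lambda>t. e * t) x (q - x) e"
            by (rule right_LD_ge_local[OF id, of "q - x"]) (use that in \<open>auto simp: algebra_simps\<close>)
        qed
        then show ?thesis by simp
      qed
      show "right_lap_cont (reflect (\<lambda>t. F t + e * t)) (- x) (x - p)" if "p < x" "x \<le> q" for x
      proof -
        have "F integrable_on {p..x}" using F that by (auto intro: integrable_on_subinterval)
        then have Fi: "reflect F integrable_on {- x..- x + (x - p)}" using integrable_reflect[of F x p] by simp
        have "right_lap_cont (\<lambda>t. reflect F t + e * t) (- x) (x - p)"
          using contL[OF that] id_cont[of "x - p"] that by (intro right_lap_cont_add Fi id) auto
        moreover have "reflect (\<lambda>t. F t + e * t) = (\<lambda>t. reflect F t + e * t)"
          by (auto simp: reflect_def)
        ultimately show ?thesis by simp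
      qed
    qed
  qed
  show ?thesis
  proof (rule ccontr)
    assume "\<not> F p \<le> F q"
    \<comment> \<open>Chosen so that \<open>e * (q - p)\<close> is half of the supposed deficit
      \<open>F p - F q\<close>.\<close>
    define e where "e = (F p - F q) / (2 * (q - p))"
    have "e > 0" using True \<open>\<not> F p \<le> F q\<close> by (simp add: e_def)
    moreover have "e * (q - p) = (F p - F q) / 2"
      unfolding e_def using True by (metis (no_types) diff_gt_0_iff_gt divide_divide_eq_left less_irrefl nonzero_divide_eq_eq)
    ultimately show False using *[of e] \<open>\<not> F p \<le> F q\<close> by (simp add: algebra_simps)
  qed
qed (use pq in auto)

lemma continuous_LD_nonneg_imp_le:
  assumes F: "continuous_on {p..q} F"
    and nonneg: "\<And>x. p \<le> x \<Longrightarrow> x < q \<Longrightarrow> right_LD_ge F x (q - x) 0"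
    and pq: "p \<le> q"
  shows "F p \<le> F q"
proof (rule LD_nonneg_imp_le[OF integrable_continuous_real[OF F] _ _ nonneg pq])
  show "right_lap_cont F x (q - x)" if "p \<le> x" "x < q" for x
    using F that by (intro right_lap_cont_continuous) (auto intro: continuous_on_subset)
  show "right_lap_cont (reflect F) (- x) (x - p)" if "p < x" "x \<le> q" for x
    using that unfolding reflect_def
    by (intro right_lap_cont_continuous continuous_on_minus continuous_on_compose2[OF F])
      (auto intro!: continuous_intros)
qed auto

section \<open>Primitives of Laplace integrable functions\<close>

text \<open>One predicate serves both kinds of comparison functions: a major function of
  \<open>h\<close> is \<open>W\<close> itself, and a minor function \<open>V\<close> enters as
  \<open>- V\<close> against \<open>- h\<close>.\<close>

definition LD_ge_on :: "(real \<Rightarrow> real) \<Rightarrow> (real \<Rightarrow> real) \<Rightarrow> real \<Rightarrow> real \<Rightarrow> bool" where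
  "LD_ge_on W h c d \<longleftrightarrow> continuous_on {c..d} W \<and>
     (\<forall>x. c \<le> x \<and> x < d \<longrightarrow> right_LD_ge W x (d - x) (h x)) \<and>
     (\<forall>x. c < x \<and> x \<le> d \<longrightarrow> right_LD_ge (reflect W) (- x) (x - c) (h x))"

lemma ereal_le_Liminf_iff:
  "ereal r \<le> Liminf at_top (\<lambda>s::real. ereal (g s)) \<longleftrightarrow> (\<forall>r'<r. \<forall>\<^sub>F s in at_top. r' < g s)"
  unfolding le_Liminf_iff
proof safe
  fix r' assume "\<forall>y<ereal r. \<forall>\<^sub>F s in at_top. y < ereal (g s)" "r' < r"
  then show "\<forall>\<^sub>F s in at_top. r' < g s" by (auto dest: spec[of _ "ereal r'"])
next
  fix y assume "\<forall>r'<r. \<forall>\<^sub>F s in at_top. r' < g s" "y < ereal r"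
  then show "\<forall>\<^sub>F s in at_top. y < ereal (g s)" by (cases y) auto
qed

lemma ereal_Limsup_le_iff:
  "Limsup at_top (\<lambda>s::real. ereal (g s)) \<le> ereal r \<longleftrightarrow> (\<forall>r'<(- r). \<forall>\<^sub>F s in at_top. r' < - g s)"
proof -
  have "Liminf at_top (\<lambda>s::real. ereal (- g s)) = - Limsup at_top (\<lambda>s. ereal (g s))"
    using ereal_Liminf_uminus[of "at_top :: real filter" "\<lambda>s. ereal (g s)"] by simp
  then have "Limsup at_top (\<lambda>s::real. ereal (g s)) \<le> ereal r \<longleftrightarrow> ereal (- r) \<le> Liminf at_top (\<lambda>s::real. ereal (- g s))"
    by (metis ereal_minus_le_minus uminus_ereal.simps(1))
  then show ?thesis by (simp add: ereal_le_Liminf_iff)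
qed

lemma major_fun_iff: "major_fun h c d W \<longleftrightarrow> LD_ge_on W h c d"
proof -
  have "ereal (h x) \<le> lower_LD1 W c d x \<and> - \<infinity> < lower_LD1 W c d x \<longleftrightarrow>
      (x < d \<longrightarrow> right_LD_ge W x (d - x) (h x)) \<and>
      (c < x \<longrightarrow> right_LD_ge (reflect W) (- x) (x - c) (h x))" for x
  proof -
    have "ereal (h x) \<le> lower_LD1 W c d x \<and> - \<infinity> < lower_LD1 W c d x \<longleftrightarrow> ereal (h x) \<le> lower_LD1 W c d x"
      by (metis MInfty_neq_ereal(1) ereal_infty_less(2) ereal_infty_less_eq(2))
    also have "\<dots> \<longleftrightarrow> (x < d \<longrightarrow> right_LD_ge W x (d - x) (h x)) \<and>
      (c < x \<longrightarrow> right_LD_ge (reflect W) (- x) (x - c) (h x))"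
      unfolding lower_LD1_def min.bounded_iff lapL1_eq_lapR1_reflect
      by (simp add: ereal_le_Liminf_iff right_LD_ge_def)
    finally show ?thesis .
  qed
  then show ?thesis unfolding major_fun_def LD_ge_on_def by auto
qed

lemma minor_fun_iff: "minor_fun h c d V \<longleftrightarrow> LD_ge_on (\<lambda>t. - V t) (\<lambda>t. - h t) c d"
proof -
  have r: "reflect (\<lambda>t. - V t) = (\<lambda>t. - reflect V t)" by (simp add: reflect_def)
  have "upper_LD1 V c d x \<le> ereal (h x) \<and> upper_LD1 V c d x < \<infinity> \<longleftrightarrow>
      (x < d \<longrightarrow> right_LD_ge (\<lambda>t. - V t) x (d - x) (- h x)) \<and>
      (c < x \<longrightarrow> right_LD_ge (reflect (\<lambda>t. - V t)) (- x) (x - c) (- h x))" for x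
  proof -
    have "upper_LD1 V c d x \<le> ereal (h x) \<and> upper_LD1 V c d x < \<infinity> \<longleftrightarrow> upper_LD1 V c d x \<le> ereal (h x)"
      by (metis PInfty_neq_ereal(1) ereal_infty_less(1) ereal_infty_less_eq(1))
    also have "\<dots> \<longleftrightarrow> (x < d \<longrightarrow> right_LD_ge (\<lambda>t. - V t) x (d - x) (- h x)) \<and>
      (c < x \<longrightarrow> right_LD_ge (reflect (\<lambda>t. - V t)) (- x) (x - c) (- h x))"
      unfolding upper_LD1_def max.bounded_iff lapL1_eq_lapR1_reflect r
      by (simp add: ereal_Limsup_le_iff right_LD_ge_def lapR1_uminus)
    finally show ?thesis .
  qed
  then show ?thesis unfolding minor_fun_def LD_ge_on_def
    by (auto simp: continuous_on_minus dest: continuous_on_minus)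
qed

section \<open>Operations on major functions\<close>

lemma integrable_reflect_cutoff:
  assumes "continuous_on {c..d} W" "x \<le> d"
  shows "reflect W integrable_on {- x..- x + (x - c)}"
proof -
  have "W integrable_on {c..x}"
    using assms by (auto intro!: integrable_continuous_real intro: continuous_on_subset)
  then show ?thesis using integrable_reflect[of W x c] by simp
qed

lemma integrable_cutoff:
  assumes "continuous_on {c..d} W" "c \<le> (x::real)"
  shows "(W::real \<Rightarrow> real) integrable_on {x..x + (d - x)}"
  using assms by (auto intro!: integrable_continuous_real intro: continuous_on_subset)

lemma LD_ge_on_reflect:
  assumes "LD_ge_on W h c d" shows "LD_ge_on (reflect W) (\<lambda>u. h (- u)) (- d) (- c)"
  unfolding LD_ge_on_def
proof (intro conjI allI impI)
  show "continuous_on {- d..- c} (reflect W)"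
    unfolding reflect_def
    by (rule continuous_on_minus, rule continuous_on_compose2[of "{c..d}" W])
      (use assms in \<open>auto simp: LD_ge_on_def intro!: continuous_intros\<close>)
  show "right_LD_ge (reflect W) x (- c - x) (h (- x))" if "- d \<le> x \<and> x < - c" for x
  proof -
    have "right_LD_ge (reflect W) (- (- x)) (- x - c) (h (- x))"
      using assms that unfolding LD_ge_on_def by (auto dest: spec[of _ "-x"])
    moreover have "- x - c = - c - x" by simp
    ultimately show ?thesis by (simp only: minus_minus)
  qed
  show "right_LD_ge (reflect (reflect W)) (- x) (x - - d) (h (- x))" if "- d < x \<and> x \<le> - c" for x
  proof -
    have "right_LD_ge W (- x) (d - - x) (h (- x))"
      using assms that unfolding LD_ge_on_def by (auto dest: spec[of _ "-x"])
    then show ?thesis by (simp add: algebra_simps)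
  qed
qed

lemma LD_ge_on_mono_fun: "LD_ge_on W h c d \<Longrightarrow> (\<And>x. c \<le> x \<Longrightarrow> x \<le> d \<Longrightarrow> g x \<le> h x) \<Longrightarrow> LD_ge_on W g c d"
  unfolding LD_ge_on_def using right_LD_ge_mono by (metis less_imp_le)

lemma LD_ge_on_add:
  assumes "LD_ge_on W h c d" "LD_ge_on W' h' c d"
  shows "LD_ge_on (\<lambda>t. W t + W' t) (\<lambda>t. h t + h' t) c d"
proof -
  have r: "reflect (\<lambda>t. W t + W' t) = (\<lambda>t. reflect W t + reflect W' t)" by (auto simp: reflect_def)
  have c: "continuous_on {c..d} W" "continuous_on {c..d} W'" using assms by (auto simp: LD_ge_on_def)
  show ?thesis
    unfolding LD_ge_on_def r
    using assms c unfolding LD_ge_on_def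
    by (auto intro!: continuous_on_add right_LD_ge_add intro: integrable_cutoff integrable_reflect_cutoff)
qed

lemma LD_ge_on_const: "LD_ge_on (\<lambda>t. k) (\<lambda>t. 0) c d"
  unfolding LD_ge_on_def by (auto simp: right_LD_ge_def lapR1_def reflect_def)

lemma LD_ge_on_add_const: "LD_ge_on W h c d \<Longrightarrow> LD_ge_on (\<lambda>t. W t + k) h c d"
  using LD_ge_on_add[OF _ LD_ge_on_const] by simp

lemma LD_ge_on_subinterval:
  assumes "LD_ge_on W h c d" "c \<le> c'" "d' \<le> d"
  shows "LD_ge_on W h c' d'"
  unfolding LD_ge_on_def
proof (intro conjI allI impI)
  have c: "continuous_on {c..d} W" using assms by (auto simp: LD_ge_on_def)
  then show "continuous_on {c'..d'} W" using assms by (auto intro: continuous_on_subset)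
  show "right_LD_ge W x (d' - x) (h x)" if "c' \<le> x \<and> x < d'" for x
  proof -
    have "right_LD_ge W x (d - x) (h x)" using assms that by (auto simp: LD_ge_on_def)
    then show ?thesis
      using right_LD_ge_cutoff_iff[OF integrable_cutoff[OF c, of x], of "d' - x"] assms that by simp
  qed
  show "right_LD_ge (reflect W) (- x) (x - c') (h x)" if "c' < x \<and> x \<le> d'" for x
  proof -
    have "right_LD_ge (reflect W) (- x) (x - c) (h x)" using assms that by (auto simp: LD_ge_on_def)
    then show ?thesis
      using right_LD_ge_cutoff_iff[OF integrable_reflect_cutoff[OF c, of x], of "x - c'"] assms that by simp
  qed
qed

lemma LD_ge_on_cong:
  assumes "LD_ge_on W h c d" "\<And>t. c \<le> t \<Longrightarrow> t \<le> d \<Longrightarrow> W t = W' t"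
  shows "LD_ge_on W' h c d"
  unfolding LD_ge_on_def
proof (intro conjI allI impI)
  show "continuous_on {c..d} W'"
    using assms unfolding LD_ge_on_def by (auto cong: continuous_on_cong_simp)
  show "right_LD_ge W' x (d - x) (h x)" if "c \<le> x \<and> x < d" for x
  proof -
    have "right_LD_ge W x (d - x) (h x) \<longleftrightarrow> right_LD_ge W' x (d - x) (h x)"
      by (rule right_LD_ge_cong) (use that assms(2) in auto)
    then show ?thesis using assms(1) that by (auto simp: LD_ge_on_def)
  qed
  show "right_LD_ge (reflect W') (- x) (x - c) (h x)" if "c < x \<and> x \<le> d" for x
  proof -
    have "right_LD_ge (reflect W) (- x) (x - c) (h x) \<longleftrightarrow> right_LD_ge (reflect W') (- x) (x - c) (h x)"
      by (rule right_LD_ge_cong) (use that assms(2) in \<open>auto simp: reflect_def\<close>)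
    then show ?thesis using assms(1) that by (auto simp: LD_ge_on_def)
  qed
qed

text \<open>Each one-sided derivate sees only one side: at the junction \<open>b\<close> the left
  one comes from the first piece and the right one from the second. Elsewhere cut-off independence
  allows the cut-off to be shortened to a single piece.\<close>

lemma LD_ge_on_combine:
  assumes 1: "LD_ge_on W h a b" and 2: "LD_ge_on W h b c" and "a \<le> b" "b \<le> c"
  shows "LD_ge_on W h a c"
  unfolding LD_ge_on_def
proof (intro conjI allI impI)
  have "continuous_on ({a..b} \<union> {b..c}) W"
    using 1 2 by (intro continuous_on_closed_Un) (auto simp: LD_ge_on_def)
  moreover have "{a..b} \<union> {b..c} = {a..c}" using assms by auto
  ultimately show c: "continuous_on {a..c} W" by simp
  show "right_LD_ge W x (c - x) (h x)" if "a \<le> x \<and> x < c" for x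
  proof (cases "x < b")
    case True
    then show ?thesis
      using right_LD_ge_cutoff_iff[OF integrable_cutoff[OF c, of x], of "b - x"] 1 that assms
      by (auto simp: LD_ge_on_def)
  qed (use 2 that in \<open>auto simp: LD_ge_on_def\<close>)
  show "right_LD_ge (reflect W) (- x) (x - a) (h x)" if "a < x \<and> x \<le> c" for x
  proof (cases "b < x")
    case True
    then show ?thesis
      using right_LD_ge_cutoff_iff[OF integrable_reflect_cutoff[OF c, of x], of "x - b"] 2 that assms
      by (auto simp: LD_ge_on_def)
  qed (use 1 that in \<open>auto simp: LD_ge_on_def\<close>)
qed

lemma LD_ge_on_derivative:
  assumes D: "\<And>x. x \<in> {c..d} \<Longrightarrow> (H has_real_derivative h x) (at x within {c..d})"
  shows "LD_ge_on H h c d"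
  unfolding LD_ge_on_def
proof (intro conjI allI impI)
  show c: "continuous_on {c..d} H" using D by (rule DERIV_continuous_on)
  show "right_LD_ge H x (d - x) (h x)" if "c \<le> x \<and> x < d" for x
    by (rule right_LD_ge_derivative)
      (use that integrable_cutoff[OF c] DERIV_subset[OF D[of x]] in auto)
  show "right_LD_ge (reflect H) (- x) (x - c) (h x)" if "c < x \<and> x \<le> d" for x
  proof (rule right_LD_ge_derivative[OF integrable_reflect_cutoff[OF c]])
    have "(H has_real_derivative h x) (at x within uminus ` {- x..- x + (x - c)})"
      using that by (intro DERIV_subset[OF D]) auto
    then have "((\<lambda>u. H (- u)) has_real_derivative h x * (- 1)) (at (- x) within {- x..- x + (x - c)})"
      by (intro DERIV_image_chain[of H _ uminus, unfolded comp_def] derivative_eq_intros) auto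
    from DERIV_minus[OF this]
    show "(reflect H has_real_derivative h x) (at (- x) within {- x..- x + (x - c)})"
      by (simp add: reflect_def)
  qed (use that in auto)
qed

lemma LD_ge_on_nonneg_imp_le:
  assumes W: "LD_ge_on W h c d" and h: "\<And>x. c \<le> x \<Longrightarrow> x \<le> d \<Longrightarrow> 0 \<le> h x"
    and xy: "c \<le> x" "x \<le> y" "y \<le> d"
  shows "W x \<le> W y"
proof -
  have W': "LD_ge_on W (\<lambda>t. 0) x y"
    using LD_ge_on_subinterval[OF LD_ge_on_mono_fun[OF W h] xy(1,3)] by simp
  then show ?thesis
    by (intro continuous_LD_nonneg_imp_le[OF _ _ xy(2)]) (auto simp: LD_ge_on_def)
qed

text \<open>Describing the indefinite Laplace integral as a uniform limit of major and of minor functions,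
  rather than by the extremal values at the endpoints, makes it easy to restrict, glue and transform.\<close>

definition upper_primitive :: "(real \<Rightarrow> real) \<Rightarrow> (real \<Rightarrow> real) \<Rightarrow> real \<Rightarrow> real \<Rightarrow> bool" where
  "upper_primitive H h c d \<longleftrightarrow>
     (\<forall>e>0. \<exists>W. LD_ge_on W h c d \<and> (\<forall>t\<in>{c..d}. \<bar>W t - H t\<bar> \<le> e))"

definition laplace_primitive :: "(real \<Rightarrow> real) \<Rightarrow> (real \<Rightarrow> real) \<Rightarrow> real \<Rightarrow> real \<Rightarrow> bool" where
  "laplace_primitive H h c d \<longleftrightarrow>
     upper_primitive H h c d \<and> upper_primitive (\<lambda>t. - H t) (\<lambda>t. - h t) c d"

lemma upper_primitive_of_LD_ge_on: "LD_ge_on W h c d \<Longrightarrow> upper_primitive W h c d"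
  unfolding upper_primitive_def by force

lemma upper_primitive_add:
  assumes "upper_primitive H h c d" "upper_primitive K k c d"
  shows "upper_primitive (\<lambda>t. H t + K t) (\<lambda>t. h t + k t) c d"
  unfolding upper_primitive_def
proof (intro allI impI)
  fix e :: real assume "e > 0"
  then have "e / 2 > 0" by simp
  then obtain W V where W: "LD_ge_on W h c d" "\<forall>t\<in>{c..d}. \<bar>W t - H t\<bar> \<le> e / 2"
    and V: "LD_ge_on V k c d" "\<forall>t\<in>{c..d}. \<bar>V t - K t\<bar> \<le> e / 2"
    using assms unfolding upper_primitive_def by meson
  have "\<bar>W t + V t - (H t + K t)\<bar> \<le> e" if "t \<in> {c..d}" for t
    using W(2)[rule_format, OF that] V(2)[rule_format, OF that] by linarith
  then show "\<exists>W. LD_ge_on W (\<lambda>t. h t + k t) c d \<and> (\<forall>t\<in>{c..d}. \<bar>W t - (H t + K t)\<bar> \<le> e)"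
    using LD_ge_on_add[OF W(1) V(1)] by blast
qed

lemma upper_primitive_cong:
  assumes "upper_primitive H h c d" "\<And>t. c \<le> t \<Longrightarrow> t \<le> d \<Longrightarrow> H t = K t"
  shows "upper_primitive K h c d"
  using assms unfolding upper_primitive_def by auto

lemma upper_primitive_add_const:
  "upper_primitive H h c d \<Longrightarrow> upper_primitive (\<lambda>t. H t + k) h c d"
  using upper_primitive_add[OF _ upper_primitive_of_LD_ge_on[OF LD_ge_on_const]] by simp

lemma upper_primitive_subinterval:
  assumes "upper_primitive H h c d" "c \<le> c'" "d' \<le> d"
  shows "upper_primitive H h c' d'"
  using assms LD_ge_on_subinterval unfolding upper_primitive_def
  by (metis atLeastatMost_subset_iff subsetD)

lemma upper_primitive_combine:
  assumes 1: "upper_primitive H h a b" and 2: "upper_primitive H h b c" and ab: "a \<le> b" "b \<le> c"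
  shows "upper_primitive H h a c"
  unfolding upper_primitive_def
proof (intro allI impI)
  fix e :: real assume "e > 0"
  then have "e / 3 > 0" by simp
  then obtain W V where W: "LD_ge_on W h a b" "\<forall>t\<in>{a..b}. \<bar>W t - H t\<bar> \<le> e / 3"
    and V: "LD_ge_on V h b c" "\<forall>t\<in>{b..c}. \<bar>V t - H t\<bar> \<le> e / 3"
    using 1 2 unfolding upper_primitive_def by meson
  \<comment> \<open>Shifting \<open>V\<close> by \<open>W b - V b\<close> makes the pieces meet at
    \<open>b\<close>; the shift costs two further errors \<open>e / 3\<close>.\<close>
  define X where "X t = (if t \<le> b then W t else V t + (W b - V b))" for t
  have "LD_ge_on X h a c"
  proof (rule LD_ge_on_combine[OF _ _ ab])
    show "LD_ge_on X h a b" by (rule LD_ge_on_cong[OF W(1)]) (simp add: X_def)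
    show "LD_ge_on X h b c"
      by (rule LD_ge_on_cong[OF LD_ge_on_add_const[OF V(1)], of "W b - V b"]) (auto simp: X_def)
  qed
  moreover have "\<bar>X t - H t\<bar> \<le> e" if "t \<in> {a..c}" for t
  proof (cases "t \<le> b")
    case True
    then have "\<bar>W t - H t\<bar> \<le> e / 3" using W(2) that by auto
    then show ?thesis using True \<open>e > 0\<close> by (simp add: X_def)
  next
    case False
    then have "\<bar>V t - H t\<bar> \<le> e / 3" "\<bar>W b - H b\<bar> \<le> e / 3" "\<bar>V b - H b\<bar> \<le> e / 3"
      using W(2) V(2) that ab by auto
    moreover have "X t = V t + (W b - V b)" using False by (simp add: X_def)
    ultimately show ?thesis by linarith
  qed
  ultimately show "\<exists>W. LD_ge_on W h a c \<and> (\<forall>t\<in>{a..c}. \<bar>W t - H t\<bar> \<le> e)" by blast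
qed

lemma upper_primitive_reflect:
  assumes "upper_primitive H h c d"
  shows "upper_primitive (reflect H) (\<lambda>u. h (- u)) (- d) (- c)"
  unfolding upper_primitive_def
proof (intro allI impI)
  fix e :: real assume "e > 0"
  then obtain W where W: "LD_ge_on W h c d" "\<forall>t\<in>{c..d}. \<bar>W t - H t\<bar> \<le> e"
    using assms unfolding upper_primitive_def by meson
  have "\<bar>reflect W t - reflect H t\<bar> \<le> e" if "t \<in> {- d..- c}" for t
  proof -
    have "\<bar>W (- t) - H (- t)\<bar> \<le> e" using W(2) that by auto
    then show ?thesis by (simp add: reflect_def abs_minus_commute)
  qed
  then show "\<exists>W. LD_ge_on W (\<lambda>u. h (- u)) (- d) (- c) \<and> (\<forall>t\<in>{- d..- c}. \<bar>W t - reflect H t\<bar> \<le> e)"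
    using LD_ge_on_reflect[OF W(1)] by blast
qed

lemma LD_ge_on_shift:
  assumes "LD_ge_on W h (a + c) (a + d)"
  shows "LD_ge_on (\<lambda>t. W (a + t)) (\<lambda>t. h (a + t)) c d"
  unfolding LD_ge_on_def
proof (intro conjI allI impI)
  show "continuous_on {c..d} (\<lambda>t. W (a + t))"
    by (rule continuous_on_compose2[of "{a + c..a + d}" W])
      (use assms in \<open>auto simp: LD_ge_on_def intro!: continuous_intros\<close>)
  show "right_LD_ge (\<lambda>t. W (a + t)) x (d - x) (h (a + x))" if "c \<le> x \<and> x < d" for x
    using assms that unfolding LD_ge_on_def right_LD_ge_def lapR1_shift
    by (auto dest: spec[of _ "a + x"])
  have r: "reflect (\<lambda>t. W (a + t)) = (\<lambda>t. reflect W (- a + t))" by (auto simp: reflect_def)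
  show "right_LD_ge (reflect (\<lambda>t. W (a + t))) (- x) (x - c) (h (a + x))" if "c < x \<and> x \<le> d" for x
  proof -
    have "right_LD_ge (reflect W) (- (a + x)) (a + x - (a + c)) (h (a + x))"
      using assms that unfolding LD_ge_on_def by (auto dest: spec[of _ "a + x"])
    then show ?thesis unfolding r right_LD_ge_def lapR1_shift by (simp add: algebra_simps)
  qed
qed

lemma upper_primitive_shift:
  assumes "upper_primitive H h (a + c) (a + d)"
  shows "upper_primitive (\<lambda>t. H (a + t)) (\<lambda>t. h (a + t)) c d"
  unfolding upper_primitive_def
proof (intro allI impI)
  fix e :: real assume "e > 0"
  then obtain W where W: "LD_ge_on W h (a + c) (a + d)" "\<forall>t\<in>{a + c..a + d}. \<bar>W t - H t\<bar> \<le> e"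
    using assms unfolding upper_primitive_def by meson
  then show "\<exists>W. LD_ge_on W (\<lambda>t. h (a + t)) c d \<and> (\<forall>t\<in>{c..d}. \<bar>W t - H (a + t)\<bar> \<le> e)"
    using LD_ge_on_shift[OF W(1)] by (intro exI[of _ "\<lambda>t. W (a + t)"]) auto
qed

lemma upper_primitive_continuous:
  assumes "upper_primitive H h c d" shows "continuous_on {c..d} H"
proof -
  have "\<forall>n. \<exists>W. LD_ge_on W h c d \<and> (\<forall>t\<in>{c..d}. \<bar>W t - H t\<bar> \<le> inverse (real (Suc n)))"
    using assms unfolding upper_primitive_def by simp
  then obtain W where W: "\<And>n. LD_ge_on (W n) h c d"
    "\<And>n t. t \<in> {c..d} \<Longrightarrow> \<bar>W n t - H t\<bar> \<le> inverse (real (Suc n))"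
    by metis
  have "uniform_limit {c..d} W H sequentially"
  proof (rule uniform_limitI)
    fix e :: real assume "e > 0"
    then have "\<forall>\<^sub>F n in sequentially. inverse (real (Suc n)) < e"
      using LIMSEQ_inverse_real_of_nat by (rule order_tendstoD(2)[rotated])
    then show "\<forall>\<^sub>F n in sequentially. \<forall>x\<in>{c..d}. dist (W n x) (H x) < e"
      by eventually_elim (auto simp: dist_real_def intro: le_less_trans[OF W(2)])
  qed
  then show ?thesis
    by (rule uniform_limit_theorem[rotated]) (use W(1) in \<open>auto simp: LD_ge_on_def\<close>)
qed

lemma upper_primitive_nonneg_imp_le:
  assumes H: "upper_primitive H h c d" and h: "\<And>x. c \<le> x \<Longrightarrow> x \<le> d \<Longrightarrow> 0 \<le> h x"
    and xy: "c \<le> x" "x \<le> y" "y \<le> d"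
  shows "H x \<le> H y"
proof (rule field_le_epsilon)
  fix e :: real assume "e > 0"
  then have "e / 2 > 0" by simp
  then obtain W where W: "LD_ge_on W h c d" "\<forall>t\<in>{c..d}. \<bar>W t - H t\<bar> \<le> e / 2"
    using H unfolding upper_primitive_def by meson
  have "W x \<le> W y" using LD_ge_on_nonneg_imp_le[OF W(1) h xy] .
  moreover have "\<bar>W x - H x\<bar> \<le> e / 2" "\<bar>W y - H y\<bar> \<le> e / 2" using W(2) xy by auto
  ultimately show "H x \<le> H y + e" by linarith
qed

text \<open>A majorant for \<open>h\<close> plus one for \<open>- h\<close> is a majorant for 0, so
  \<open>H - K\<close> is nondecreasing; exchanging the roles shows that it is constant.\<close>

lemma laplace_primitive_unique:
  assumes "laplace_primitive H h c d" "laplace_primitive K h c d" "c \<le> x" "x \<le> y" "y \<le> d"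
  shows "H y - H x = K y - K x"
proof -
  have *: "K y - K x \<le> H y - H x" if "upper_primitive H h c d" "upper_primitive (\<lambda>t. - K t) (\<lambda>t. - h t) c d" for H K
    using upper_primitive_nonneg_imp_le[OF upper_primitive_add[OF that] _ assms(3-5)] by simp
  show ?thesis
    using *[of H K] *[of K H] assms(1,2) unfolding laplace_primitive_def by auto
qed

lemma laplace_primitive_add_const:
  "laplace_primitive H h c d \<Longrightarrow> laplace_primitive (\<lambda>t. H t + k) h c d"
  unfolding laplace_primitive_def
  using upper_primitive_add_const[of H h c d k] upper_primitive_add_const[of "\<lambda>t. - H t" "\<lambda>t. - h t" c d "- k"]
  by simp

lemma laplace_primitive_diff:
  "laplace_primitive H h c d \<Longrightarrow> laplace_primitive K k c d \<Longrightarrow>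
    laplace_primitive (\<lambda>t. H t - K t) (\<lambda>t. h t - k t) c d"
  unfolding laplace_primitive_def
  using upper_primitive_add[of H h c d "\<lambda>t. - K t" "\<lambda>t. - k t"]
    upper_primitive_add[of "\<lambda>t. - H t" "\<lambda>t. - h t" c d K k] by simp

lemma laplace_primitive_subinterval:
  "laplace_primitive H h c d \<Longrightarrow> c \<le> c' \<Longrightarrow> d' \<le> d \<Longrightarrow> laplace_primitive H h c' d'"
  unfolding laplace_primitive_def using upper_primitive_subinterval by blast

lemma laplace_primitive_continuous: "laplace_primitive H h c d \<Longrightarrow> continuous_on {c..d} H"
  unfolding laplace_primitive_def using upper_primitive_continuous by blast

lemma laplace_primitive_derivative:
  assumes "\<And>x. x \<in> {c..d} \<Longrightarrow> (H has_real_derivative h x) (at x within {c..d})"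
  shows "laplace_primitive H h c d"
  unfolding laplace_primitive_def using assms
  by (intro conjI upper_primitive_of_LD_ge_on LD_ge_on_derivative DERIV_minus)

lemma laplace_primitive_combine:
  assumes H: "laplace_primitive H h a b" and K: "laplace_primitive K h b c" and ab: "a \<le> b" "b \<le> c"
  shows "\<exists>L. laplace_primitive L h a c"
proof -
  define L where "L t = (if t \<le> b then H t else K t + (H b - K b))" for t
  have L1: "upper_primitive L h a b" "upper_primitive (\<lambda>t. - L t) (\<lambda>t. - h t) a b"
    using H unfolding laplace_primitive_def
    by (auto elim!: upper_primitive_cong simp: L_def)
  have "laplace_primitive (\<lambda>t. K t + (H b - K b)) h b c"
    using K by (rule laplace_primitive_add_const)
  then have L2: "upper_primitive L h b c" "upper_primitive (\<lambda>t. - L t) (\<lambda>t. - h t) b c"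
    unfolding laplace_primitive_def by (auto elim!: upper_primitive_cong simp: L_def)
  show ?thesis
    unfolding laplace_primitive_def
    using upper_primitive_combine[OF L1(1) L2(1) ab] upper_primitive_combine[OF L1(2) L2(2) ab] by blast
qed

section \<open>Laplace integrability as existence of a primitive\<close>

lemma major_minus_minor_mono:
  assumes "major_fun h c d W" "minor_fun h c d V" "c \<le> x" "x \<le> y" "y \<le> d"
  shows "W x - V x \<le> W y - V y"
proof -
  have "LD_ge_on (\<lambda>t. W t + - V t) (\<lambda>t. h t + - h t) c d"
    using assms(1,2) by (intro LD_ge_on_add) (auto simp: major_fun_iff minor_fun_iff)
  from LD_ge_on_nonneg_imp_le[OF this _ assms(3-5)] show ?thesis by simp
qed

lemma major_fun_add_const: "major_fun h c d W \<Longrightarrow> major_fun h c d (\<lambda>t. W t - k)"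
  using LD_ge_on_add_const[of W h c d "- k"] by (simp add: major_fun_iff)

lemma minor_fun_add_const: "minor_fun h c d V \<Longrightarrow> minor_fun h c d (\<lambda>t. V t - k)"
  using LD_ge_on_add_const[of "\<lambda>t. - V t" _ c d "k"] by (simp add: minor_fun_iff)

text \<open>Equality of the two extremal values speaks only about increments from \<open>c\<close>
  to \<open>d\<close>. But the gap between a major and a minor function is nondecreasing, so after
  normalisation at \<open>c\<close> a gap of \<open>e\<close> at \<open>d\<close> bounds it
  everywhere. The pointwise supremum \<open>H\<close> of the normalised minor functions is squeezed
  in between, hence a uniform limit of both kinds.\<close>

lemma laplace_integrable_imp_primitive:
  assumes int: "laplace_integrable h c d" and cd: "c \<le> d"
  shows "\<exists>H. laplace_primitive H h c d"
proof -
  define A where "A = laplace_integral h c d"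
  have INF: "(INF W\<in>{W. major_fun h c d W}. ereal (W d - W c)) = ereal A"
    using int unfolding laplace_integrable_def A_def laplace_integral_def
    by (auto simp: ereal_real)
  have SUP: "(SUP V\<in>{V. minor_fun h c d V}. ereal (V d - V c)) = ereal A"
    using int INF unfolding laplace_integrable_def by simp
  define S where "S = {V. minor_fun h c d V \<and> V c = 0}"
  define H where "H t = (SUP V\<in>S. V t)" for t
  have approx: "\<exists>W V. major_fun h c d W \<and> minor_fun h c d V \<and>
      (\<forall>t\<in>{c..d}. \<bar>W t - H t\<bar> \<le> e \<and> \<bar>V t - H t\<bar> \<le> e)" if e: "e > 0" for e
  proof -
    have "(INF W\<in>{W. major_fun h c d W}. ereal (W d - W c)) < ereal (A + e / 2)"
      unfolding INF using e by simp
    then obtain W0 where W0: "major_fun h c d W0" "W0 d - W0 c < A + e / 2"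
      unfolding INF_less_iff by auto
    have "ereal (A - e / 2) < (SUP V\<in>{V. minor_fun h c d V}. ereal (V d - V c))"
      unfolding SUP using e by simp
    then obtain V0 where V0: "minor_fun h c d V0" "A - e / 2 < V0 d - V0 c"
      unfolding less_SUP_iff by auto
    define W V where "W t = W0 t - W0 c" and "V t = V0 t - V0 c" for t
    have W: "major_fun h c d W" "W c = 0" and V: "minor_fun h c d V" "V c = 0"
      unfolding W_def V_def using W0 V0 by (auto intro: major_fun_add_const minor_fun_add_const)
    have gap: "W d - V d \<le> e" using W0(2) V0(2) by (simp add: W_def V_def)
    have below: "V' t \<le> W t" if "V' \<in> S" "t \<in> {c..d}" for V' t
      using major_minus_minor_mono[OF W(1), of V' c t] W(2) that by (auto simp: S_def)
    have "\<bar>W t - H t\<bar> \<le> e \<and> \<bar>V t - H t\<bar> \<le> e" if t: "t \<in> {c..d}" for t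
    proof -
      have VS: "V \<in> S" using V by (simp add: S_def)
      have "V t \<le> H t" unfolding H_def
        by (rule cSUP_upper[OF VS]) (use below[OF _ t] in \<open>auto simp: bdd_above_def\<close>)
      moreover have "H t \<le> W t" unfolding H_def
        by (rule cSUP_least) (use below[OF _ t] VS in auto)
      moreover have "W t - V t \<le> W d - V d"
        using major_minus_minor_mono[OF W(1) V(1), of t d] t by simp
      ultimately show ?thesis using gap by auto
    qed
    then show ?thesis using W V by blast
  qed
  have "laplace_primitive H h c d"
    unfolding laplace_primitive_def upper_primitive_def
  proof (intro conjI allI impI)
    fix e :: real assume "e > 0"
    from approx[OF this] show "\<exists>W. LD_ge_on W h c d \<and> (\<forall>t\<in>{c..d}. \<bar>W t - H t\<bar> \<le> e)"
      unfolding major_fun_iff by blast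
  next
    fix e :: real assume "e > 0"
    from approx[OF this] obtain V where V: "minor_fun h c d V" "\<forall>t\<in>{c..d}. \<bar>V t - H t\<bar> \<le> e" by blast
    then show "\<exists>W. LD_ge_on W (\<lambda>t. - h t) c d \<and> (\<forall>t\<in>{c..d}. \<bar>W t - - H t\<bar> \<le> e)"
      unfolding minor_fun_iff
      by (intro exI[of _ "\<lambda>t. - V t"]) (auto simp: abs_minus_commute)
  qed
  then show ?thesis by blast
qed

text \<open>The difference of a major function and \<open>H\<close> is nondecreasing, so no major
  function has a smaller increment than \<open>H\<close>, while uniform approximants come within
  \<open>e\<close>. Minor functions are symmetric.\<close>

lemma laplace_primitive_imp_integral:
  assumes H: "laplace_primitive H h c d" and cd: "c \<le> d"
  shows "laplace_integrable h c d" "laplace_integral h c d = H d - H c"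
proof -
  have major: "H d - H c \<le> W d - W c" if "major_fun h c d W" for W
    using upper_primitive_nonneg_imp_le[OF upper_primitive_add[OF upper_primitive_of_LD_ge_on, of W h c d "\<lambda>t. - H t" "\<lambda>t. - h t"], of c d]
      that H cd by (simp add: major_fun_iff laplace_primitive_def)
  have minor: "V d - V c \<le> H d - H c" if "minor_fun h c d V" for V
    using upper_primitive_nonneg_imp_le[OF upper_primitive_add[OF upper_primitive_of_LD_ge_on, of "\<lambda>t. - V t" "\<lambda>t. - h t" c d H h], of c d]
      that H cd by (simp add: minor_fun_iff laplace_primitive_def)
  have INF: "(INF W\<in>{W. major_fun h c d W}. ereal (W d - W c)) = ereal (H d - H c)"
  proof (rule antisym)
    show "(INF W\<in>{W. major_fun h c d W}. ereal (W d - W c)) \<le> ereal (H d - H c)"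
    proof (rule ereal_le_epsilon2)
      fix e :: real assume "e > 0"
      then have "e / 2 > 0" by simp
      then obtain W where W: "LD_ge_on W h c d" "\<forall>t\<in>{c..d}. \<bar>W t - H t\<bar> \<le> e / 2"
        using H unfolding laplace_primitive_def upper_primitive_def by meson
      have "\<bar>W c - H c\<bar> \<le> e / 2" "\<bar>W d - H d\<bar> \<le> e / 2" using W(2) cd by auto
      then have "W d - W c \<le> H d - H c + e" by linarith
      then show "(INF W\<in>{W. major_fun h c d W}. ereal (W d - W c)) \<le> ereal (H d - H c) + ereal e"
        using W(1) by (intro INF_lower2[of W]) (auto simp: major_fun_iff)
    qed
    show "ereal (H d - H c) \<le> (INF W\<in>{W. major_fun h c d W}. ereal (W d - W c))"
      by (rule INF_greatest) (use major in auto)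
  qed
  have SUP: "(SUP V\<in>{V. minor_fun h c d V}. ereal (V d - V c)) = ereal (H d - H c)"
  proof (rule antisym)
    show "ereal (H d - H c) \<le> (SUP V\<in>{V. minor_fun h c d V}. ereal (V d - V c))"
    proof (rule ereal_le_epsilon2)
      fix e :: real assume "e > 0"
      then have "e / 2 > 0" by simp
      then obtain W where W: "LD_ge_on W (\<lambda>t. - h t) c d" "\<forall>t\<in>{c..d}. \<bar>W t - - H t\<bar> \<le> e / 2"
        using H unfolding laplace_primitive_def upper_primitive_def by meson
      have "minor_fun h c d (\<lambda>t. - W t)" using W(1) by (simp add: minor_fun_iff)
      then have "ereal (- W d - - W c) \<le> (SUP V\<in>{V. minor_fun h c d V}. ereal (V d - V c))"
        by (intro SUP_upper2[of "\<lambda>t. - W t"]) auto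
      moreover have "\<bar>W c - - H c\<bar> \<le> e / 2" "\<bar>W d - - H d\<bar> \<le> e / 2" using W(2) cd by auto
      then have "H d - H c \<le> (- W d - - W c) + e" by linarith
      then have "ereal (H d - H c) \<le> ereal (- W d - - W c) + ereal e" by simp
      ultimately show "ereal (H d - H c) \<le> (SUP V\<in>{V. minor_fun h c d V}. ereal (V d - V c)) + ereal e"
        using add_right_mono order_trans by blast
    qed
    show "(SUP V\<in>{V. minor_fun h c d V}. ereal (V d - V c)) \<le> ereal (H d - H c)"
      by (rule SUP_least) (use minor in auto)
  qed
  show "laplace_integrable h c d" "laplace_integral h c d = H d - H c"
    unfolding laplace_integrable_def laplace_integral_def INF SUP by auto
qed

text \<open>Integration by parts against \<open>exp (\<kappa> t)\<close>, which turns major functions of \<open>h\<close> into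
  major functions of \<open>exp (\<kappa> t) * h t\<close>.\<close>

definition exp_parts :: "real \<Rightarrow> real \<Rightarrow> (real \<Rightarrow> real) \<Rightarrow> real \<Rightarrow> real" where
  "exp_parts \<kappa> c W t = exp (\<kappa> * t) * W t - \<kappa> * integral {c..t} (\<lambda>u. exp (\<kappa> * u) * W u)"

text \<open>\<open>W\<close> need not be differentiable, so the product rule is replaced by freezing
  the weight at \<open>x\<close>. The remainder \<open>A x\<close> has derivative 0 at
  \<open>x\<close>: the function \<open>(exp (\<kappa> * t) - exp (\<kappa> * x)) * W t\<close> is
  differentiable there by continuity of \<open>W\<close> alone, and its derivative cancels that of
  the integral term. What is left is the constant multiple
  \<open>exp (\<kappa> * x) * W\<close>.\<close>

lemma LD_ge_on_exp_parts:
  assumes W: "LD_ge_on W h c d"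
  shows "LD_ge_on (exp_parts \<kappa> c W) (\<lambda>t. exp (\<kappa> * t) * h t) c d"
proof -
  have contW: "continuous_on {c..d} W" using W by (simp add: LD_ge_on_def)
  have contE: "continuous_on {c..d} (\<lambda>u. exp (\<kappa> * u) * W u)"
    by (intro continuous_intros contW)
  have contP: "continuous_on {c..d} (exp_parts \<kappa> c W)"
    unfolding exp_parts_def[abs_def]
    by (intro continuous_intros contW indefinite_integral_continuous_1 integrable_continuous_real contE)
  define A where "A x t = exp_parts \<kappa> c W t - exp (\<kappa> * x) * W t" for x t
  have A_deriv: "(A x has_real_derivative 0) (at x within {c..d})" if x: "x \<in> {c..d}" for x
  proof -
    have D: "((\<lambda>t. exp (\<kappa> * t)) has_real_derivative \<kappa> * exp (\<kappa> * x)) (at x within {c..d})"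
      by (auto intro!: derivative_eq_intros)
    have "((\<lambda>t. (exp (\<kappa> * t) - exp (\<kappa> * x)) / (t - x) * W t) \<longlongrightarrow> \<kappa> * exp (\<kappa> * x) * W x) (at x within {c..d})"
      using D contW x unfolding has_field_derivative_iff continuous_on_def
      by (intro tendsto_mult) auto
    then have 1: "((\<lambda>t. (exp (\<kappa> * t) - exp (\<kappa> * x)) * W t) has_real_derivative \<kappa> * exp (\<kappa> * x) * W x) (at x within {c..d})"
      unfolding has_field_derivative_iff by simp
    have 2: "((\<lambda>t. integral {c..t} (\<lambda>u. exp (\<kappa> * u) * W u)) has_real_derivative exp (\<kappa> * x) * W x) (at x within {c..d})"
      by (rule integral_has_real_derivative[OF contE x])
    have "A x = (\<lambda>t. (exp (\<kappa> * t) - exp (\<kappa> * x)) * W t - \<kappa> * integral {c..t} (\<lambda>u. exp (\<kappa> * u) * W u))"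
      by (auto simp: A_def exp_parts_def algebra_simps)
    then show ?thesis using DERIV_diff[OF 1 DERIV_cmult[OF 2, of \<kappa>]] by (simp add: mult.assoc)
  qed
  have decomp: "exp_parts \<kappa> c W = (\<lambda>t. exp (\<kappa> * x) * W t + A x t)" for x
    by (auto simp: A_def)
  have contA: "continuous_on {c..d} (A x)" for x
    unfolding A_def[abs_def] by (intro continuous_intros contW contP)
  show ?thesis
    unfolding LD_ge_on_def
  proof (intro conjI allI impI contP)
    fix x assume x: "c \<le> x \<and> x < d"
    have "right_LD_ge (A x) x (d - x) 0"
      by (rule right_LD_ge_derivative[OF integrable_cutoff[OF contA]])
        (use x in \<open>auto intro: DERIV_subset[OF A_deriv]\<close>)
    moreover have "right_LD_ge (\<lambda>t. exp (\<kappa> * x) * W t) x (d - x) (exp (\<kappa> * x) * h x)"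
      by (rule right_LD_ge_cmult) (use W x in \<open>auto simp: LD_ge_on_def\<close>)
    ultimately have "right_LD_ge (\<lambda>t. exp (\<kappa> * x) * W t + A x t) x (d - x) (exp (\<kappa> * x) * h x + 0)"
      by (intro right_LD_ge_add integrable_cutoff[OF contA] integrable_on_mult_right integrable_cutoff[OF contW])
        (use x in auto)
    then show "right_LD_ge (exp_parts \<kappa> c W) x (d - x) (exp (\<kappa> * x) * h x)"
      by (subst decomp[of x]) simp
  next
    fix x assume x: "c < x \<and> x \<le> d"
    have r: "reflect (exp_parts \<kappa> c W) = (\<lambda>t. exp (\<kappa> * x) * reflect W t + reflect (A x) t)"
      by (auto simp: A_def reflect_def algebra_simps)
    have "(A x has_real_derivative 0) (at x within uminus ` {- x..- x + (x - c)})"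
      by (rule DERIV_subset[OF A_deriv]) (use x in auto)
    then have "((\<lambda>u. A x (- u)) has_real_derivative 0 * (- 1)) (at (- x) within {- x..- x + (x - c)})"
      by (intro DERIV_image_chain[of "A x" _ uminus, unfolded comp_def] derivative_eq_intros) auto
    from DERIV_minus[OF this]
    have D: "(reflect (A x) has_real_derivative 0) (at (- x) within {- x..- x + (x - c)})"
      by (simp add: reflect_def)
    have "right_LD_ge (reflect (A x)) (- x) (x - c) 0"
      by (rule right_LD_ge_derivative[OF integrable_reflect_cutoff[OF contA] _ D]) (use x in auto)
    moreover have "reflect (A x) integrable_on {- x..- x + (x - c)}"
      using x by (intro integrable_reflect_cutoff[OF contA]) auto
    moreover have "(\<lambda>t. exp (\<kappa> * x) * reflect W t) integrable_on {- x..- x + (x - c)}"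
      using x by (intro integrable_on_mult_right integrable_reflect_cutoff[OF contW]) auto
    moreover have "right_LD_ge (\<lambda>t. exp (\<kappa> * x) * reflect W t) (- x) (x - c) (exp (\<kappa> * x) * h x)"
      by (rule right_LD_ge_cmult) (use W x in \<open>auto simp: LD_ge_on_def\<close>)
    ultimately have "right_LD_ge (\<lambda>t. exp (\<kappa> * x) * reflect W t + reflect (A x) t) (- x) (x - c) (exp (\<kappa> * x) * h x + 0)"
      by (intro right_LD_ge_add)
    then show "right_LD_ge (reflect (exp_parts \<kappa> c W)) (- x) (x - c) (exp (\<kappa> * x) * h x)"
      by (simp add: r)
  qed
qed

text \<open>Makes \<open>exp_parts\<close> Lipschitz in \<open>W\<close> for the uniform norm, so
  that uniform approximation by major functions is inherited: \<open>M\<close> accounts for the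
  boundary term, \<open>M * \<bar>\<kappa>\<bar> * (d - c)\<close> for the integral.\<close>

lemma exp_parts_diff_bound:
  assumes W: "continuous_on {c..d} W" and H: "continuous_on {c..d} H"
    and le: "\<And>t. t \<in> {c..d} \<Longrightarrow> \<bar>W t - H t\<bar> \<le> e" and t: "t \<in> {c..d}"
    and M: "\<And>t. t \<in> {c..d} \<Longrightarrow> exp (\<kappa> * t) \<le> M"
  shows "\<bar>exp_parts \<kappa> c W t - exp_parts \<kappa> c H t\<bar> \<le> M * (1 + \<bar>\<kappa>\<bar> * (d - c)) * e"
proof -
  have sub: "{c..t} \<subseteq> {c..d}" using t by auto
  have e0: "0 \<le> e" using le[OF t] by linarith
  have M0: "0 \<le> M" using M[OF t] exp_ge_zero order_trans by blast
  have b: "\<bar>exp (\<kappa> * u) * (W u - H u)\<bar> \<le> M * e" if "u \<in> {c..d}" for u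
    unfolding abs_mult by (rule mult_mono) (use M[OF that] le[OF that] M0 in auto)
  let ?I = "integral {c..t} (\<lambda>u. exp (\<kappa> * u) * (W u - H u))"
  have "norm ?I \<le> M * e * (t - c)"
    by (rule integral_bound)
      (use t b sub W H in \<open>auto intro!: continuous_intros intro: continuous_on_subset\<close>)
  also have "\<dots> \<le> M * e * (d - c)" using t e0 M0 by (intro mult_left_mono) auto
  finally have I: "\<bar>\<kappa> * ?I\<bar> \<le> \<bar>\<kappa>\<bar> * (M * e * (d - c))" by (simp add: abs_mult mult_left_mono)
  define J where "J = ?I"
  have J: "J = integral {c..t} (\<lambda>u. exp (\<kappa> * u) * W u) - integral {c..t} (\<lambda>u. exp (\<kappa> * u) * H u)"
    unfolding J_def right_diff_distrib
    by (intro Henstock_Kurzweil_Integration.integral_diff integrable_continuous_real continuous_intros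
        continuous_on_subset[OF W sub] continuous_on_subset[OF H sub])
  have "exp_parts \<kappa> c W t - exp_parts \<kappa> c H t = exp (\<kappa> * t) * (W t - H t) - \<kappa> * ?I"
    unfolding exp_parts_def J_def[symmetric] J by (simp add: algebra_simps)
  then have "\<bar>exp_parts \<kappa> c W t - exp_parts \<kappa> c H t\<bar> \<le> M * e + \<bar>\<kappa>\<bar> * (M * e * (d - c))"
    using b[OF t] I by linarith
  then show ?thesis by (simp add: algebra_simps)
qed

lemma upper_primitive_exp_parts:
  assumes H: "upper_primitive H h c d"
  shows "upper_primitive (exp_parts \<kappa> c H) (\<lambda>t. exp (\<kappa> * t) * h t) c d"
proof (cases "c \<le> d")
  case True
  have "bounded ((\<lambda>t. exp (\<kappa> * t)) ` {c..d})"
    by (intro compact_imp_bounded compact_continuous_image continuous_intros) auto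
  then obtain M where "\<forall>t\<in>{c..d}. exp (\<kappa> * t) \<le> M"
    unfolding bounded_iff by auto
  then have M: "exp (\<kappa> * t) \<le> M" if "t \<in> {c..d}" for t using that by blast
  have "0 < exp (\<kappa> * c)" by simp
  also have "\<dots> \<le> M" by (rule M) (use True in simp)
  finally have M0: "0 < M" .
  show ?thesis
    unfolding upper_primitive_def
  proof (intro allI impI)
    fix e :: real assume e: "e > 0"
    define K where "K = M * (1 + \<bar>\<kappa>\<bar> * (d - c))"
    have K: "K > 0" using M0 True by (simp add: K_def add_pos_nonneg)
    then have "e / K > 0" using e by simp
    then obtain W where W: "LD_ge_on W h c d" "\<forall>t\<in>{c..d}. \<bar>W t - H t\<bar> \<le> e / K"
      using H unfolding upper_primitive_def by meson
    have "\<bar>exp_parts \<kappa> c W t - exp_parts \<kappa> c H t\<bar> \<le> e" if "t \<in> {c..d}" for t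
      using exp_parts_diff_bound[of c d W H "e / K" t \<kappa> M] W upper_primitive_continuous[OF H] that M K
      unfolding K_def[symmetric] LD_ge_on_def by simp
    then show "\<exists>W. LD_ge_on W (\<lambda>t. exp (\<kappa> * t) * h t) c d \<and> (\<forall>t\<in>{c..d}. \<bar>W t - exp_parts \<kappa> c H t\<bar> \<le> e)"
      using LD_ge_on_exp_parts[OF W(1)] by blast
  qed
qed (auto simp: upper_primitive_def LD_ge_on_def)

lemma laplace_primitive_exp_parts:
  assumes "laplace_primitive H h c d"
  shows "laplace_primitive (exp_parts \<kappa> c H) (\<lambda>t. exp (\<kappa> * t) * h t) c d"
proof -
  have "exp_parts \<kappa> c (\<lambda>t. - H t) = (\<lambda>t. - exp_parts \<kappa> c H t)"
    by (auto simp: exp_parts_def)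
  then show ?thesis
    using upper_primitive_exp_parts[of H h c d \<kappa>] upper_primitive_exp_parts[of "\<lambda>t. - H t" "\<lambda>t. - h t" c d \<kappa>] assms
    unfolding laplace_primitive_def by simp
qed

lemma laplace_primitive_reflect:
  "laplace_primitive H h c d \<Longrightarrow> laplace_primitive (reflect H) (\<lambda>u. h (- u)) (- d) (- c)"
  unfolding laplace_primitive_def
  using upper_primitive_reflect[of H h c d] upper_primitive_reflect[of "\<lambda>t. - H t" "\<lambda>t. - h t" c d]
  by (simp add: reflect_def)

lemma laplace_primitive_shift:
  "laplace_primitive H h (a + c) (a + d) \<Longrightarrow> laplace_primitive (\<lambda>t. H (a + t)) (\<lambda>t. h (a + t)) c d"
  unfolding laplace_primitive_def
  using upper_primitive_shift[of H h a c d] upper_primitive_shift[of "\<lambda>t. - H t" "\<lambda>t. - h t" a c d]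
  by simp

text \<open>The fundamental theorem of calculus: Laplace continuity of \<open>h\<close> at \<open>x\<close> is, up to an
  exponentially small boundary term, Laplace differentiability of its primitive.\<close>

lemma lapR1_primitive_tendsto:
  assumes H: "laplace_primitive H h x (x + \<delta>)" and d: "0 < \<delta>"
    and lim: "((\<lambda>s. s * laplace_integral (\<lambda>t. exp (- s * t) * h (x + t)) 0 \<delta>) \<longlongrightarrow> L) at_top"
  shows "(lapR1 H x \<delta> \<longlongrightarrow> L) at_top"
proof -
  let ?H = "\<lambda>t. H (x + t) - H x"
  have prim: "laplace_primitive ?H (\<lambda>t. h (x + t)) 0 \<delta>"
    using laplace_primitive_add_const[OF laplace_primitive_shift[of H h x 0 \<delta>], of "- H x"] H by simp
  \<comment> \<open>With exponent \<open>- s\<close> the value of \<open>exp_parts\<close> at the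
    lower end vanishes, since \<open>?H\<close> is normalised to be 0 there.\<close>
  have LI: "laplace_integral (\<lambda>t. exp (- s * t) * h (x + t)) 0 \<delta> = exp (- s * \<delta>) * ?H \<delta> + s * lap ?H \<delta> s" for s
    using laplace_primitive_imp_integral(2)[OF laplace_primitive_exp_parts[OF prim, of "- s"]] d
    by (simp add: exp_parts_def lap_def)
  have eq: "s * laplace_integral (\<lambda>t. exp (- s * t) * h (x + t)) 0 \<delta> - s * exp (- s * \<delta>) * ?H \<delta> = lapR1 H x \<delta> s" for s
    unfolding LI lapR1_eq_lap by (simp add: algebra_simps power2_eq_square)
  have "((\<lambda>s. s * exp (- s * \<delta>) * ?H \<delta>) \<longlongrightarrow> 0) at_top" using d by real_asymp
  from tendsto_diff[OF lim this] show ?thesis unfolding eq by simp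
qed

lemma lapL1_primitive_tendsto:
  assumes H: "laplace_primitive H h (x - \<delta>) x" and d: "0 < \<delta>"
    and lim: "((\<lambda>s. s * laplace_integral (\<lambda>t. exp (- s * t) * h (x - t)) 0 \<delta>) \<longlongrightarrow> L) at_top"
  shows "(lapL1 H x \<delta> \<longlongrightarrow> L) at_top"
proof -
  have "(lapR1 (reflect H) (- x) \<delta> \<longlongrightarrow> L) at_top"
    by (rule lapR1_primitive_tendsto[where h = "\<lambda>u. h (- u)"])
      (use laplace_primitive_reflect[OF H] d lim in simp_all)
  then show ?thesis by (simp add: lapL1_eq_lapR1_reflect[abs_def])
qed

text \<open>Laplace continuity contains Laplace integrability near each point; bisection glues the
  local primitives along a compact interval.\<close>

lemma laplace_continuous_on_imp_primitive:
  assumes h: "laplace_continuous_on h I" and pq: "{p..q} \<subseteq> I" "p \<le> q"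
  shows "\<exists>H. laplace_primitive H h p q"
proof -
  let ?P = "\<lambda>a b. a \<le> b \<and> {a..b} \<subseteq> {p..q} \<longrightarrow> (\<exists>H. laplace_primitive H h a b)"
  have "?P p q"
    using pq(2)
  proof (rule Bolzano[where P = ?P])
    fix a b c assume 1: "?P a b" "?P b c" "a \<le> b" "b \<le> c"
    show "?P a c"
    proof
      assume "a \<le> c \<and> {a..c} \<subseteq> {p..q}"
      then have "{a..b} \<subseteq> {p..q}" "{b..c} \<subseteq> {p..q}" using 1(3,4) by auto
      then show "\<exists>H. laplace_primitive H h a c"
        using 1 laplace_primitive_combine by blast
    qed
  next
    fix x assume x: "p \<le> x" "x \<le> q"
    then have "laplace_integrable_near h I x"
      using h pq unfolding laplace_continuous_on_def laplace_continuous_at_def has_LD0_def by auto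
    then obtain c d e where *: "c < d" "0 < e" "I \<inter> ball x e \<subseteq> {c..d}" "laplace_integrable h c d"
      unfolding laplace_integrable_near_def by blast
    obtain H where H: "laplace_primitive H h c d"
      using laplace_integrable_imp_primitive[OF *(4)] *(1) by auto
    have "\<exists>H. laplace_primitive H h a b"
      if ab: "a \<le> x" "x \<le> b" "b - a < e" "{a..b} \<subseteq> {p..q}" for a b
    proof -
      have "{a..b} \<subseteq> ball x e" using ab(1-3) by (auto simp: dist_real_def)
      then have "{a..b} \<subseteq> {c..d}" using ab(4) pq(1) *(3) by blast
      then have "c \<le> a" "b \<le> d" using ab(1,2) by auto
      then show ?thesis using laplace_primitive_subinterval[OF H] by blast
    qed
    then show "\<exists>d>0. \<forall>a b. a \<le> x \<and> x \<le> b \<and> b - a < d \<longrightarrow> ?P a b"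
      by (intro exI[of _ e] conjI *(2)) simp
  qed
  then show ?thesis using pq by simp
qed

section \<open>Continuous functions are Laplace continuous\<close>

lemma continuous_imp_laplace_integral:
  assumes g: "continuous_on {c..d} g" and cd: "c \<le> d"
  shows "laplace_integrable g c d" "laplace_integral g c d = integral {c..d} g"
proof -
  have "laplace_primitive (\<lambda>t. integral {c..t} g) g c d"
    by (rule laplace_primitive_derivative) (rule integral_has_real_derivative[OF g])
  from laplace_primitive_imp_integral[OF this cd]
  show "laplace_integrable g c d" "laplace_integral g c d = integral {c..d} g" by auto
qed

lemma continuous_laplace_average:
  assumes h: "continuous_on {x..x + \<delta>} h" and d: "0 < \<delta>"
  shows "laplace_integrable (\<lambda>t. exp (- s * t) * h (x + t)) 0 \<delta>"
    and "((\<lambda>s. s * laplace_integral (\<lambda>t. exp (- s * t) * h (x + t)) 0 \<delta>) \<longlongrightarrow> h x) at_top"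
proof -
  have c: "continuous_on {0..\<delta>} (\<lambda>t. exp (- s * t) * h (x + t))" for s
    by (intro continuous_on_mult continuous_on_compose2[OF h, of "{0..\<delta>}" "\<lambda>t. x + t"])
      (auto intro!: continuous_intros)
  show "laplace_integrable (\<lambda>t. exp (- s * t) * h (x + t)) 0 \<delta>"
    by (rule continuous_imp_laplace_integral[OF c]) (use d in simp)
  have eq: "laplace_integral (\<lambda>t. exp (- s * t) * h (x + t)) 0 \<delta> = lap (\<lambda>t. h (x + t)) \<delta> s" for s
    using continuous_imp_laplace_integral(2)[OF c] d by (simp add: lap_def)
  have "((\<lambda>s. s * lap (\<lambda>t. h (x + t) - h x) \<delta> s + s * lap (\<lambda>t. h x) \<delta> s) \<longlongrightarrow> 0 + h x) at_top"
    using right_lap_cont_continuous[OF h d] lap_const_tendsto[OF d, of "h x"]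
    unfolding right_lap_cont_iff by (rule tendsto_add)
  moreover have "\<forall>\<^sub>F s in at_top. s * lap (\<lambda>t. h (x + t) - h x) \<delta> s + s * lap (\<lambda>t. h x) \<delta> s =
      s * laplace_integral (\<lambda>t. exp (- s * t) * h (x + t)) 0 \<delta>"
    using eventually_ge_at_top[of 0]
  proof eventually_elim
    case (elim s)
    have "lap (\<lambda>t. (h (x + t) - h x) + h x) \<delta> s = lap (\<lambda>t. h (x + t) - h x) \<delta> s + lap (\<lambda>t. h x) \<delta> s"
      by (intro lap_add integrable_shift_diff integrable_continuous_real h elim continuous_intros)
    then show ?case unfolding eq by (simp add: algebra_simps)
  qed
  ultimately have "((\<lambda>s. s * laplace_integral (\<lambda>t. exp (- s * t) * h (x + t)) 0 \<delta>) \<longlongrightarrow> 0 + h x) at_top"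
    by (rule Lim_transform_eventually)
  then show "((\<lambda>s. s * laplace_integral (\<lambda>t. exp (- s * t) * h (x + t)) 0 \<delta>) \<longlongrightarrow> h x) at_top"
    by simp
qed

lemma interval_sides:
  fixes I :: "real set"
  assumes I: "is_interval I" and x: "x \<in> I"
  shows "\<exists>\<delta>>0. (has_right I x \<longrightarrow> {x..x + \<delta>} \<subseteq> I) \<and> (has_left I x \<longrightarrow> {x - \<delta>..x} \<subseteq> I)"
proof -
  have conv: "{a..b} \<subseteq> I" if "a \<in> I" "b \<in> I" for a b
    using mem_is_interval_1_I[OF I that] by auto
  obtain d1 where d1: "d1 > 0" "has_right I x \<Longrightarrow> x + d1 \<in> I"
  proof (cases "has_right I x")
    case True
    then obtain y where "y \<in> I" "x < y" by (auto simp: has_right_def)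
    then show ?thesis by (intro that[of "y - x"]) auto
  next
    case False
    then show ?thesis by (intro that[of 1]) auto
  qed
  obtain d2 where d2: "d2 > 0" "has_left I x \<Longrightarrow> x - d2 \<in> I"
  proof (cases "has_left I x")
    case True
    then obtain y where "y \<in> I" "y < x" by (auto simp: has_left_def)
    then show ?thesis by (intro that[of "x - y"]) auto
  next
    case False
    then show ?thesis by (intro that[of 1]) auto
  qed
  show ?thesis
  proof (intro exI[of _ "min d1 d2"] conjI impI)
    show "{x..x + min d1 d2} \<subseteq> I" if "has_right I x"
      by (rule subset_trans[OF _ conv[OF x d1(2)[OF that]]]) auto
    show "{x - min d1 d2..x} \<subseteq> I" if "has_left I x"
      by (rule subset_trans[OF _ conv[OF d2(2)[OF that] x]]) auto
  qed (use d1 d2 in auto)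
qed

text \<open>Supplies the members of \<open>BLCn\<close> used later: the constants on which (B) is
  tested, and the Picard iterates.\<close>

lemma continuous_imp_laplace_continuous_on:
  assumes I: "is_interval I" and nontriv: "a \<in> I" "b \<in> I" "a \<noteq> b" and h: "continuous_on I h"
  shows "laplace_continuous_on h I"
  unfolding laplace_continuous_on_def laplace_continuous_at_def has_LD0_def
proof (intro ballI conjI)
  fix x assume x: "x \<in> I"
  show sides: "has_right I x \<or> has_left I x"
    using nontriv unfolding has_right_def has_left_def by (cases "x = a") (auto simp: neq_iff)
  obtain \<delta> where d: "0 < \<delta>" "has_right I x \<Longrightarrow> {x..x + \<delta>} \<subseteq> I" "has_left I x \<Longrightarrow> {x - \<delta>..x} \<subseteq> I"
    using interval_sides[OF I x] by blast
  \<comment> \<open>If a side of \<open>x\<close> is missing in \<open>I\<close>, the corresponding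
    endpoint degenerates to \<open>x\<close>; since one side exists, \<open>c < e\<close> still
    holds.\<close>
  define c where "c = (if has_left I x then x - \<delta> else x)"
  define e where "e = (if has_right I x then x + \<delta> else x)"
  have "{c..e} \<subseteq> {x..e} \<union> {c..x}" by auto
  also have "\<dots> \<subseteq> I" using d x by (auto simp: c_def e_def)
  finally have ce: "{c..e} \<subseteq> I" .
  have "I \<inter> ball x \<delta> \<subseteq> {c..e}"
  proof
    fix z assume z: "z \<in> I \<inter> ball x \<delta>"
    then have "x < z \<longrightarrow> has_right I x" by (auto simp: has_right_def)
    moreover have "z < x \<longrightarrow> has_left I x" using z by (auto simp: has_left_def)
    ultimately show "z \<in> {c..e}" using z d(1) by (auto simp: c_def e_def dist_real_def)
  qed
  moreover have "c < e" using sides d(1) by (auto simp: c_def e_def)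
  ultimately show "laplace_integrable_near h I x"
    unfolding laplace_integrable_near_def
    by (intro exI[of _ c] exI[of _ e] exI[of _ \<delta>] conjI d(1) ce
        continuous_imp_laplace_integral(1)[OF continuous_on_subset[OF h ce]]) auto
  show "\<exists>\<delta>>0.
       (has_right I x \<longrightarrow> {x..x + \<delta>} \<subseteq> I \<and>
          (\<forall>s>0. laplace_integrable (\<lambda>t. exp (- s * t) * h (x + t)) 0 \<delta>) \<and>
          ((\<lambda>s. s * laplace_integral (\<lambda>t. exp (- s * t) * h (x + t)) 0 \<delta>) \<longlongrightarrow> h x) at_top) \<and>
       (has_left I x \<longrightarrow> {x - \<delta>..x} \<subseteq> I \<and>
          (\<forall>s>0. laplace_integrable (\<lambda>t. exp (- s * t) * h (x - t)) 0 \<delta>) \<and>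
          ((\<lambda>s. s * laplace_integral (\<lambda>t. exp (- s * t) * h (x - t)) 0 \<delta>) \<longlongrightarrow> h x) at_top)"
  proof (intro exI[of _ \<delta>] conjI impI d(1) allI)
    assume r: "has_right I x"
    show "{x..x + \<delta>} \<subseteq> I" using d(2)[OF r] .
    note c = continuous_on_subset[OF h this]
    show "laplace_integrable (\<lambda>t. exp (- s * t) * h (x + t)) 0 \<delta>" for s
      by (rule continuous_laplace_average(1)[OF c d(1)])
    show "((\<lambda>s. s * laplace_integral (\<lambda>t. exp (- s * t) * h (x + t)) 0 \<delta>) \<longlongrightarrow> h x) at_top"
      by (rule continuous_laplace_average(2)[OF c d(1)])
  next
    assume l: "has_left I x"
    show sub: "{x - \<delta>..x} \<subseteq> I" using d(3)[OF l] .
    have c: "continuous_on {- x..- x + \<delta>} (\<lambda>u. h (- u))"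
      by (rule continuous_on_compose2[OF continuous_on_subset[OF h sub]]) (auto intro!: continuous_intros)
    show "laplace_integrable (\<lambda>t. exp (- s * t) * h (x - t)) 0 \<delta>" for s
      using continuous_laplace_average(1)[OF c d(1)] by simp
    show "((\<lambda>s. s * laplace_integral (\<lambda>t. exp (- s * t) * h (x - t)) 0 \<delta>) \<longlongrightarrow> h x) at_top"
      using continuous_laplace_average(2)[OF c d(1)] by simp
  qed
qed auto

section \<open>Domination by Lebesgue integrable functions\<close>

lemma measure_cut_diff:
  fixes S :: "real set"
  assumes "S \<in> lmeasurable" "a \<le> b"
  shows "measure lebesgue (S \<inter> {..b}) - measure lebesgue (S \<inter> {..a}) = measure lebesgue (S \<inter> {a<..b})"
proof -
  have m: "S \<inter> {..a} \<in> lmeasurable" "S \<inter> {a<..b} \<in> lmeasurable"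
    using assms(1) by (auto intro!: fmeasurable_Int_fmeasurable)
  have "S \<inter> {..b} = (S \<inter> {..a}) \<union> (S \<inter> {a<..b})" using assms(2) by auto
  moreover have "measure lebesgue ((S \<inter> {..a}) \<union> (S \<inter> {a<..b})) =
      measure lebesgue (S \<inter> {..a}) + measure lebesgue (S \<inter> {a<..b})"
    by (rule measure_Un2[OF m, THEN trans]) (auto intro!: arg_cong[of _ _ "measure lebesgue"])
  ultimately show ?thesis by simp
qed

lemma measure_cut_le:
  fixes S :: "real set"
  assumes "S \<in> lmeasurable" "a \<le> b"
  shows "measure lebesgue (S \<inter> {a<..b}) \<le> b - a"
proof -
  have "measure lebesgue (S \<inter> {a<..b}) \<le> measure lebesgue {a<..b}"
    using assms by (intro measure_mono_fmeasurable bounded_set_imp_lmeasurable)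
      (auto intro: bounded_subset[OF bounded_closed_interval[of a b]])
  then show ?thesis using assms by simp
qed

text \<open>The distribution function is 1-Lipschitz, because its increment from \<open>a\<close> to
  \<open>b\<close> is the measure of a subset of \<open>{a<..b}\<close>.\<close>

lemma continuous_on_measure_cut:
  fixes S :: "real set"
  assumes "S \<in> lmeasurable"
  shows "continuous_on UNIV (\<lambda>y. measure lebesgue (S \<inter> {..y}))"
proof -
  have *: "\<bar>measure lebesgue (S \<inter> {..b}) - measure lebesgue (S \<inter> {..a})\<bar> \<le> b - a" if "a \<le> b" for a b
    using measure_cut_diff[OF assms that] measure_cut_le[OF assms that] by simp
  have "dist (measure lebesgue (S \<inter> {..b})) (measure lebesgue (S \<inter> {..a})) \<le> dist b a" for a b
    using *[of a b] *[of b a] by (cases "a \<le> b") (auto simp: dist_real_def)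
  then show ?thesis unfolding continuous_on_iff by (meson le_less_trans)
qed

text \<open>The level sets \<open>{x. n * k < v x}\<close>, enlarged by the null set \<open>N\<close>, are covered by open
  sets of slightly larger measure; \<open>M\<close> is \<open>k\<close> times the sum of the distribution functions of
  these covers.\<close>

lemma lebesgue_major_function:
  fixes v :: "real \<Rightarrow> real"
  assumes v: "v absolutely_integrable_on {c..d}" and v0: "\<And>x. x \<in> {c..d} \<Longrightarrow> 0 \<le> v x"
    and N: "negligible N" and e: "0 < e" and cd: "c \<le> d"
  obtains M where "continuous_on UNIV M" "M d - M c \<le> integral {c..d} v + e"
    "\<And>x r. x \<in> {c..d} \<Longrightarrow> x \<in> N \<or> r \<le> v x \<Longrightarrow>
       \<exists>\<eta>>0. \<forall>a b. x - \<eta> < a \<and> a \<le> b \<and> b < x + \<eta> \<longrightarrow> r * (b - a) \<le> M b - M a"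
proof -
  \<comment> \<open>Slicing \<open>v\<close> into levels of height \<open>k\<close> overestimates
    its integral by at most \<open>k * (d - c)\<close>, which is to be at most \<open>e / 2\<close>;
    the summand 1 covers \<open>c = d\<close>.\<close>
  define k where "k = e / (2 * (d - c + 1))"
  have k: "0 < k" using e cd by (simp add: k_def)
  have kdc: "k * (d - c) \<le> e / 2"
  proof -
    have "k * (d - c) \<le> k * (d - c + 1)" using k by (intro mult_left_mono) auto
    also have "\<dots> = e / 2" using cd by (simp add: k_def field_simps)
    finally show ?thesis .
  qed
  define g where "g x = indicat_real {c..d} x * v x" for x
  have g_int: "integrable lebesgue g"
    using v unfolding set_integrable_def g_def by simp
  then have g_meas: "g \<in> borel_measurable lebesgue" by auto
  have g_integral: "integral\<^sup>L lebesgue g = integral {c..d} v"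
    using set_lebesgue_integral_eq_integral(2)[OF v] unfolding set_lebesgue_integral_def g_def by simp
  have g0: "0 \<le> g x" for x using v0 by (auto simp: g_def indicator_def)
  define E where "E n = {x. real n * k < g x}" for n :: nat
  have E_sub: "E n \<subseteq> {c..d}" for n
  proof
    fix x assume "x \<in> E n"
    then have "0 < g x" using k unfolding E_def by (auto intro: le_less_trans[rotated])
    then show "x \<in> {c..d}" by (cases "x \<in> {c..d}") (auto simp: g_def)
  qed
  have E_meas: "E n \<in> lmeasurable" for n
  proof (rule bounded_set_imp_lmeasurable)
    have "{x \<in> space lebesgue. real n * k < g x} \<in> sets lebesgue"
      using g_meas by measurable
    then show "E n \<in> sets lebesgue" by (simp add: E_def)
    show "bounded (E n)" using E_sub bounded_subset[OF bounded_closed_interval] by blast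
  qed
  \<comment> \<open>After multiplication by \<open>k\<close> and summation over \<open>n\<close> the
    excess measures contribute at most \<open>e / 2\<close>.\<close>
  have "\<exists>T. open T \<and> E n \<union> N \<subseteq> T \<and> T \<in> lmeasurable \<and> measure lebesgue T \<le> measure lebesgue (E n) + e / (4 * k) * (1/2) ^ n" for n
  proof -
    have Nm: "N \<in> lmeasurable" "measure lebesgue N = 0" using N by (auto simp: negligible_iff_measure)
    have EN: "E n \<union> N \<in> lmeasurable" using E_meas Nm by auto
    have pos: "0 < e / (4 * k) * (1/2) ^ n" using e k by simp
    obtain T where T: "open T" "E n \<union> N \<subseteq> T" "T - (E n \<union> N) \<in> lmeasurable"
      "emeasure lebesgue (T - (E n \<union> N)) < ennreal (e / (4 * k) * (1/2) ^ n)"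
      using sets_lebesgue_outer_open[OF fmeasurableD[OF EN] pos] by blast
    have Teq: "(E n \<union> N) \<union> (T - (E n \<union> N)) = T" using T(2) by auto
    have Tm: "T \<in> lmeasurable" using fmeasurable.Un[OF EN T(3)] unfolding Teq .
    have "measure lebesgue (T - (E n \<union> N)) \<le> e / (4 * k) * (1/2) ^ n"
      using T(4) pos unfolding emeasure_eq_measure2[OF T(3)] by (simp add: ennreal_less_iff)
    moreover have "measure lebesgue T \<le> measure lebesgue (E n \<union> N) + measure lebesgue (T - (E n \<union> N))"
      using measure_Un_le[OF fmeasurableD[OF EN] fmeasurableD[OF T(3)]] unfolding Teq .
    moreover have "measure lebesgue (E n \<union> N) \<le> measure lebesgue (E n) + measure lebesgue N"
      using measure_Un_le[of "E n" lebesgue N] E_meas Nm by auto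
    ultimately show ?thesis using T Tm Nm by (intro exI[of _ T]) auto
  qed
  from choice[OF allI[OF this]] obtain T where "\<forall>n. open (T n) \<and> E n \<union> N \<subseteq> T n \<and> T n \<in> lmeasurable \<and>
      measure lebesgue (T n) \<le> measure lebesgue (E n) + e / (4 * k) * (1/2) ^ n" ..
  then have T: "\<And>n. open (T n)" "\<And>n. E n \<union> N \<subseteq> T n" "\<And>n. T n \<in> lmeasurable"
    "\<And>n. measure lebesgue (T n) \<le> measure lebesgue (E n) + e / (4 * k) * (1/2) ^ n"
    by blast+
  have E_sum: "(\<Sum>n<m. k * measure lebesgue (E n)) \<le> integral {c..d} v + e / 2" for m
  proof -
    have int: "integrable lebesgue (\<lambda>x. k * indicat_real (E n) x)" for n
      using E_meas[of n] by (intro integrable_mult_right integrable_real_indicator) (auto simp: fmeasurable_def)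
    have int2: "integrable lebesgue (\<lambda>x. g x + k * indicat_real {c..d} x)"
    proof -
      have "{c..d} \<in> lmeasurable" by simp
      then show ?thesis
        by (intro Bochner_Integration.integrable_add g_int integrable_mult_right integrable_real_indicator)
          (auto simp: fmeasurable_def)
    qed
    \<comment> \<open>At \<open>x\<close> the sum counts levels with \<open>n * k < g x\<close>;
      there are at most \<open>g x / k + 1\<close> of them, so it exceeds \<open>g x\<close> by at
      most \<open>k\<close>.\<close>
    have pt: "(\<Sum>n<m. k * indicat_real (E n) x) \<le> g x + k * indicat_real {c..d} x" for x
    proof (cases "x \<in> {c..d}")
      case True
      have "(\<Sum>n<m. k * indicat_real (E n) x) = k * real (card {n. n < m \<and> x \<in> E n})"
      proof -
        have "(\<Sum>n<m. indicat_real (E n) x) = (\<Sum>n<m. if x \<in> E n then 1 else 0)"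
          by (intro sum.cong) auto
        also have "\<dots> = real (card {n \<in> {..<m}. x \<in> E n})"
          by (subst sum.inter_filter[symmetric]) auto
        finally show ?thesis by (simp add: sum_distrib_left[symmetric])
      qed
      also have "\<dots> \<le> k * (g x / k + 1)"
      proof (rule mult_left_mono)
        have "{n. n < m \<and> x \<in> E n} \<subseteq> {..<nat \<lceil>g x / k\<rceil>}"
        proof
          fix n assume "n \<in> {n. n < m \<and> x \<in> E n}"
          then have "real n < g x / k" using k by (simp add: E_def field_simps)
          then show "n \<in> {..<nat \<lceil>g x / k\<rceil>}" unfolding lessThan_iff by linarith
        qed
        then have "card {n. n < m \<and> x \<in> E n} \<le> nat \<lceil>g x / k\<rceil>"
          using card_mono[OF finite_lessThan] by (metis card_lessThan)
        also have "real (nat \<lceil>g x / k\<rceil>) \<le> g x / k + 1"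
        proof -
          have "0 \<le> g x / k" using g0 k by simp
          then show ?thesis by linarith
        qed
        finally show "real (card {n. n < m \<and> x \<in> E n}) \<le> g x / k + 1" by simp
      qed (use k in simp)
      also have "\<dots> = g x + k * indicat_real {c..d} x" using True k by (simp add: field_simps)
      finally show ?thesis .
    next
      case False
      then have "x \<notin> E n" for n using E_sub by blast
      then show ?thesis using g0 k by simp
    qed
    have "(\<Sum>n<m. k * measure lebesgue (E n)) = integral\<^sup>L lebesgue (\<lambda>x. \<Sum>n<m. k * indicat_real (E n) x)"
      by (subst Bochner_Integration.integral_sum) (use int E_meas in auto)
    also have "\<dots> \<le> integral\<^sup>L lebesgue (\<lambda>x. g x + k * indicat_real {c..d} x)"
      by (intro integral_mono Bochner_Integration.integrable_sum int int2 pt)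
    also have "\<dots> = integral {c..d} v + k * (d - c)"
      using g_int g_integral cd by (subst Bochner_Integration.integral_add) auto
    finally show ?thesis using kdc by linarith
  qed
  have T_sum: "(\<Sum>n<m. k * measure lebesgue (T n)) \<le> integral {c..d} v + e" for m
  proof -
    have "(\<Sum>n<m. k * measure lebesgue (T n)) \<le> (\<Sum>n<m. k * measure lebesgue (E n) + e / 4 * (1/2) ^ n)"
    proof (rule sum_mono)
      fix n
      have "k * measure lebesgue (T n) \<le> k * (measure lebesgue (E n) + e / (4 * k) * (1/2) ^ n)"
        using T(4) k by (intro mult_left_mono) auto
      also have "\<dots> = k * measure lebesgue (E n) + e / 4 * (1/2) ^ n"
        using k by (simp add: distrib_left)
      finally show "k * measure lebesgue (T n) \<le> k * measure lebesgue (E n) + e / 4 * (1/2) ^ n" .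
    qed
    also have "\<dots> = (\<Sum>n<m. k * measure lebesgue (E n)) + e / 4 * (\<Sum>n<m. (1/2) ^ n)"
      by (simp only: sum.distrib sum_distrib_left)
    also have "(\<Sum>n<m. (1/2) ^ n) \<le> (2::real)"
      by (subst geometric_sum) (auto simp: field_simps)
    finally show ?thesis using E_sum[of m] e by simp
  qed
  have T_summable: "summable (\<lambda>n. k * measure lebesgue (T n))"
    by (rule summableI_nonneg_bounded) (use k T_sum in auto)
  define M where "M y = (\<Sum>n. k * measure lebesgue (T n \<inter> {..y}))" for y
  have cut_le: "norm (k * measure lebesgue (T n \<inter> {..y})) \<le> k * measure lebesgue (T n)" for n y
  proof -
    have "measure lebesgue (T n \<inter> {..y}) \<le> measure lebesgue (T n)"
      using T(3)[of n] by (intro measure_mono_fmeasurable) auto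
    then show ?thesis using k by (simp add: mult_left_mono)
  qed
  have cut_summable: "summable (\<lambda>n. k * measure lebesgue (T n \<inter> {..y}))" for y
    by (rule summable_comparison_test'[OF T_summable cut_le])
  have M_diff: "M b - M a = (\<Sum>n. k * measure lebesgue (T n \<inter> {a<..b}))"
    and M_diff_summable: "summable (\<lambda>n. k * measure lebesgue (T n \<inter> {a<..b}))" if "a \<le> b" for a b
  proof -
    have eq: "k * measure lebesgue (T n \<inter> {..b}) - k * measure lebesgue (T n \<inter> {..a}) = k * measure lebesgue (T n \<inter> {a<..b})" for n
      using measure_cut_diff[OF T(3) that] by (simp add: right_diff_distrib[symmetric])
    show "M b - M a = (\<Sum>n. k * measure lebesgue (T n \<inter> {a<..b}))"
      unfolding M_def by (subst suminf_diff[OF cut_summable cut_summable]) (simp add: eq)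
    show "summable (\<lambda>n. k * measure lebesgue (T n \<inter> {a<..b}))"
      using summable_diff[OF cut_summable[of b] cut_summable[of a]] unfolding eq .
  qed
  show thesis
  proof (rule that[of M])
    have "uniform_limit UNIV (\<lambda>m y. \<Sum>n<m. k * measure lebesgue (T n \<inter> {..y})) M sequentially"
      unfolding M_def by (rule Weierstrass_m_test[OF cut_le T_summable])
    then show "continuous_on UNIV M"
      by (rule uniform_limit_theorem[rotated])
        (auto intro!: always_eventually continuous_intros continuous_on_measure_cut T(3))
    have "M d - M c \<le> (\<Sum>n. k * measure lebesgue (T n))"
      unfolding M_diff[OF cd]
      by (intro suminf_le M_diff_summable[OF cd] T_summable)
        (use k T(3) in \<open>auto intro!: measure_mono_fmeasurable\<close>)
    also have "\<dots> \<le> integral {c..d} v + e"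
      by (rule suminf_le_const[OF T_summable T_sum])
    finally show "M d - M c \<le> integral {c..d} v + e" .
  next
    fix x r assume x: "x \<in> {c..d}" and r: "x \<in> N \<or> r \<le> v x"
    \<comment> \<open>Every open cover containing \<open>x\<close> contributes slope
      \<open>k\<close> to \<open>M\<close> near \<open>x\<close>. A point of \<open>N\<close> lies
      in all of them, so any slope \<open>r\<close> is reached; another point lies in at least the
      first \<open>\<lceil>v x / k\<rceil>\<close>, enough for slope \<open>v x\<close>.\<close>
    have "\<exists>K. r \<le> real K * k \<and> (\<forall>n<K. x \<in> T n)"
    proof (cases "x \<in> N")
      case True
      obtain K :: nat where "r / k \<le> real K" using real_arch_simple by blast
      then have "r \<le> real K * k" using k by (simp add: field_simps)
      then show ?thesis using T(2) True by blast
    next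
      case False
      define K where "K = nat \<lceil>v x / k\<rceil>"
      have gx: "g x = v x" using x by (simp add: g_def)
      have "v x / k \<le> real K" unfolding K_def by linarith
      then have "r \<le> real K * k" using r False k by (simp add: field_simps)
      moreover have "x \<in> T n" if "n < K" for n
      proof -
        have "real n < v x / k" using that unfolding K_def by linarith
        then have "x \<in> E n" using k gx by (simp add: E_def field_simps)
        then show ?thesis using T(2) by blast
      qed
      ultimately show ?thesis by blast
    qed
    then obtain K where K: "r \<le> real K * k" "\<And>n. n < K \<Longrightarrow> x \<in> T n" by blast
    \<comment> \<open>Only finitely many covers are intersected, so a whole neighbourhood of
      \<open>x\<close> gets the slope.\<close>
    have "open (\<Inter>n<K. T n)" using T(1) by (intro open_INT) auto
    moreover have "x \<in> (\<Inter>n<K. T n)" using K by auto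
    ultimately obtain \<eta> where \<eta>: "\<eta> > 0" "ball x \<eta> \<subseteq> (\<Inter>n<K. T n)" using open_contains_ball by blast
    have "r * (b - a) \<le> M b - M a" if ab: "x - \<eta> < a" "a \<le> b" "b < x + \<eta>" for a b
    proof -
      have "{a<..b} \<subseteq> ball x \<eta>" using ab by (auto simp: dist_real_def)
      then have "T n \<inter> {a<..b} = {a<..b}" if "n < K" for n using \<eta>(2) that by blast
      then have "(\<Sum>n<K. k * measure lebesgue (T n \<inter> {a<..b})) = real K * k * (b - a)"
        using ab(2) by simp
      moreover have "(\<Sum>n<K. k * measure lebesgue (T n \<inter> {a<..b})) \<le> M b - M a"
        unfolding M_diff[OF ab(2)] by (intro sum_le_suminf M_diff_summable[OF ab(2)]) (use k in auto)
      moreover have "r * (b - a) \<le> real K * k * (b - a)"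
        using K(1) ab(2) by (intro mult_right_mono) auto
      ultimately show ?thesis by linarith
    qed
    then show "\<exists>\<eta>>0. \<forall>a b. x - \<eta> < a \<and> a \<le> b \<and> b < x + \<eta> \<longrightarrow> r * (b - a) \<le> M b - M a"
      using \<eta>(1) by blast
  qed
qed

text \<open>The function \<open>M\<close> is a major function of \<open>g\<close> at every point:
  off \<open>N\<close> its slope reaches \<open>v x \<ge> g x\<close>, and on \<open>N\<close> it
  reaches any prescribed value. So \<open>M - D\<close> is nondecreasing, and the null set is paid
  for by the error \<open>e\<close>.\<close>

lemma laplace_primitive_le_integral:
  assumes D: "laplace_primitive D g c d"
    and v: "v absolutely_integrable_on {c..d}" and v0: "\<And>x. x \<in> {c..d} \<Longrightarrow> 0 \<le> v x"
    and N: "negligible N" and le: "\<And>x. x \<in> {c..d} \<Longrightarrow> x \<notin> N \<Longrightarrow> g x \<le> v x"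
    and cd: "c \<le> d"
  shows "D d - D c \<le> integral {c..d} v"
proof (rule field_le_epsilon)
  fix e :: real assume "0 < e"
  obtain M where M: "continuous_on UNIV M" "M d - M c \<le> integral {c..d} v + e"
    and inc: "\<And>x r. x \<in> {c..d} \<Longrightarrow> x \<in> N \<or> r \<le> v x \<Longrightarrow>
       \<exists>\<eta>>0. \<forall>a b. x - \<eta> < a \<and> a \<le> b \<and> b < x + \<eta> \<longrightarrow> r * (b - a) \<le> M b - M a"
    using lebesgue_major_function[OF v v0 N \<open>0 < e\<close> cd] by blast
  have cont: "continuous_on {c..d} M" using M(1) continuous_on_subset by blast
  have loc: "\<exists>\<eta>>0. \<forall>a b. x - \<eta> < a \<and> a \<le> b \<and> b < x + \<eta> \<longrightarrow> g x * (b - a) \<le> M b - M a" if "x \<in> {c..d}" for x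
    using inc[OF that, of "g x"] le[OF that] by blast
  have "LD_ge_on M g c d"
    unfolding LD_ge_on_def
  proof (intro conjI allI impI cont)
    fix x assume x: "c \<le> x \<and> x < d"
    then obtain \<eta> where \<eta>: "\<eta> > 0" "\<And>a b. x - \<eta> < a \<Longrightarrow> a \<le> b \<Longrightarrow> b < x + \<eta> \<Longrightarrow> g x * (b - a) \<le> M b - M a"
      using loc[of x] by auto
    show "right_LD_ge M x (d - x) (g x)"
    proof (rule right_LD_ge_local[OF integrable_cutoff[OF cont], of x "min (d - x) (\<eta> / 2)"])
      show "g x * t \<le> M (x + t) - M x" if "0 \<le> t" "t \<le> min (d - x) (\<eta> / 2)" for t
        using \<eta>(2)[of x "x + t"] \<eta>(1) that by simp
    qed (use x \<eta>(1) in auto)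
  next
    fix x assume x: "c < x \<and> x \<le> d"
    then obtain \<eta> where \<eta>: "\<eta> > 0" "\<And>a b. x - \<eta> < a \<Longrightarrow> a \<le> b \<Longrightarrow> b < x + \<eta> \<Longrightarrow> g x * (b - a) \<le> M b - M a"
      using loc[of x] by auto
    show "right_LD_ge (reflect M) (- x) (x - c) (g x)"
    proof (rule right_LD_ge_local[OF integrable_reflect_cutoff[OF cont], of x "min (x - c) (\<eta> / 2)"])
      show "g x * t \<le> reflect M (- x + t) - reflect M (- x)" if "0 \<le> t" "t \<le> min (x - c) (\<eta> / 2)" for t
        using \<eta>(2)[of "x - t" x] \<eta>(1) that by (simp add: reflect_def)
    qed (use x \<eta>(1) in auto)
  qed
  then have "upper_primitive (\<lambda>t. M t + - D t) (\<lambda>t. g t + - g t) c d"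
    using D unfolding laplace_primitive_def by (intro upper_primitive_add[OF upper_primitive_of_LD_ge_on]) auto
  then have "M c + - D c \<le> M d + - D d"
    by (rule upper_primitive_nonneg_imp_le) (use cd in auto)
  then show "D d - D c \<le> integral {c..d} v + e" using M(2) by linarith
qed

section \<open>Laplace differentiable functions on compact intervals\<close>

text \<open>The cut-off \<open>\<delta>\<close> delivered by Laplace continuity may lead beyond
  \<open>q\<close>. On the common part of the two intervals both primitives have equal increments,
  hence equal Laplace expressions.\<close>

lemma lapR1_tendsto_of_primitive:
  assumes H: "laplace_primitive H h t q" and K: "laplace_primitive K h t (t + \<delta>)"
    and d: "0 < \<delta>" "t < q" and lim: "(lapR1 K t \<delta> \<longlongrightarrow> L) at_top"
  shows "(lapR1 H t (q - t) \<longlongrightarrow> L) at_top"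
proof -
  define \<eta> where "\<eta> = min \<delta> (q - t)"
  have \<eta>: "0 < \<eta>" "\<eta> \<le> \<delta>" "\<eta> \<le> q - t" using d by (auto simp: \<eta>_def)
  have Ki: "K integrable_on {t..t + \<delta>}" and Hi: "H integrable_on {t..t + (q - t)}"
    using laplace_primitive_continuous[OF H] laplace_primitive_continuous[OF K]
    by (auto intro: integrable_continuous_real)
  have H': "laplace_primitive H h t (t + \<eta>)" and K': "laplace_primitive K h t (t + \<eta>)"
    using laplace_primitive_subinterval[OF H, of t "t + \<eta>"] laplace_primitive_subinterval[OF K, of t "t + \<eta>"] \<eta> by auto
  have eq: "lapR1 H t \<eta> = lapR1 K t \<eta>"
  proof
    fix s
    show "lapR1 H t \<eta> s = lapR1 K t \<eta> s"
    unfolding lapR1_eq_lap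
    using laplace_primitive_unique[OF H' K', of t "t + _"] by (intro arg_cong2[of _ _ _ _ "(*)"] lap_cong) auto
  qed
  have "(lapR1 K t \<eta> \<longlongrightarrow> L) at_top"
    using lim lapR1_tendsto_cutoff_iff[OF Ki \<eta>(1,2)] by simp
  then have "(lapR1 H t \<eta> \<longlongrightarrow> L) at_top" unfolding eq .
  then show ?thesis using lapR1_tendsto_cutoff_iff[OF Hi \<eta>(1,3)] by simp
qed

text \<open>Laplace continuity comes with its own cut-off, on which a separate primitive
  \<open>K\<close> is built; the limit found for \<open>K\<close> is transferred to
  \<open>H\<close>, on the left through reflection.\<close>

lemma laplace_continuous_primitive_tendsto:
  assumes h: "laplace_continuous_on h I" and pq: "{p..q} \<subseteq> I" and H: "laplace_primitive H h p q"
  shows "p \<le> t \<Longrightarrow> t < q \<Longrightarrow> (lapR1 H t (q - t) \<longlongrightarrow> h t) at_top"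
    and "p < t \<Longrightarrow> t \<le> q \<Longrightarrow> (lapR1 (reflect H) (- t) (t - p) \<longlongrightarrow> h t) at_top"
proof -
  have LD0: "has_LD0 h I t (h t)" if "t \<in> {p..q}" for t
    using h pq that unfolding laplace_continuous_on_def laplace_continuous_at_def by auto
  show "(lapR1 H t (q - t) \<longlongrightarrow> h t) at_top" if t: "p \<le> t" "t < q"
  proof -
    have "has_right I t" using t pq unfolding has_right_def by (intro bexI[of _ q]) auto
    then obtain \<delta> where \<delta>: "\<delta> > 0" "{t..t + \<delta>} \<subseteq> I"
      "((\<lambda>s. s * laplace_integral (\<lambda>u. exp (- s * u) * h (t + u)) 0 \<delta>) \<longlongrightarrow> h t) at_top"
      using LD0[of t] t unfolding has_LD0_def by auto
    obtain K where K: "laplace_primitive K h t (t + \<delta>)"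
      using laplace_continuous_on_imp_primitive[OF h \<delta>(2)] \<delta>(1) by auto
    show ?thesis
      using lapR1_tendsto_of_primitive[OF _ K \<delta>(1) t(2) lapR1_primitive_tendsto[OF K \<delta>(1,3)]]
        laplace_primitive_subinterval[OF H t(1)] by simp
  qed
  show "(lapR1 (reflect H) (- t) (t - p) \<longlongrightarrow> h t) at_top" if t: "p < t" "t \<le> q"
  proof -
    have "has_left I t" using t pq unfolding has_left_def by (intro bexI[of _ p]) auto
    then obtain \<delta> where \<delta>: "\<delta> > 0" "{t - \<delta>..t} \<subseteq> I"
      "((\<lambda>s. s * laplace_integral (\<lambda>u. exp (- s * u) * h (t - u)) 0 \<delta>) \<longlongrightarrow> h t) at_top"
      using LD0[of t] t unfolding has_LD0_def by auto
    obtain K where K: "laplace_primitive K h (t - \<delta>) t"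
      using laplace_continuous_on_imp_primitive[OF h \<delta>(2)] \<delta>(1) by auto
    have lim: "(lapR1 (reflect K) (- t) \<delta> \<longlongrightarrow> h t) at_top"
      using lapL1_primitive_tendsto[OF K \<delta>(1,3)] by (simp add: lapL1_eq_lapR1_reflect[abs_def])
    have K': "laplace_primitive (reflect K) (\<lambda>u. h (- u)) (- t) (- t + \<delta>)"
      using laplace_primitive_reflect[OF K] by simp
    have H': "laplace_primitive (reflect H) (\<lambda>u. h (- u)) (- t) (- p)"
      using laplace_primitive_reflect[OF laplace_primitive_subinterval[OF H order_refl t(2)]] .
    show ?thesis
      using lapR1_tendsto_of_primitive[OF H' K' \<delta>(1) _ lim] t by simp
  qed
qed

text \<open>A solution comes only with one-sided integrability near each point; bisection makes it
  integrable on the whole interval.\<close>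

lemma has_LD1_imp_integrable:
  assumes F: "\<And>t. t \<in> {p..q} \<Longrightarrow> has_LD1 F {p..q} t (L t)" and pq: "p \<le> q"
  shows "F integrable_on {p..q}"
proof -
  let ?P = "\<lambda>a b. a \<le> b \<and> {a..b} \<subseteq> {p..q} \<longrightarrow> F integrable_on {a..b}"
  have "?P p q"
    using pq
  proof (rule Bolzano[where P = ?P])
    fix a b c assume 1: "?P a b" "?P b c" "a \<le> b" "b \<le> c"
    show "?P a c"
    proof
      assume "a \<le> c \<and> {a..c} \<subseteq> {p..q}"
      then have "{a..b} \<subseteq> {p..q}" "{b..c} \<subseteq> {p..q}" using 1(3,4) by auto
      then show "F integrable_on {a..c}"
        using 1 Henstock_Kurzweil_Integration.integrable_combine by blast
    qed
  next
    fix x assume x: "p \<le> x" "x \<le> q"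
    then obtain \<delta> where \<delta>: "\<delta> > 0" "has_right {p..q} x \<Longrightarrow> F integrable_on {x..x + \<delta>}"
      "has_left {p..q} x \<Longrightarrow> F integrable_on {x - \<delta>..x}"
      using F[of x] unfolding has_LD1_def by auto
    have "F integrable_on {a..b}"
      if ab: "a \<le> x" "x \<le> b" "b - a < \<delta>" "{a..b} \<subseteq> {p..q}" for a b
    proof (rule Henstock_Kurzweil_Integration.integrable_combine[OF ab(1,2)])
      show "F integrable_on {a..x}"
      proof (cases "a = x")
        case False
        then have "has_left {p..q} x" using ab unfolding has_left_def by (intro bexI[of _ a]) auto
        from \<delta>(3)[OF this] show ?thesis by (rule integrable_on_subinterval) (use ab in auto)
      qed (use integrable_on_refl[of F x] in auto)
      show "F integrable_on {x..b}"
      proof (cases "b = x")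
        case False
        then have "has_right {p..q} x" using ab unfolding has_right_def by (intro bexI[of _ b]) auto
        from \<delta>(2)[OF this] show ?thesis by (rule integrable_on_subinterval) (use ab in auto)
      qed (use integrable_on_refl[of F x] in auto)
    qed
    then show "\<exists>d>0. \<forall>a b. a \<le> x \<and> x \<le> b \<and> b - a < d \<longrightarrow> ?P a b"
      by (intro exI[of _ \<delta>] conjI \<delta>(1)) simp
  qed
  then show ?thesis using pq by simp
qed

text \<open>Replaces the existentially quantified cut-off by the distance to the endpoints, so that
  expressions for different functions at the same point can be combined.\<close>

lemma has_LD1_interval_iff:
  assumes F: "F integrable_on {p..q}" and t: "t \<in> {p..q}" and pq: "p < q"
  shows "has_LD1 F {p..q} t L \<longleftrightarrow>
    (t < q \<longrightarrow> (lapR1 F t (q - t) \<longlongrightarrow> L) at_top) \<and>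
    (p < t \<longrightarrow> (lapR1 (reflect F) (- t) (t - p) \<longlongrightarrow> L) at_top)"
proof -
  have sides: "has_right {p..q} t \<longleftrightarrow> t < q" "has_left {p..q} t \<longleftrightarrow> p < t"
    using t by (auto simp: has_right_def has_left_def)
  have R: "(lapR1 F t (q - t) \<longlongrightarrow> L) at_top \<longleftrightarrow> (lapR1 F t \<delta> \<longlongrightarrow> L) at_top"
    if "0 < \<delta>" "\<delta> \<le> q - t" for \<delta>
    by (rule lapR1_tendsto_cutoff_iff) (use that t in \<open>auto intro: integrable_on_subinterval[OF F]\<close>)
  have L: "(lapR1 (reflect F) (- t) (t - p) \<longlongrightarrow> L) at_top \<longleftrightarrow> (lapL1 F t \<delta> \<longlongrightarrow> L) at_top"
    if "0 < \<delta>" "\<delta> \<le> t - p" for \<delta>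
  proof -
    have "F integrable_on {p..t}" using t by (auto intro: integrable_on_subinterval[OF F])
    then have "reflect F integrable_on {- t..- t + (t - p)}" using integrable_reflect[of F t p] by simp
    from lapR1_tendsto_cutoff_iff[OF this that] show ?thesis
      by (simp add: lapL1_eq_lapR1_reflect[abs_def])
  qed
  show ?thesis
  proof
    assume *: "has_LD1 F {p..q} t L"
    then obtain \<delta> where \<delta>: "\<delta> > 0"
      "t < q \<longrightarrow> {t..t + \<delta>} \<subseteq> {p..q} \<and> (lapR1 F t \<delta> \<longlongrightarrow> L) at_top"
      "p < t \<longrightarrow> {t - \<delta>..t} \<subseteq> {p..q} \<and> (lapL1 F t \<delta> \<longlongrightarrow> L) at_top"
      unfolding has_LD1_def sides by blast
    show "(t < q \<longrightarrow> (lapR1 F t (q - t) \<longlongrightarrow> L) at_top) \<and>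
      (p < t \<longrightarrow> (lapR1 (reflect F) (- t) (t - p) \<longlongrightarrow> L) at_top)"
    proof (intro conjI impI)
      assume "t < q"
      then show "(lapR1 F t (q - t) \<longlongrightarrow> L) at_top" using R[OF \<delta>(1)] \<delta>(1,2) by auto
    next
      assume "p < t"
      then show "(lapR1 (reflect F) (- t) (t - p) \<longlongrightarrow> L) at_top" using L[OF \<delta>(1)] \<delta>(1,3) by auto
    qed
  next
    assume *: "(t < q \<longrightarrow> (lapR1 F t (q - t) \<longlongrightarrow> L) at_top) \<and>
      (p < t \<longrightarrow> (lapR1 (reflect F) (- t) (t - p) \<longlongrightarrow> L) at_top)"
    \<comment> \<open>A missing side is given the harmless value \<open>q - p\<close>, so that the
      minimum stays positive and is governed by the sides that exist.\<close>
    define \<delta> where "\<delta> = min (if t < q then q - t else q - p) (if p < t then t - p else q - p)"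
    have \<delta>: "\<delta> > 0" "t < q \<Longrightarrow> \<delta> \<le> q - t" "p < t \<Longrightarrow> \<delta> \<le> t - p" using pq by (auto simp: \<delta>_def)
    show "has_LD1 F {p..q} t L"
      unfolding has_LD1_def sides
    proof (intro conjI exI[of _ \<delta>] impI t \<delta>(1))
      show "t < q \<or> p < t" using t pq by auto
      show sub: "{t..t + \<delta>} \<subseteq> {p..q}" if "t < q" using \<delta>(2)[OF that] t by auto
      show "F integrable_on {t..t + \<delta>}" if "t < q" using sub[OF that] integrable_on_subinterval[OF F] by blast
      show "(lapR1 F t \<delta> \<longlongrightarrow> L) at_top" if "t < q" using R[OF \<delta>(1) \<delta>(2)[OF that]] * that by simp
      show sub: "{t - \<delta>..t} \<subseteq> {p..q}" if "p < t" using \<delta>(3)[OF that] t by auto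
      show "F integrable_on {t - \<delta>..t}" if "p < t" using sub[OF that] integrable_on_subinterval[OF F] by blast
      show "(lapL1 F t \<delta> \<longlongrightarrow> L) at_top" if "p < t" using L[OF \<delta>(1) \<delta>(3)[OF that]] * that by simp
    qed
  qed
qed

text \<open>Monotonicity applied to \<open>G - F\<close>: being Laplace differentiable,
  \<open>F\<close> is Laplace continuous from both sides, and the right derivate of the difference
  is nonnegative because that of \<open>F\<close> is an exact limit. It thus applies to solutions,
  of which neither continuity nor boundedness is known.\<close>

lemma has_LD1_increment_le:
  assumes F: "F integrable_on {p..q}"
    and right: "\<And>t. p \<le> t \<Longrightarrow> t < q \<Longrightarrow> (lapR1 F t (q - t) \<longlongrightarrow> L t) at_top"
    and left: "\<And>t. p < t \<Longrightarrow> t \<le> q \<Longrightarrow> (lapR1 (reflect F) (- t) (t - p) \<longlongrightarrow> L t) at_top"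
    and G: "continuous_on {p..q} G" and cd: "p \<le> c" "c \<le> d" "d \<le> q"
    and ge: "\<And>t. c \<le> t \<Longrightarrow> t < d \<Longrightarrow> right_LD_ge G t (q - t) (L t)"
  shows "F d - F c \<le> G d - G c"
proof -
  have Gi: "G integrable_on {a..b}" if "p \<le> a" "b \<le> q" for a b
    using G that by (auto intro!: integrable_continuous_real intro: continuous_on_subset)
  have Fi: "F integrable_on {a..b}" if "p \<le> a" "b \<le> q" for a b
    by (rule integrable_on_subinterval[OF F]) (use that in auto)
  have Fr: "reflect F integrable_on {- b..- b + (b - a)}" if "p \<le> a" "b \<le> q" for a b
    using integrable_reflect[of F b a] Fi[OF that] by simp
  have "- F c + G c \<le> - F d + G d"
  proof (rule LD_nonneg_imp_le[of "\<lambda>t. - F t + G t", OF _ _ _ _ cd(2)])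
    show "(\<lambda>t. - F t + G t) integrable_on {c..d}"
      using cd by (intro integrable_add integrable_neg Fi Gi) auto
  next
    fix x assume x: "c \<le> x" "x < d"
    have mF: "(\<lambda>t. - F t) integrable_on {x..x + (q - x)}" and Fx: "F integrable_on {x..x + (q - x)}"
      using Fi[of x q] x cd by (auto intro: integrable_neg)
    have "right_lap_cont F x (d - x)"
      using right_lap_cont_of_tendsto[OF right[of x]] right_lap_cont_cutoff_iff[OF Fx, of "d - x"] x cd by auto
    from right_lap_cont_cmult[OF this, of "-1"] have "right_lap_cont (\<lambda>t. - F t) x (d - x)" by simp
    moreover have "right_lap_cont G x (d - x)"
      using x cd continuous_on_subset[OF G] by (intro right_lap_cont_continuous) auto
    ultimately show "right_lap_cont (\<lambda>t. - F t + G t) x (d - x)"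
      using x cd Fi[of x d] Gi[of x d]
      by (intro right_lap_cont_add) (auto intro: integrable_neg)
    have "right_LD_ge (\<lambda>t. - F t + G t) x (q - x) (- L x + L x)"
      using right[of x] ge[of x] x cd Gi[of x q] unfolding lapR1_tendsto_iff
      by (intro right_LD_ge_add mF) auto
    then have "right_LD_ge (\<lambda>t. - F t + G t) x (q - x) 0" by simp
    moreover have "(\<lambda>t. - F t + G t) integrable_on {x..x + (q - x)}"
      using Gi[of x q] x cd by (intro integrable_add mF) auto
    ultimately show "right_LD_ge (\<lambda>t. - F t + G t) x (d - x) 0"
      using right_LD_ge_cutoff_iff[of _ x "q - x" "d - x"] x cd by auto
  next
    fix x assume x: "c < x" "x \<le> d"
    have r: "reflect (\<lambda>t. - F t + G t) = (\<lambda>t. (-1) * reflect F t + reflect G t)"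
      by (auto simp: reflect_def)
    have F': "right_lap_cont (\<lambda>t. (-1) * reflect F t) (- x) (x - c)"
      using right_lap_cont_of_tendsto[OF left[of x]] right_lap_cont_cutoff_iff[OF Fr[of p x], of "x - c"] x cd
      by (intro right_lap_cont_cmult) auto
    have G': "continuous_on {- x..- x + (x - c)} (reflect G)"
      unfolding reflect_def
      by (intro continuous_on_minus continuous_on_compose2[OF G]) (use x cd in \<open>auto intro!: continuous_intros\<close>)
    show "right_lap_cont (reflect (\<lambda>t. - F t + G t)) (- x) (x - c)"
      unfolding r
    proof (rule right_lap_cont_add[OF _ _ F'])
      show "(\<lambda>t. (-1) * reflect F t) integrable_on {- x..- x + (x - c)}"
        using x cd by (intro integrable_on_mult_right Fr) auto
      show "reflect G integrable_on {- x..- x + (x - c)}"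
        using G' by (rule integrable_continuous_real)
      show "right_lap_cont (reflect G) (- x) (x - c)"
        using G' x by (intro right_lap_cont_continuous) auto
    qed
  qed
  then show ?thesis by simp
qed

section \<open>The initial value problem\<close>

lemma norm_n_inf_bounds:
  fixes z :: "real \<Rightarrow> real ^ 'n"
  assumes I: "t0 \<in> I" and le: "\<And>t i. t \<in> I \<Longrightarrow> \<bar>z t $ i\<bar> \<le> K"
  shows "0 \<le> norm_n_inf I z" "norm_n_inf I z \<le> K"
proof -
  have sup: "(SUP t\<in>I. \<bar>z t $ i\<bar>) \<le> K" "0 \<le> (SUP t\<in>I. \<bar>z t $ i\<bar>)" for i
  proof -
    show "(SUP t\<in>I. \<bar>z t $ i\<bar>) \<le> K" using I le by (intro cSUP_least) auto
    have "\<bar>z t0 $ i\<bar> \<le> (SUP t\<in>I. \<bar>z t $ i\<bar>)"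
      using I le by (intro cSUP_upper bdd_aboveI2) auto
    then show "0 \<le> (SUP t\<in>I. \<bar>z t $ i\<bar>)" by linarith
  qed
  show "norm_n_inf I z \<le> K" unfolding norm_n_inf_def using sup(1) by (intro Max.boundedI) auto
  \<comment> \<open>\<open>undefined\<close> serves as an arbitrary index, index types being
    nonempty.\<close>
  have "(SUP t\<in>I. \<bar>z t $ undefined\<bar>) \<le> norm_n_inf I z"
    unfolding norm_n_inf_def by (intro Max_ge) auto
  then show "0 \<le> norm_n_inf I z" using sup(2)[of undefined] by linarith
qed

text \<open>Source of the dimension factor in the smallness condition: increments are estimated by
  components, but compared in the Euclidean norm.\<close>

lemma norm_vec_le:
  fixes z :: "real ^ 'n"
  assumes "\<And>i. \<bar>z $ i\<bar> \<le> K"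
  shows "norm z \<le> real CARD('n) * K"
proof -
  have "norm z \<le> (\<Sum>i\<in>UNIV. \<bar>z $ i\<bar>)" by (rule norm_le_l1_cart)
  also have "\<dots> \<le> (\<Sum>i\<in>(UNIV :: 'n set). K)" by (intro sum_mono assms)
  finally show ?thesis by simp
qed

text \<open>The interval is already short enough for both existence and uniqueness:
  \<open>small\<close> provides the contraction constant and the absorption factor. Absolute values
  appear because \<open>v\<close> carries no sign condition.\<close>

locale laplace_ivp =
  fixes I U :: "real set" and f :: "real \<Rightarrow> real ^ 'n \<Rightarrow> real ^ 'n" and v :: "real \<Rightarrow> real"
    and p q :: real
  assumes I: "is_interval I"
    and A: "\<And>x i. x \<in> BLCn I \<Longrightarrow> laplace_continuous_on (\<lambda>t. f t (x t) $ i) I"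
    and UI: "U \<subseteq> I" and v: "v absolutely_integrable_on U"
    and B: "\<And>i x y. x \<in> BLCn I \<Longrightarrow> y \<in> BLCn I \<Longrightarrow>
              (AE t in lebesgue. t \<in> U \<longrightarrow>
                 \<bar>f t (x t) $ i - f t (y t) $ i\<bar> \<le> v t * norm_n_inf I (\<lambda>t. x t - y t))"
    and pq: "p < q" and sub: "{p..q} \<subseteq> U"
    and small: "real CARD('n) * integral {p..q} (\<lambda>t. \<bar>v t\<bar>) \<le> 1 / 2"
begin

definition \<Phi> :: "real \<Rightarrow> real" where "\<Phi> t = integral {p..t} (\<lambda>t. \<bar>v t\<bar>)"

lemma pqI: "{p..q} \<subseteq> I" using sub UI by blast

lemma abs_v: "(\<lambda>t. \<bar>v t\<bar>) absolutely_integrable_on {a..b}" if "p \<le> a" "b \<le> q"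
proof -
  have "v absolutely_integrable_on {a..b}"
    by (rule set_integrable_subset[OF v]) (use that sub in auto)
  then show ?thesis by (simp add: set_integrable_abs)
qed

lemma abs_v_integrable: "p \<le> a \<Longrightarrow> b \<le> q \<Longrightarrow> (\<lambda>t. \<bar>v t\<bar>) integrable_on {a..b}"
  using abs_v set_lebesgue_integral_eq_integral(1) by blast

lemma \<Phi>_diff: "p \<le> a \<Longrightarrow> a \<le> b \<Longrightarrow> b \<le> q \<Longrightarrow> integral {a..b} (\<lambda>t. \<bar>v t\<bar>) = \<Phi> b - \<Phi> a"
  using Henstock_Kurzweil_Integration.integral_combine[of p a b "\<lambda>t. \<bar>v t\<bar>"] abs_v_integrable[of p b]
  by (simp add: \<Phi>_def)

lemma \<Phi>_mono: "p \<le> a \<Longrightarrow> a \<le> b \<Longrightarrow> b \<le> q \<Longrightarrow> \<Phi> a \<le> \<Phi> b"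
  using \<Phi>_diff[of a b] Henstock_Kurzweil_Integration.integral_nonneg[OF abs_v_integrable, of a b] by simp

lemma \<Phi>_p: "\<Phi> p = 0" by (simp add: \<Phi>_def)

lemma \<Phi>_small: "real CARD('n) * \<Phi> q \<le> 1 / 2" using small by (simp add: \<Phi>_def)

lemma \<Phi>_continuous: "continuous_on {p..q} \<Phi>"
  unfolding \<Phi>_def by (intro indefinite_integral_continuous_1 abs_v_integrable) auto

lemma continuous_BLCn:
  assumes "continuous_on I x" "bounded (x ` I)" shows "x \<in> BLCn I"
proof -
  have "(\<lambda>t. x t $ i) \<in> BLC I" for i
  proof -
    have "continuous_on I (\<lambda>t. x t $ i)" using assms(1) by (intro continuous_intros)
    then have "laplace_continuous_on (\<lambda>t. x t $ i) I"
      using pqI pq by (intro continuous_imp_laplace_continuous_on[OF I, of p q]) auto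
    moreover have "bounded ((\<lambda>t. x t $ i) ` I)"
      using bounded_component_cart[OF assms(2), of i] by (simp add: image_image)
    ultimately show ?thesis by (simp add: BLC_def)
  qed
  then show ?thesis by (simp add: BLCn_def)
qed

lemma const_BLCn: "(\<lambda>t. a) \<in> BLCn I"
  by (rule continuous_BLCn) (auto intro: bounded_subset[of "{a}"])

lemma primitive_exists:
  assumes "x \<in> BLCn I" shows "\<exists>H. laplace_primitive H (\<lambda>t. f t (x t) $ i) p q"
  by (rule laplace_continuous_on_imp_primitive[OF A[OF assms] pqI]) (use pq in simp)

text \<open>By (B), \<open>K * \<bar>v t\<bar>\<close> is a Lebesgue majorant of the difference of
  the right-hand sides off a null set, and the comparison of Laplace primitives with Lebesgue
  integrals tolerates null sets.\<close>

lemma primitive_increment_le: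
  assumes x: "x \<in> BLCn I" and y: "y \<in> BLCn I"
    and K: "\<And>t i. t \<in> I \<Longrightarrow> \<bar>x t $ i - y t $ i\<bar> \<le> K"
    and H: "laplace_primitive H (\<lambda>t. f t (x t) $ i) p q" and L: "laplace_primitive L (\<lambda>t. f t (y t) $ i) p q"
    and ab: "p \<le> a" "a \<le> b" "b \<le> q"
  shows "(H b - L b) - (H a - L a) \<le> K * (\<Phi> b - \<Phi> a)"
proof -
  have "p \<in> I" using pqI pq by auto
  have n: "0 \<le> norm_n_inf I (\<lambda>t. x t - y t)" "norm_n_inf I (\<lambda>t. x t - y t) \<le> K"
    using norm_n_inf_bounds[OF \<open>p \<in> I\<close>, of "\<lambda>t. x t - y t" K] K by auto
  have K0: "0 \<le> K" using n by linarith
  obtain N where N: "N \<in> null_sets lebesgue"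
    "{t. \<not> (t \<in> U \<longrightarrow> \<bar>f t (x t) $ i - f t (y t) $ i\<bar> \<le> v t * norm_n_inf I (\<lambda>t. x t - y t))} \<subseteq> N"
    using B[OF x y, of i] by (auto elim!: AE_E2 AE_E simp: eventually_ae_filter)
  have "laplace_primitive (\<lambda>t. H t - L t) (\<lambda>t. f t (x t) $ i - f t (y t) $ i) a b"
    using laplace_primitive_subinterval[OF laplace_primitive_diff[OF H L] ab(1,3)] .
  then have "(H b - L b) - (H a - L a) \<le> integral {a..b} (\<lambda>t. K * \<bar>v t\<bar>)"
  proof (rule laplace_primitive_le_integral)
    show "(\<lambda>t. K * \<bar>v t\<bar>) absolutely_integrable_on {a..b}"
      using abs_v[OF ab(1,3)] by simp
    show "negligible N" using N(1) by (simp add: negligible_iff_null_sets)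
    show "f t (x t) $ i - f t (y t) $ i \<le> K * \<bar>v t\<bar>" if "t \<in> {a..b}" "t \<notin> N" for t
    proof -
      have "t \<in> U" using that(1) ab sub by auto
      then have "\<bar>f t (x t) $ i - f t (y t) $ i\<bar> \<le> v t * norm_n_inf I (\<lambda>t. x t - y t)"
        using N(2) that(2) by blast
      also have "\<dots> \<le> \<bar>v t\<bar> * K"
        by (rule mult_mono) (use n in auto)
      finally show ?thesis by (simp add: mult.commute)
    qed
  qed (use K0 ab in auto)
  also have "\<dots> = K * (\<Phi> b - \<Phi> a)" using \<Phi>_diff[OF ab] by simp
  finally show ?thesis .
qed

text \<open>Testing (B) on constant functions gives a Lipschitz estimate at every point, in which the
  pointwise constant is the lower right Laplace derivate of \<open>\<Phi>\<close> instead of \<open>v t\<close>.\<close>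

lemma right_LD_ge_lipschitz:
  assumes t: "p \<le> t" "t < q"
  shows "right_LD_ge (\<lambda>s. norm (a - b) * \<Phi> s) t (q - t) \<bar>f t a $ i - f t b $ i\<bar>"
proof -
  have *: "right_LD_ge (\<lambda>s. norm (a - b) * \<Phi> s) t (q - t) (f t a $ i - f t b $ i)" for a b
  proof -
    obtain H where H: "laplace_primitive H (\<lambda>t. f t a $ i) p q"
      using primitive_exists[OF const_BLCn, of a i] by blast
    obtain L where L: "laplace_primitive L (\<lambda>t. f t b $ i) p q"
      using primitive_exists[OF const_BLCn, of b i] by blast
    define D where "D s = H s - L s" for s
    have int: "H integrable_on {t..t + (q - t)}" "L integrable_on {t..t + (q - t)}"
      by (rule integrable_cutoff[OF laplace_primitive_continuous[OF H] t(1)],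
          rule integrable_cutoff[OF laplace_primitive_continuous[OF L] t(1)])
    have "(lapR1 H t (q - t) \<longlongrightarrow> f t a $ i) at_top" "(lapR1 L t (q - t) \<longlongrightarrow> f t b $ i) at_top"
      using laplace_continuous_primitive_tendsto(1)[OF A[OF const_BLCn] pqI H t]
        laplace_continuous_primitive_tendsto(1)[OF A[OF const_BLCn] pqI L t] by auto
    then have "((\<lambda>s. lapR1 H t (q - t) s - lapR1 L t (q - t) s) \<longlongrightarrow> f t a $ i - f t b $ i) at_top"
      by (rule tendsto_diff)
    moreover have "\<forall>\<^sub>F s in at_top. lapR1 H t (q - t) s - lapR1 L t (q - t) s = lapR1 D t (q - t) s"
      using eventually_ge_at_top[of 0] unfolding D_def
      by eventually_elim (simp add: lapR1_diff[OF int])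
    ultimately have "(lapR1 D t (q - t) \<longlongrightarrow> f t a $ i - f t b $ i) at_top"
      by (rule Lim_transform_eventually)
    then have D: "right_LD_ge D t (q - t) (f t a $ i - f t b $ i)"
      unfolding lapR1_tendsto_iff by blast
    \<comment> \<open>The increment estimate keeps \<open>?E\<close> above \<open>?E t\<close> to
      the right of \<open>t\<close>, so its derivate there is nonnegative; adding back
      \<open>D\<close>, whose derivate at \<open>t\<close> is known exactly, gives the bound at this
      very point.\<close>
    let ?E = "\<lambda>s. norm (a - b) * \<Phi> s - D s"
    have contD: "continuous_on {p..q} D"
      unfolding D_def using laplace_primitive_continuous[OF H] laplace_primitive_continuous[OF L]
      by (intro continuous_intros)
    have contE: "continuous_on {p..q} ?E" by (intro continuous_intros \<Phi>_continuous contD)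
    have "right_LD_ge ?E t (q - t) 0"
    proof (rule right_LD_ge_mono_fun[OF integrable_cutoff[OF contE t(1)]])
      show "?E t \<le> ?E s" if s: "t \<le> s" "s \<le> t + (q - t)" for s
      proof -
        have "D s - D t \<le> norm (a - b) * (\<Phi> s - \<Phi> t)"
          unfolding D_def
          by (rule primitive_increment_le[OF const_BLCn const_BLCn _ H L])
            (use s t in \<open>auto simp: vector_minus_component[symmetric] simp del: vector_minus_component intro: component_le_norm_cart\<close>)
        then show ?thesis by (simp add: algebra_simps)
      qed
    qed (use t in auto)
    from right_LD_ge_add[OF integrable_cutoff[OF contE t(1)] integrable_cutoff[OF contD t(1)] this D]
    show ?thesis by simp
  qed
  show ?thesis
    using *[of a b] *[of b a] by (cases "f t b $ i \<le> f t a $ i") (auto simp: norm_minus_commute)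
qed

end

context laplace_ivp
begin

text \<open>The Picard operator acts on bounded continuous functions on the whole line, a complete
  space whose members belong to \<open>BLCn I\<close>, as (A) and (B) require. On
  \<open>{p..q}\<close> the components of a fixed point are Laplace primitives of its own right-hand
  side, so the fundamental theorem yields the equation.\<close>

lemma solution_exists:
  assumes t0: "t0 \<in> {p..q}"
  shows "\<exists>x. is_LD_solution f t0 \<alpha> {p..q} x"
proof -
  \<comment> \<open>Clamping extends a primitive on \<open>{p..q}\<close> by constants, which keeps
    it continuous and bounded on the whole line.\<close>
  define cl where "cl t = max p (min q t)" for t
  have cl: "cl t \<in> {p..q}" for t using pq by (auto simp: cl_def)
  have cl_id: "cl t = t" if "t \<in> {p..q}" for t using that by (auto simp: cl_def)
  have cont_cl: "continuous_on UNIV cl" unfolding cl_def by (intro continuous_intros)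
  let ?X = "apply_bcontfun :: (real \<Rightarrow>\<^sub>C (real ^ 'n)) \<Rightarrow> _"
  have X_BLCn: "?X X \<in> BLCn I" for X
    using apply_bcontfun[of X] unfolding bcontfun_def
    by (intro continuous_BLCn) (auto intro: continuous_on_subset bounded_subset)
  have "\<forall>X i. \<exists>H. laplace_primitive H (\<lambda>t. f t (?X X t) $ i) p q"
    using primitive_exists[OF X_BLCn] by blast
  then obtain P where P: "\<And>X i. laplace_primitive (P X i) (\<lambda>t. f t (?X X t) $ i) p q" by metis
  \<comment> \<open>Subtracting the value at \<open>t0\<close> builds in the initial condition and
    removes the free additive constant of the chosen primitive.\<close>
  define g where "g X t = \<alpha> + (\<chi> i. P X i (cl t) - P X i t0)" for X t
  have contP: "continuous_on {p..q} (P X i)" for X i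
    using P by (rule laplace_primitive_continuous)
  have contP_cl: "continuous_on UNIV (\<lambda>t. P X i (cl t))" for X i
    by (rule continuous_on_compose2[OF contP cont_cl]) (use cl in auto)
  have g_bcont: "g X \<in> bcontfun" for X
    unfolding bcontfun_def
  proof (intro CollectI conjI)
    show "continuous_on UNIV (g X)"
      unfolding g_def by (intro continuous_intros continuous_on_vec_lambda contP_cl)
    have "continuous_on {p..q} (\<lambda>t. \<alpha> + (\<chi> i. P X i t - P X i t0))"
      by (intro continuous_intros continuous_on_vec_lambda contP)
    then have "bounded ((\<lambda>t. \<alpha> + (\<chi> i. P X i t - P X i t0)) ` {p..q})"
      by (intro compact_imp_bounded compact_continuous_image) auto
    moreover have "range (g X) \<subseteq> (\<lambda>t. \<alpha> + (\<chi> i. P X i t - P X i t0)) ` {p..q}"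
      using cl by (auto simp: g_def)
    ultimately show "bounded (range (g X))" by (rule bounded_subset)
  qed
  define T where "T X = Bcontfun (g X)" for X
  have T: "?X (T X) t = g X t" for X t
    unfolding T_def by (simp add: Bcontfun_inverse g_bcont)
  have "dist (T X) (T Y) \<le> 1 / 2 * dist X Y" for X Y
  proof (rule dist_bound)
    fix t
    have comp: "\<bar>?X X t $ i - ?X Y t $ i\<bar> \<le> dist X Y" for t i
    proof -
      have "\<bar>?X X t $ i - ?X Y t $ i\<bar> \<le> norm (?X X t - ?X Y t)"
        using component_le_norm_cart[of "?X X t - ?X Y t" i] by simp
      also have "\<dots> \<le> dist X Y" using dist_bounded[of X t Y] by (simp add: dist_norm)
      finally show ?thesis .
    qed
    have inc: "\<bar>(P X i b - P Y i b) - (P X i a - P Y i a)\<bar> \<le> dist X Y * \<Phi> q"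
      if "p \<le> a" "a \<le> b" "b \<le> q" for a b i
    proof -
      have "(P X i b - P Y i b) - (P X i a - P Y i a) \<le> dist X Y * (\<Phi> b - \<Phi> a)"
        by (rule primitive_increment_le[OF X_BLCn X_BLCn comp P P that])
      moreover have "(P Y i b - P X i b) - (P Y i a - P X i a) \<le> dist X Y * (\<Phi> b - \<Phi> a)"
        by (rule primitive_increment_le[OF X_BLCn X_BLCn _ P P that])
          (use comp in \<open>auto simp: abs_minus_commute\<close>)
      moreover have "dist X Y * (\<Phi> b - \<Phi> a) \<le> dist X Y * \<Phi> q"
        using \<Phi>_mono[of p a] \<Phi>_mono[of b q] that \<Phi>_p by (intro mult_left_mono) auto
      ultimately show ?thesis by linarith
    qed
    have "\<bar>(g X t - g Y t) $ i\<bar> \<le> dist X Y * \<Phi> q" for i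
    proof -
      have eq: "(g X t - g Y t) $ i = (P X i (cl t) - P Y i (cl t)) - (P X i t0 - P Y i t0)"
        by (simp add: g_def)
      show ?thesis
        unfolding eq using inc[of "cl t" t0 i] inc[of t0 "cl t" i] cl[of t] t0
        by (cases "cl t \<le> t0") (auto simp: abs_minus_commute)
    qed
    then have "norm (g X t - g Y t) \<le> real CARD('n) * (dist X Y * \<Phi> q)" by (rule norm_vec_le)
    also have "\<dots> = (real CARD('n) * \<Phi> q) * dist X Y" by simp
    also have "\<dots> \<le> 1 / 2 * dist X Y" using \<Phi>_small by (intro mult_right_mono) auto
    finally show "dist (?X (T X) t) (?X (T Y) t) \<le> 1 / 2 * dist X Y"
      by (simp add: T dist_norm)
  qed
  then have "\<exists>!X. T X = X" by (intro banach_fix_type[of "1/2"]) auto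
  then obtain X where X: "T X = X" by blast
  have X_eq: "?X X t = g X t" for t using T[of X t] X by simp
  have X_comp: "?X X t $ i = P X i t + (\<alpha> $ i - P X i t0)" if "t \<in> {p..q}" for t i
    by (simp add: X_eq g_def cl_id[OF that])
  have "is_LD_solution f t0 \<alpha> {p..q} (?X X)"
    unfolding is_LD_solution_def
  proof (intro conjI ballI allI)
    show "?X X t0 = \<alpha>" by (simp add: vec_eq_iff X_comp[OF t0])
    fix t i assume t: "t \<in> {p..q}"
    let ?F = "\<lambda>t. ?X X t $ i"
    have H: "laplace_primitive (\<lambda>t. P X i t + (\<alpha> $ i - P X i t0)) (\<lambda>t. f t (?X X t) $ i) p q"
      by (rule laplace_primitive_add_const[OF P])
    note lim = laplace_continuous_primitive_tendsto[OF A[OF X_BLCn] pqI H]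
    have "?F integrable_on {p..q}"
      using apply_bcontfun[of X] unfolding bcontfun_def
      by (intro integrable_continuous_real continuous_intros) (auto intro: continuous_on_subset)
    then show "has_LD1 ?F {p..q} t (f t (?X X t) $ i)"
    proof (rule has_LD1_interval_iff[THEN iffD2, OF _ t pq], intro conjI impI)
      assume "t < q"
      have eq: "lapR1 ?F t (q - t) s = lapR1 (\<lambda>t. P X i t + (\<alpha> $ i - P X i t0)) t (q - t) s" for s
        by (rule lapR1_cong) (use t X_comp in auto)
      show "(lapR1 ?F t (q - t) \<longlongrightarrow> f t (?X X t) $ i) at_top"
        unfolding eq[abs_def] using lim(1)[of t] t \<open>t < q\<close> by auto
    next
      assume "p < t"
      have eq: "lapR1 (reflect ?F) (- t) (t - p) s =
          lapR1 (reflect (\<lambda>t. P X i t + (\<alpha> $ i - P X i t0))) (- t) (t - p) s" for s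
        by (rule lapR1_cong) (use t X_comp in \<open>auto simp: reflect_def\<close>)
      show "(lapR1 (reflect ?F) (- t) (t - p) \<longlongrightarrow> f t (?X X t) $ i) at_top"
        unfolding eq[abs_def] using lim(2)[of t] t \<open>p < t\<close> by auto
    qed
  qed
  then show ?thesis by blast
qed

text \<open>Two solutions need not be continuous or bounded. Their difference \<open>z\<close> satisfies a Harnack
  inequality on intervals where it is bounded; since the Laplace averages of \<open>z\<close> are continuous and
  converge to \<open>z\<close>, Baire's theorem excludes points near which \<open>z\<close> is unbounded.\<close>

lemma solution_unique:
  assumes x: "is_LD_solution f t0 \<alpha> {p..q} x" and y: "is_LD_solution f t0 \<alpha> {p..q} y"
    and t0: "t0 \<in> {p..q}" and t: "t \<in> {p..q}"
  shows "y t = x t"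
proof -
  define F where "F i s = x s $ i - y s $ i" for i s
  define g where "g i s = f s (x s) $ i - f s (y s) $ i" for i s
  define z where "z s = x s - y s" for s
  have z_comp: "z s $ i = F i s" for s i by (simp add: z_def F_def)
  have LD: "has_LD1 (\<lambda>s. x s $ i) {p..q} s (f s (x s) $ i)" "has_LD1 (\<lambda>s. y s $ i) {p..q} s (f s (y s) $ i)"
    if "s \<in> {p..q}" for s i
    using x y that unfolding is_LD_solution_def by auto
  have int: "(\<lambda>s. x s $ i) integrable_on {p..q}" "(\<lambda>s. y s $ i) integrable_on {p..q}" for i
    using has_LD1_imp_integrable[OF LD(1)] has_LD1_imp_integrable[OF LD(2)] pq by auto
  have F_int: "F i integrable_on {p..q}" for i
    unfolding F_def using int by (rule integrable_diff)
  have F_right: "(lapR1 (F i) s (q - s) \<longlongrightarrow> g i s) at_top" if s: "p \<le> s" "s < q" for i s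
  proof (rule Lim_transform_eventually)
    have "s \<in> {p..q}" using s by simp
    then show "((\<lambda>u. lapR1 (\<lambda>s. x s $ i) s (q - s) u - lapR1 (\<lambda>s. y s $ i) s (q - s) u) \<longlongrightarrow> g i s) at_top"
      unfolding g_def using LD[of s i] has_LD1_interval_iff[OF int(1) _ pq, of s] has_LD1_interval_iff[OF int(2) _ pq, of s] s
      by (intro tendsto_diff) blast+
    have i: "(\<lambda>s. x s $ i) integrable_on {s..s + (q - s)}" "(\<lambda>s. y s $ i) integrable_on {s..s + (q - s)}"
      using s by (auto intro: integrable_on_subinterval[OF int(1)] integrable_on_subinterval[OF int(2)])
    show "\<forall>\<^sub>F u in at_top. lapR1 (\<lambda>s. x s $ i) s (q - s) u - lapR1 (\<lambda>s. y s $ i) s (q - s) u = lapR1 (F i) s (q - s) u"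
      using eventually_ge_at_top[of 0] unfolding F_def
      by eventually_elim (simp add: lapR1_diff[OF i])
  qed
  have F_left: "(lapR1 (reflect (F i)) (- s) (s - p) \<longlongrightarrow> g i s) at_top" if s: "p < s" "s \<le> q" for i s
  proof (rule Lim_transform_eventually)
    have "s \<in> {p..q}" using s by simp
    then show "((\<lambda>u. lapR1 (reflect (\<lambda>s. x s $ i)) (- s) (s - p) u - lapR1 (reflect (\<lambda>s. y s $ i)) (- s) (s - p) u) \<longlongrightarrow> g i s) at_top"
      unfolding g_def using LD[of s i] has_LD1_interval_iff[OF int(1) _ pq, of s] has_LD1_interval_iff[OF int(2) _ pq, of s] s
      by (intro tendsto_diff) blast+
    have "(\<lambda>s. x s $ i) integrable_on {p..s}" "(\<lambda>s. y s $ i) integrable_on {p..s}"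
      using s by (auto intro: integrable_on_subinterval[OF int(1)] integrable_on_subinterval[OF int(2)])
    then have i: "reflect (\<lambda>s. x s $ i) integrable_on {- s..- s + (s - p)}" "reflect (\<lambda>s. y s $ i) integrable_on {- s..- s + (s - p)}"
      using integrable_reflect[of "\<lambda>s. x s $ i" s p] integrable_reflect[of "\<lambda>s. y s $ i" s p] by auto
    have r: "reflect (F i) = (\<lambda>u. reflect (\<lambda>s. x s $ i) u - reflect (\<lambda>s. y s $ i) u)"
      by (auto simp: reflect_def F_def)
    show "\<forall>\<^sub>F u in at_top. lapR1 (reflect (\<lambda>s. x s $ i)) (- s) (s - p) u - lapR1 (reflect (\<lambda>s. y s $ i)) (- s) (s - p) u
        = lapR1 (reflect (F i)) (- s) (s - p) u"
      using eventually_ge_at_top[of 0] unfolding r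
      by eventually_elim (simp add: lapR1_diff[OF i])
  qed
  \<comment> \<open>Where \<open>norm (z s) \<le> K\<close>, the pointwise Lipschitz estimate bounds
    the lower derivate of \<open>K * \<Phi>\<close> below by \<open>\<bar>g i s\<bar>\<close>, so
    \<open>K * \<Phi>\<close> dominates the increments of both \<open>F i\<close> and
    \<open>- F i\<close>.\<close>
  have increment: "\<bar>F i d - F i c\<bar> \<le> K * \<Phi> q"
    if cd: "p \<le> c" "c \<le> d" "d \<le> q" and K: "\<And>s. c \<le> s \<Longrightarrow> s \<le> d \<Longrightarrow> norm (z s) \<le> K" for i c d K
  proof -
    have K0: "0 \<le> K" using K[of c] cd norm_ge_zero order_trans by blast
    let ?G = "\<lambda>s. K * \<Phi> s"
    have contG: "continuous_on {p..q} ?G" by (intro continuous_intros \<Phi>_continuous)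
    have ge: "right_LD_ge ?G s (q - s) \<bar>g i s\<bar>" if s: "c \<le> s" "s < d" for s
    proof -
      have "right_LD_ge (\<lambda>u. norm (z s) * \<Phi> u) s (q - s) \<bar>g i s\<bar>"
        using right_LD_ge_lipschitz[of s "x s" "y s" i] s cd by (simp add: z_def g_def)
      moreover have int: "(\<lambda>u. k * \<Phi> u) integrable_on {s..s + (q - s)}" for k
        using s cd by (intro integrable_on_mult_right integrable_cutoff[OF \<Phi>_continuous]) auto
      \<comment> \<open>\<open>K\<close> is split as \<open>norm (z s) + (K - norm (z s))\<close>:
        the first part carries the derivate bound, the second is a nonnegative multiple of the
        nondecreasing \<open>\<Phi>\<close>.\<close>
      moreover have "right_LD_ge (\<lambda>u. (K - norm (z s)) * \<Phi> u) s (q - s) 0"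
        by (rule right_LD_ge_mono_fun[OF int])
          (use K[of s] s cd \<Phi>_mono in \<open>auto intro!: mult_left_mono\<close>)
      ultimately have "right_LD_ge (\<lambda>u. norm (z s) * \<Phi> u + (K - norm (z s)) * \<Phi> u) s (q - s) (\<bar>g i s\<bar> + 0)"
        by (intro right_LD_ge_add)
      then show ?thesis by (simp add: algebra_simps)
    qed
    have "F i d - F i c \<le> ?G d - ?G c"
      by (rule has_LD1_increment_le[OF F_int F_right F_left contG cd])
        (use right_LD_ge_mono[OF ge] in auto)
    moreover have "- F i d - - F i c \<le> ?G d - ?G c"
    proof (rule has_LD1_increment_le[OF integrable_neg[OF F_int] _ _ contG cd])
      show "(lapR1 (\<lambda>s. - F i s) s (q - s) \<longlongrightarrow> - g i s) at_top" if "p \<le> s" "s < q" for s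
        unfolding lapR1_uminus[abs_def] by (intro tendsto_minus F_right that)
      have r: "reflect (\<lambda>s. - F i s) = (\<lambda>s. - reflect (F i) s)" by (simp add: reflect_def)
      show "(lapR1 (reflect (\<lambda>s. - F i s)) (- s) (s - p) \<longlongrightarrow> - g i s) at_top" if "p < s" "s \<le> q" for s
        unfolding r lapR1_uminus[abs_def] by (intro tendsto_minus F_left that)
      show "right_LD_ge ?G s (q - s) (- g i s)" if "c \<le> s" "s < d" for s
        using right_LD_ge_mono[OF ge[OF that]] by simp
    qed
    moreover have "?G d - ?G c \<le> K * \<Phi> q"
    proof -
      have "K * (\<Phi> d - \<Phi> c) \<le> K * \<Phi> q"
        using \<Phi>_mono[of p c] \<Phi>_mono[of d q] cd \<Phi>_p K0 by (intro mult_left_mono) auto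
      then show ?thesis by (simp add: right_diff_distrib)
    qed
    ultimately show ?thesis by linarith
  qed
  \<comment> \<open>For \<open>K\<close> the supremum of \<open>norm z\<close>, smallness bounds the
    distance of \<open>z\<close> from \<open>z a\<close> by \<open>K / 2\<close>, so
    \<open>K \<le> norm (z a) + K / 2\<close>. Boundedness makes \<open>K\<close> finite, so that
    \<open>K / 2\<close> can be absorbed.\<close>
  have harnack: "norm (z b) \<le> 2 * norm (z a)"
    if cd: "p \<le> c" "d \<le> q" and bdd: "bounded (z ` {c..d})" and ab: "a \<in> {c..d}" "b \<in> {c..d}" for a b c d
  proof -
    define K where "K = (SUP s\<in>{c..d}. norm (z s))"
    have "bdd_above ((\<lambda>s. norm (z s)) ` {c..d})"
      using bdd by (auto simp: bounded_iff bdd_above_def)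
    then have K: "norm (z s) \<le> K" if "s \<in> {c..d}" for s
      unfolding K_def using that by (intro cSUP_upper)
    have "norm (z s - z a) \<le> K / 2" if s: "s \<in> {c..d}" for s
    proof -
      have "\<bar>(z s - z a) $ i\<bar> \<le> K * \<Phi> q" for i
        using increment[of a s K i] increment[of s a K i] K s ab cd
        by (cases "a \<le> s") (auto simp: z_comp abs_minus_commute)
      then have "norm (z s - z a) \<le> real CARD('n) * (K * \<Phi> q)" by (rule norm_vec_le)
      also have "\<dots> = (real CARD('n) * \<Phi> q) * K" by simp
      also have "\<dots> \<le> 1 / 2 * K"
        using \<Phi>_small K[OF ab(1)] norm_ge_zero[of "z a"] by (intro mult_right_mono) linarith+
      finally show ?thesis by simp
    qed
    then have "norm (z s) \<le> norm (z a) + K / 2" if "s \<in> {c..d}" for s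
      using norm_triangle_sub[of "z s" "z a"] that by fastforce
    then have "K \<le> norm (z a) + K / 2"
      unfolding K_def using ab by (intro cSUP_least) auto
    then show ?thesis using K[OF ab(2)] by linarith
  qed
  \<comment> \<open>The points near which \<open>z\<close> is unbounded form a closed set; once it
    is shown to be empty, the Harnack inequality applies on all of \<open>{p..q}\<close>.\<close>
  define Q where "Q = {p..q} - \<Union>{T. open T \<and> bounded (z ` ({p..q} \<inter> T))}"
  have bdd_free: "bounded (z ` {a..b})" if ab: "p \<le> a" "b \<le> q" and free: "{a..b} \<inter> Q = {}" for a b
  proof (cases "a \<le> b")
    case True
    let ?P = "\<lambda>c d. c \<le> d \<and> {c..d} \<subseteq> {a..b} \<longrightarrow> bounded (z ` {c..d})"
    have "?P a b"
      using True
    proof (rule Bolzano[where P = ?P])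
      fix c d e assume 1: "?P c d" "?P d e" "c \<le> d" "d \<le> e"
      show "?P c e"
      proof
        assume "c \<le> e \<and> {c..e} \<subseteq> {a..b}"
        moreover have "{c..e} = {c..d} \<union> {d..e}" using 1(3,4) by auto
        ultimately show "bounded (z ` {c..e})" using 1 by (simp add: image_Un)
      qed
    next
      fix s assume s: "a \<le> s" "s \<le> b"
      then have "s \<in> {p..q}" "s \<notin> Q" using ab free by auto
      then obtain T where T: "open T" "s \<in> T" "bounded (z ` ({p..q} \<inter> T))" unfolding Q_def by blast
      obtain e where e: "e > 0" "ball s e \<subseteq> T" using T(1,2) by (rule openE)
      have "bounded (z ` {c..d})" if cd: "c \<le> s" "s \<le> d" "d - c < e" "{c..d} \<subseteq> {a..b}" for c d
      proof (rule bounded_subset[OF T(3)])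
        have "{c..d} \<subseteq> ball s e" using cd(1-3) by (auto simp: dist_real_def)
        moreover have "{c..d} \<subseteq> {p..q}" using cd(4) ab by auto
        ultimately show "z ` {c..d} \<subseteq> z ` ({p..q} \<inter> T)" using e(2) by blast
      qed
      then show "\<exists>e>0. \<forall>c d. c \<le> s \<and> s \<le> d \<and> d - c < e \<longrightarrow> ?P c d"
        by (intro exI[of _ e] conjI e(1)) simp
    qed
    then show ?thesis using True by simp
  qed auto
  have "Q = {}"
  proof (rule ccontr)
    assume "Q \<noteq> {}"
    have Q_sub: "Q \<subseteq> {p..q}" by (auto simp: Q_def)
    have "closed Q"
      unfolding Q_def by (intro closed_Diff open_Union) auto
    \<comment> \<open>These averages are continuous in \<open>s\<close> although their limits
      \<open>F i s\<close> need not be. At \<open>s = q\<close> the range of integration is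
      degenerate and the average is 0, so \<open>q\<close> is treated separately.\<close>
    define S where "S i u s = u * lap (\<lambda>r. F i (s + r)) (q - s) u" for i u s
    have S_cont: "continuous_on {p..q} (S i u)" if "0 \<le> u" for i u
    proof -
      have eI: "(\<lambda>r. exp (- u * r) * F i r) integrable_on {p..q}"
        using exp_mult_integrable[OF F_int that] .
      \<comment> \<open>The substitution moves the dependence on \<open>s\<close> out of the
        integrand, into an exponential factor and the lower limit, where continuity is
        visible.\<close>
      have eq: "S i u s = u * (exp (u * s) * integral {s..q} (\<lambda>r. exp (- u * r) * F i r))" for s
      proof -
        have "lap (\<lambda>r. F i (s + r)) (q - s) u = integral {0..q - s} (\<lambda>r. exp (u * s) * (exp (- u * (s + r)) * F i (s + r)))"
          unfolding lap_def
        proof (rule integral_cong)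
          fix r
          have "exp (- u * r) = exp (u * s) * exp (- u * (s + r))"
            unfolding mult_exp_exp by (simp add: algebra_simps)
          then show "exp (- u * r) * F i (s + r) = exp (u * s) * (exp (- u * (s + r)) * F i (s + r))"
            by (simp only: mult.assoc)
        qed
        also have "\<dots> = exp (u * s) * integral {0..q - s} (\<lambda>r. exp (- u * (s + r)) * F i (s + r))"
          by (rule integral_mult_right)
        also have "integral {0..q - s} (\<lambda>r. exp (- u * (s + r)) * F i (s + r)) = integral {s..q} (\<lambda>r. exp (- u * r) * F i r)"
          using integral_shift[of 0 "q - s" "\<lambda>r. exp (- u * r) * F i r" s]
          by (simp only: add_0_right add_diff_cancel_left' diff_add_cancel add_diff_eq)
        finally show ?thesis by (simp add: S_def)
      qed
      show ?thesis
        unfolding eq[abs_def] by (intro continuous_intros indefinite_integral_continuous_1' eI)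
    qed
    have S_lim: "((\<lambda>u. S i u s) \<longlongrightarrow> F i s) at_top" if s: "p \<le> s" "s < q" for i s
    proof (rule Lim_transform_eventually)
      have "F i integrable_on {s..s + (q - s)}" using s by (auto intro: integrable_on_subinterval[OF F_int])
      note sh = integrable_shift_diff[OF this]
      have d: "0 < q - s" using s by simp
      have "((\<lambda>u. u * lap (\<lambda>r. F i (s + r) - F i s) (q - s) u + u * lap (\<lambda>r. F i s) (q - s) u) \<longlongrightarrow> 0 + F i s) at_top"
        using right_lap_cont_of_tendsto[OF F_right[OF s]] lap_const_tendsto[OF d, of "F i s"]
        unfolding right_lap_cont_iff by (rule tendsto_add)
      then show "((\<lambda>u. u * lap (\<lambda>r. F i (s + r) - F i s) (q - s) u + u * lap (\<lambda>r. F i s) (q - s) u) \<longlongrightarrow> F i s) at_top"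
        by simp
      show "\<forall>\<^sub>F u in at_top. u * lap (\<lambda>r. F i (s + r) - F i s) (q - s) u + u * lap (\<lambda>r. F i s) (q - s) u = S i u s"
        using eventually_ge_at_top[of 0]
      proof eventually_elim
        case (elim u)
        have "lap (\<lambda>r. (F i (s + r) - F i s) + F i s) (q - s) u = lap (\<lambda>r. F i (s + r) - F i s) (q - s) u + lap (\<lambda>r. F i s) (q - s) u"
          by (rule lap_add[OF sh _ elim]) auto
        then show ?case unfolding S_def by (simp add: algebra_simps)
      qed
    qed
    have S_q: "S i u q = 0" for i u by (simp add: S_def lap_def)
    \<comment> \<open>Continuity of the averages makes these sets closed, and their convergence at
      each point makes them cover \<open>Q\<close>.\<close>
    define E where "E m = {s \<in> Q. \<forall>i. \<forall>u\<ge>real m. \<bar>S i u s\<bar> \<le> real m}" for m :: nat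
    have E_closed: "closed (E m)" for m
    proof -
      have cl: "closed (Q \<inter> S i u -` cball 0 (real m))" if "real m \<le> u" for i u
        using that by (intro continuous_closed_preimage continuous_on_subset[OF S_cont Q_sub] \<open>closed Q\<close>) auto
      have "closed (\<Inter>i. \<Inter>u\<in>{real m..}. Q \<inter> S i u -` cball 0 (real m))"
        by (intro closed_INT ballI cl) simp
      moreover have "(\<Inter>i. \<Inter>u\<in>{real m..}. Q \<inter> S i u -` cball 0 (real m)) = E m"
        unfolding E_def by auto
      ultimately show ?thesis by simp
    qed
    have E_cover: "\<exists>m. s \<in> E m" if s: "s \<in> Q" for s
    proof (cases "s = q")
      case True
      then have "s \<in> E 0" using s S_q by (simp add: E_def)
      then show ?thesis ..
    next
      case False
      then have s': "p \<le> s" "s < q" using s Q_sub by auto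
      have "\<exists>B. \<forall>u\<ge>B. \<bar>S i u s\<bar> \<le> \<bar>F i s\<bar> + 1" for i
      proof -
        have "\<forall>\<^sub>F u in at_top. dist (S i u s) (F i s) < 1"
          using S_lim[OF s'] by (rule tendstoD) simp
        then obtain B where "\<And>u. u \<ge> B \<Longrightarrow> dist (S i u s) (F i s) < 1"
          unfolding eventually_at_top_linorder by blast
        then have "\<bar>S i u s\<bar> \<le> \<bar>F i s\<bar> + 1" if "u \<ge> B" for u
          using that unfolding dist_real_def by fastforce
        then show ?thesis by blast
      qed
      then have "\<forall>i. \<exists>B. \<forall>u\<ge>B. \<bar>S i u s\<bar> \<le> \<bar>F i s\<bar> + 1" by blast
      from choice[OF this] obtain B where B: "\<And>i u. B i \<le> u \<Longrightarrow> \<bar>S i u s\<bar> \<le> \<bar>F i s\<bar> + 1" by blast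
      \<comment> \<open>The sum over the components dominates all thresholds and all bounds at
        once.\<close>
      obtain m :: nat where m: "(\<Sum>i\<in>UNIV. \<bar>B i\<bar> + \<bar>F i s\<bar> + 1) \<le> real m" using real_arch_simple by blast
      have mi: "\<bar>B i\<bar> + \<bar>F i s\<bar> + 1 \<le> real m" for i
        using member_le_sum[of i UNIV "\<lambda>i. \<bar>B i\<bar> + \<bar>F i s\<bar> + 1"] m by auto
      have "\<bar>S i u s\<bar> \<le> real m" if "real m \<le> u" for i u
        using B[of i u] mi[of i] that by linarith
      then have "s \<in> E m" using s by (simp add: E_def)
      then show ?thesis ..
    qed
    \<comment> \<open>Otherwise all \<open>Q - E m\<close> would be relatively open and dense in
      \<open>Q\<close>, hence so would be their intersection by Baire, up to openness; but it is
      empty. So some \<open>E m\<close> contains all points of \<open>Q\<close> near some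
      \<open>s\<close>.\<close>
    have "\<exists>m. \<not> Q \<subseteq> closure (Q - E m)"
    proof (rule ccontr)
      assume "\<not> (\<exists>m. \<not> Q \<subseteq> closure (Q - E m))"
      then have dense: "Q \<subseteq> closure (Q - E m)" for m by blast
      have "Q \<subseteq> closure (\<Inter>(range (\<lambda>m. Q - E m)))"
      proof (rule Baire[OF \<open>closed Q\<close>])
        fix T assume "T \<in> range (\<lambda>m. Q - E m)"
        then obtain m where m: "T = Q - E m" by blast
        have "Q - E m = Q \<inter> - E m" by blast
        then have "openin (top_of_set Q) T" using m E_closed[of m] by (auto simp: openin_open)
        then show "openin (top_of_set Q) T \<and> Q \<subseteq> closure T" using dense m by simp
      qed auto
      moreover have "\<Inter>(range (\<lambda>m. Q - E m)) = {}" using E_cover by blast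
      ultimately have "Q \<subseteq> closure {}" by (simp only:)
      with \<open>Q \<noteq> {}\<close> show False by simp
    qed
    then obtain m s where s: "s \<in> Q" "s \<notin> closure (Q - E m)" by blast
    then have "s \<in> - closure (Q - E m)" "open (- closure (Q - E m))" by auto
    then obtain e where e: "e > 0" "ball s e \<subseteq> - closure (Q - E m)"
      using open_contains_ball by blast
    then have e_disj: "ball s e \<inter> (Q - E m) = {}" using closure_subset by blast
    \<comment> \<open>Membership in \<open>E m\<close> bounds the limits of the averages by
      \<open>m\<close> in each component; \<open>norm (z q)\<close> is included because the averages
      do not see \<open>z\<close> at \<open>q\<close>.\<close>
    define M where "M = max (real CARD('n) * real m) (norm (z q))"
    have zM: "norm (z r) \<le> M" if r: "r \<in> Q" "r \<in> ball s e" for r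
    proof (cases "r = q")
      case False
      then have r': "p \<le> r" "r < q" using r Q_sub by auto
      have "r \<in> E m" using r e_disj by blast
      then have "\<forall>\<^sub>F u in at_top. \<bar>S i u r\<bar> \<le> real m" for i
        unfolding E_def eventually_at_top_linorder by blast
      then have "\<bar>F i r\<bar> \<le> real m" for i
        using tendsto_upperbound[OF tendsto_rabs[OF S_lim[OF r']]] by simp
      then have "norm (z r) \<le> real CARD('n) * real m"
        by (intro norm_vec_le) (simp add: z_comp)
      then show ?thesis by (simp add: M_def)
    qed (simp add: M_def)
    \<comment> \<open>On a gap meeting \<open>Q\<close> at most in its endpoint \<open>w\<close>,
      the Harnack inequality on compact subintervals that avoid \<open>w\<close> and contain
      \<open>r\<close> gives the uniform bound \<open>2 * norm (z r)\<close>. Adding the single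
      value at \<open>w\<close> keeps \<open>z\<close> bounded, so the inequality extends up to
      \<open>w\<close>.\<close>
    have free: "norm (z r) \<le> 2 * norm (z w)"
      if ab: "p \<le> a" "b \<le> q" and w: "w = a \<or> w = b" and r: "r \<in> {a..b}"
        and Qw: "({a..b} - {w}) \<inter> Q = {}" for a b w r
    proof (cases "r = w")
      case False
      have le: "norm (z r') \<le> 2 * norm (z r)" if r': "r' \<in> {a..b}" "r' \<noteq> w" for r'
      proof -
        have "{min r r'..max r r'} \<subseteq> {a..b} - {w}" using r r' w False by auto
        then have "{min r r'..max r r'} \<inter> Q = {}" using Qw by blast
        then have "bounded (z ` {min r r'..max r r'})"
          using ab r r' by (intro bdd_free) auto
        then show ?thesis by (intro harnack[of "min r r'" "max r r'"]) (use ab r r' in auto)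
      qed
      have "bounded (z ` {a..b})"
        unfolding bounded_iff
      proof (intro exI[of _ "max (2 * norm (z r)) (norm (z w))"] ballI)
        fix c assume "c \<in> z ` {a..b}"
        then obtain r' where "r' \<in> {a..b}" "c = z r'" by blast
        then show "norm c \<le> max (2 * norm (z r)) (norm (z w))" using le[of r'] by (cases "r' = w") auto
      qed
      then show ?thesis by (intro harnack[of a b]) (use ab r w in auto)
    qed (simp add: norm_ge_zero)
    have "norm (z r) \<le> 2 * M" if r: "r \<in> {p..q}" "r \<in> ball s e" for r
    proof -
      have compact: "compact (Q \<inter> {a..b})" for a b using \<open>closed Q\<close> by (simp add: closed_Int_compact)
      \<comment> \<open>\<open>w\<close> is the point of \<open>Q\<close> between \<open>s\<close>
        and \<open>r\<close> nearest to \<open>r\<close>. It exists by compactness, nothing else of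
        \<open>Q\<close> lies between \<open>w\<close> and \<open>r\<close>, and \<open>w\<close>
        stays in the ball by convexity.\<close>
      have "\<exists>w\<in>Q. w \<in> ball s e \<and> norm (z r) \<le> 2 * norm (z w)"
      proof (cases "s \<le> r")
        case True
        then have "Q \<inter> {s..r} \<noteq> {}" using s by auto
        then obtain w where w: "w \<in> Q \<inter> {s..r}" "\<And>c. c \<in> Q \<inter> {s..r} \<Longrightarrow> c \<le> w"
          using compact_attains_sup[OF compact] by blast
        have "norm (z r) \<le> 2 * norm (z w)"
        proof (rule free[of w r])
          show "({w..r} - {w}) \<inter> Q = {}" using w by force
        qed (use w r Q_sub in auto)
        moreover have "w \<in> ball s e" using w(1) r(2) by (auto simp: dist_real_def)
        ultimately show ?thesis using w(1) by blast
      next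
        case False
        then have "Q \<inter> {r..s} \<noteq> {}" using s by auto
        then obtain w where w: "w \<in> Q \<inter> {r..s}" "\<And>c. c \<in> Q \<inter> {r..s} \<Longrightarrow> w \<le> c"
          using compact_attains_inf[OF compact] by blast
        have "norm (z r) \<le> 2 * norm (z w)"
        proof (rule free[of r w])
          show "({r..w} - {w}) \<inter> Q = {}" using w by force
        qed (use w r Q_sub in auto)
        moreover have "w \<in> ball s e" using w(1) r(2) by (auto simp: dist_real_def)
        ultimately show ?thesis using w(1) by blast
      qed
      then show ?thesis using zM by fastforce
    qed
    then have "bounded (z ` ({p..q} \<inter> ball s e))" unfolding bounded_iff by blast
    moreover have "s \<in> ball s e" using e(1) by simp
    ultimately show False using s(1) open_ball[of s e] unfolding Q_def by blast
  qed
  then have "bounded (z ` {p..q})" by (intro bdd_free) auto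
  then have "norm (z t) \<le> 2 * norm (z t0)" by (intro harnack[of p q]) (use t t0 in auto)
  moreover have "z t0 = 0" using x y by (simp add: z_def is_LD_solution_def)
  ultimately show ?thesis by (simp add: z_def)
qed

end

section \<open>Choice of the interval around \<open>t0\<close>\<close>

theorem theorem11p1:
  fixes I :: "real set" and t0 :: real and \<alpha> :: "real ^ 'n"
    and f :: "real \<Rightarrow> real ^ 'n \<Rightarrow> real ^ 'n"
    and U :: "real set" and v :: "real \<Rightarrow> real"
  assumes I: "is_interval I" and t0: "t0 \<in> interior I"
    and A: "\<And>x i. x \<in> BLCn I \<Longrightarrow> laplace_continuous_on (\<lambda>t. f t (x t) $ i) I"
    and U: "U \<subseteq> I" "t0 \<in> interior U"
    and v: "v absolutely_integrable_on U"
    and B: "\<And>i x y. x \<in> BLCn I \<Longrightarrow> y \<in> BLCn I \<Longrightarrow>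
              (AE t in lebesgue. t \<in> U \<longrightarrow>
                 \<bar>f t (x t) $ i - f t (y t) $ i\<bar> \<le> v t * norm_n_inf I (\<lambda>t. x t - y t))"
  shows "\<exists>a>0. {t0 - a..t0 + a} \<subseteq> U \<and>
           (\<exists>x. is_LD_solution f t0 \<alpha> {t0 - a..t0 + a} x \<and>
              (\<forall>y. is_LD_solution f t0 \<alpha> {t0 - a..t0 + a} y \<longrightarrow>
                 (\<forall>t\<in>{t0 - a..t0 + a}. y t = x t)))"
proof -
  obtain r where r: "r > 0" "cball t0 r \<subseteq> U"
    using U(2) unfolding mem_interior_cball by blast
  have rU: "{t0 - r..t0 + r} \<subseteq> U" using r(2) by (auto simp: cball_eq_atLeastAtMost)
  have av: "(\<lambda>t. \<bar>v t\<bar>) integrable_on {t0 - r..t0 + r}"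
  proof -
    have "v absolutely_integrable_on {t0 - r..t0 + r}"
      by (rule set_integrable_subset[OF v]) (use rU in auto)
    then show ?thesis using set_lebesgue_integral_eq_integral(1) set_integrable_abs by blast
  qed
  define \<Psi> where "\<Psi> t = integral {t0 - r..t} (\<lambda>t. \<bar>v t\<bar>)" for t
  have "continuous_on {t0 - r..t0 + r} \<Psi>"
    unfolding \<Psi>_def using av by (rule indefinite_integral_continuous_1)
  moreover have "t0 \<in> {t0 - r..t0 + r}" using r by simp
  \<comment> \<open>An oscillation below \<open>1 / (4 * CARD('n))\<close> towards each of the two
    endpoints bounds the integral by \<open>1 / (2 * CARD('n))\<close>, hence the weighted integral
    by 1/2.\<close>
  moreover have eps: "1 / (4 * real CARD('n)) > 0" by simp
  ultimately obtain k where k: "k > 0"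
    "\<And>t. t \<in> {t0 - r..t0 + r} \<Longrightarrow> dist t t0 < k \<Longrightarrow> dist (\<Psi> t) (\<Psi> t0) < 1 / (4 * real CARD('n))"
    unfolding continuous_on_iff by meson
  define a where "a = min r (k / 2)"
  have a: "a > 0" "a \<le> r" "a < k" using r k by (auto simp: a_def)
  have sub: "{t0 - a..t0 + a} \<subseteq> U" using rU a by auto
  have "integral {t0 - r..t0 - a} (\<lambda>t. \<bar>v t\<bar>) + integral {t0 - a..t0 + a} (\<lambda>t. \<bar>v t\<bar>) = integral {t0 - r..t0 + a} (\<lambda>t. \<bar>v t\<bar>)"
    using a by (intro Henstock_Kurzweil_Integration.integral_combine integrable_on_subinterval[OF av]) auto
  then have "integral {t0 - a..t0 + a} (\<lambda>t. \<bar>v t\<bar>) = \<Psi> (t0 + a) - \<Psi> (t0 - a)" by (simp add: \<Psi>_def)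
  also have "\<dots> \<le> 2 * (1 / (4 * real CARD('n)))"
    using k(2)[of "t0 + a"] k(2)[of "t0 - a"] a by (auto simp: dist_real_def)
  finally have "real CARD('n) * integral {t0 - a..t0 + a} (\<lambda>t. \<bar>v t\<bar>) \<le> real CARD('n) * (2 * (1 / (4 * real CARD('n))))"
    by (intro mult_left_mono) auto
  then have small: "real CARD('n) * integral {t0 - a..t0 + a} (\<lambda>t. \<bar>v t\<bar>) \<le> 1 / 2" by simp
  interpret laplace_ivp I U f v "t0 - a" "t0 + a"
    by unfold_locales (use I A U v B a sub small in auto)
  have mem: "t0 \<in> {t0 - a..t0 + a}" using a by simp
  obtain x where "is_LD_solution f t0 \<alpha> {t0 - a..t0 + a} x"
    using solution_exists[OF mem] by blast
  then show ?thesis using solution_unique[OF _ _ mem] a(1) sub by blast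
qed

end
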